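(* A bounded operator $Y\in\mathcal{B}(H^2\oplus H^2)$ satisfies $$(S\oplus S^* )Y=Y^*(S\oplus S^* )$$ if and only if $$Y=\begin{pmatrix} U^*T_{11}U & U^*\hat T_{12}U\\ U^*\hat T_{21}U & U^*T_{22}U\end{pmatrix},$$ where $$T_{11}=\begin{pmatrix} T^*_{\phi_{11}} & T_{\overline f+zf}\\ 0 & T_{\phi_{11}}\end{pmatrix},\qquad T_{22}=\begin{pmatrix} T^*_{\phi_{22}} & T_{\overline g+zg}\\ 0 & T_{\phi_{22}}\end{pmatrix}$$ for some $\phi_{11},\phi_{22}\in H^\infty$ and $f,g\in H^2$ with $\overline f+zf,\ \overline g+zg\in L^\infty$, and $$\hat T_{12}=\begin{pmatrix}0 & H_{\hat\phi_{12}}\\ 0&0\end{pmatrix},\qquad \hat T_{21}=\begin{pmatrix}0 & H^*_{\hat\phi_{12}}\\ 0&0\end{pmatrix}$$ for some $\hat\phi_{12}\in L^\infty$.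
   Context: $L^2,L^\infty$ are the square-integrable and essentially bounded functions on the unit circle $\mathbb{T}$; $H^2$ is the Hardy space, identified via boundary values with the closed subspace of $L^2$ of functions with vanishing negative Fourier coefficients; $H^\infty=L^\infty\cap H^2$; $P$ is the orthogonal projection of $L^2$ onto $H^2$. For $\phi\in L^\infty$, the Toeplitz operator is $T_\phi:H^2\to H^2$, $T_\phi h=P(\phi h)$, and the Hankel operator is $H_\phi:H^2\to H^2$, $H_\phi h=P\mathcal{J}(\phi h)$, where $\mathcal{J}:L^2\to L^2$, $(\mathcal{J}f)(z)=\overline z f(\overline z)$. $S=T_z$ is the unilateral shift on $H^2$. Every $f(z)=\sum_{n\ge0}a_nz^n\in H^2$ is written uniquely as $f(z)=f_2(z^2)+zf_1(z^2)$ with $f_2(z)=\sum_{n\ge0}a_{2n}z^n$ and $f_1(z)=\sum_{n\ge0}a_{2n+1}z^n$; $U:H^2\to H^2\oplus H^2$ is the unitary $U(f)=(f_2,f_1)$. Functions $\overline f+zf$ are understood on $\mathbb{T}$. The block matrix of $Y$ is with respect to $H^2\oplus H^2$, and $T_{11},T_{22},\hat T_{12},\hat T_{21}$ act on $H^2\oplus H^2$ (the range of $U$). *)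

theory Defs
  imports "HOL-Analysis.Analysis"
begin

section \<open>Complex inner product spaces\<close>

class complex_inner = real_inner +
  fixes scaleC :: "complex \<Rightarrow> 'a \<Rightarrow> 'a"  (infixr \<open>*\<^sub>C\<close> 75)
    and cinner :: "'a \<Rightarrow> 'a \<Rightarrow> complex"
  assumes scaleC_add_right: "a *\<^sub>C (x + y) = a *\<^sub>C x + a *\<^sub>C y"
    and scaleC_add_left: "(a + b) *\<^sub>C x = a *\<^sub>C x + b *\<^sub>C x"
    and scaleC_scaleC: "a *\<^sub>C b *\<^sub>C x = (a * b) *\<^sub>C x"
    and scaleC_of_real: "complex_of_real r *\<^sub>C x = r *\<^sub>R x"
    and cinner_commute: "cinner x y = cnj (cinner y x)"
    and cinner_add_left: "cinner (x + y) z = cinner x z + cinner y z"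
    and cinner_scaleC_left: "cinner (a *\<^sub>C x) y = a * cinner x y"
    and inner_eq_Re_cinner: "inner x y = Re (cinner x y)"

instantiation prod :: (complex_inner, complex_inner) complex_inner
begin

definition scaleC_prod_def: "scaleC a x = (a *\<^sub>C fst x, a *\<^sub>C snd x)"

definition cinner_prod_def: "cinner x y = cinner (fst x) (fst y) + cinner (snd x) (snd y)"

instance
proof
  fix x y :: "'a \<times> 'b"
  show "cinner x y = cnj (cinner y x)"
    unfolding cinner_prod_def by (simp flip: cinner_commute)
qed (simp_all add: scaleC_prod_def cinner_prod_def scaleC_add_right scaleC_add_left scaleC_scaleC
      scaleC_of_real cinner_add_left cinner_scaleC_left inner_eq_Re_cinner inner_prod_def
      scaleR_prod_def algebra_simps)

end

definition bounded_clinear :: "('a::complex_inner \<Rightarrow> 'b::complex_inner) \<Rightarrow> bool" where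
  "bounded_clinear A \<longleftrightarrow> bounded_linear A \<and> (\<forall>c x. A (c *\<^sub>C x) = c *\<^sub>C A x)"

text \<open>Junk when there is no adjoint; a bounded operator out of a complete space has exactly one.\<close>

definition cadjoint :: "('a::complex_inner \<Rightarrow> 'b::complex_inner) \<Rightarrow> 'b \<Rightarrow> 'a" where
  "cadjoint A = (THE B. \<forall>x y. cinner (A x) y = cinner x (B y))"

definition block_op ::
  "('a \<Rightarrow> 'c::plus) \<Rightarrow> ('b \<Rightarrow> 'c) \<Rightarrow> ('a \<Rightarrow> 'd::plus) \<Rightarrow> ('b \<Rightarrow> 'd) \<Rightarrow> 'a \<times> 'b \<Rightarrow> 'c \<times> 'd" where
  "block_op A B C D = (\<lambda>(x, y). (A x + B y, C x + D y))"


section \<open>The space \<open>L\<^sup>2\<close> of the unit circle\<close>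

text \<open>Normalized arc length, as a measure on the complex plane carried by the unit circle. Values
  of a function off the circle are therefore irrelevant.\<close>

definition circle :: "complex measure" where
  "circle = distr (uniform_measure lborel {-pi..pi}) borel cis"

definition sq_integrable :: "(complex \<Rightarrow> complex) \<Rightarrow> bool" where
  "sq_integrable f \<longleftrightarrow> f \<in> borel_measurable circle \<and> integrable circle (\<lambda>z. (cmod (f z))\<^sup>2)"

definition ess_bounded :: "(complex \<Rightarrow> complex) \<Rightarrow> bool" where
  "ess_bounded f \<longleftrightarrow> f \<in> borel_measurable circle \<and> (\<exists>C. AE z in circle. cmod (f z) \<le> C)"

definition L2_rel :: "(complex \<Rightarrow> complex) \<Rightarrow> (complex \<Rightarrow> complex) \<Rightarrow> bool" where
  "L2_rel f g \<longleftrightarrow> sq_integrable f \<and> sq_integrable g \<and> (AE z in circle. f z = g z)"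

lemma sets_circle [simp, measurable_cong]: "sets circle = sets borel"
  by (simp add: circle_def)

lemma space_circle [simp]: "space circle = UNIV"
  by (simp add: circle_def)

lemma cis_measurable [measurable]: "cis \<in> borel_measurable borel"
  by (intro borel_measurable_continuous_onI continuous_intros)

lemma cnj_measurable [measurable]: "cnj \<in> borel_measurable borel"
  by (intro borel_measurable_continuous_onI continuous_intros)

lemma emeasure_circle_UNIV: "emeasure circle UNIV = 1"
  by (simp add: circle_def emeasure_distr emeasure_uniform_measure space_uniform_measure
      divide_ennreal)

lemma finite_measure_circle: "finite_measure circle"
  by (rule finite_measureI) (simp add: emeasure_circle_UNIV)

lemma AE_circle_norm: "AE z in circle. cmod z = 1"
  unfolding circle_def by (subst AE_distr_iff) auto

lemma distr_circle_cnj: "distr circle borel cnj = circle"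
proof -
  have "distr circle borel cnj = distr (uniform_measure lborel {-pi..pi}) borel (cis \<circ> uminus)"
    unfolding circle_def by (subst distr_distr) (auto simp: o_def cis_cnj)
  also have "\<dots> = distr (distr (uniform_measure lborel {-pi..pi}) borel uminus) borel cis"
    by (subst distr_distr) (auto simp: o_def)
  also have "distr (uniform_measure lborel {-pi..pi}) borel uminus
      = uniform_measure lborel {-pi..pi}"
  proof (rule measure_eqI)
    fix A :: "real set"
    assume "A \<in> sets (distr (uniform_measure lborel {-pi..pi}) borel uminus)"
    then have A [measurable]: "A \<in> sets borel" by simp
    have "emeasure lborel ({-pi..pi} \<inter> uminus -` A)
        = emeasure lborel (uminus -` ({-pi..pi} \<inter> A))"
      by (rule arg_cong[where f = "emeasure lborel"]) auto
    also have "\<dots> = emeasure (distr lborel borel uminus) ({-pi..pi} \<inter> A)"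
      by (subst emeasure_distr) auto
    also have "\<dots> = emeasure lborel ({-pi..pi} \<inter> A)"
      by (simp add: lborel_distr_uminus)
    finally have eq: "emeasure lborel ({-pi..pi} \<inter> uminus -` A)
        = emeasure lborel ({-pi..pi} \<inter> A)" .
    have "uminus -` A \<in> sets borel"
      using measurable_sets[of uminus borel borel A] by simp
    then show "emeasure (distr (uniform_measure lborel {-pi..pi}) borel uminus) A
        = emeasure (uniform_measure lborel {-pi..pi}) A"
      by (simp add: emeasure_distr space_uniform_measure emeasure_uniform_measure eq)
  qed simp
  finally show ?thesis by (simp add: circle_def)
qed

lemma sq_integrable_zero: "sq_integrable (\<lambda>_. 0)"
  by (simp add: sq_integrable_def)

lemma sq_integrable_add:
  assumes "sq_integrable f" "sq_integrable g"
  shows "sq_integrable (\<lambda>z. f z + g z)"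
proof -
  have [measurable]: "f \<in> borel_measurable circle" "g \<in> borel_measurable circle"
    using assms by (auto simp: sq_integrable_def)
  have "integrable circle (\<lambda>z. 2 * (cmod (f z))\<^sup>2 + 2 * (cmod (g z))\<^sup>2)"
    using assms by (auto simp: sq_integrable_def)
  then have "integrable circle (\<lambda>z. (cmod (f z + g z))\<^sup>2)"
  proof (rule Bochner_Integration.integrable_bound)
    show "AE z in circle. norm ((cmod (f z + g z))\<^sup>2)
        \<le> norm (2 * (cmod (f z))\<^sup>2 + 2 * (cmod (g z))\<^sup>2)"
    proof (rule AE_I2)
      fix z
      have "(cmod (f z + g z))\<^sup>2 \<le> (cmod (f z) + cmod (g z))\<^sup>2"
        by (intro power_mono norm_triangle_ineq) simp
      also have "\<dots> \<le> 2 * (cmod (f z))\<^sup>2 + 2 * (cmod (g z))\<^sup>2"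
        using sum_squares_bound[of "cmod (f z)" "cmod (g z)"] by (simp add: power2_sum)
      finally show "norm ((cmod (f z + g z))\<^sup>2)
          \<le> norm (2 * (cmod (f z))\<^sup>2 + 2 * (cmod (g z))\<^sup>2)" by simp
    qed
  qed simp
  then show ?thesis by (simp add: sq_integrable_def)
qed

lemma sq_integrable_scale: "sq_integrable f \<Longrightarrow> sq_integrable (\<lambda>z. c * f z)"
  by (auto simp: sq_integrable_def norm_mult power_mult_distrib)

lemma sq_integrable_mult:
  assumes "ess_bounded f" "sq_integrable g"
  shows "sq_integrable (\<lambda>z. f z * g z)"
proof -
  have [measurable]: "f \<in> borel_measurable circle" "g \<in> borel_measurable circle"
    using assms by (auto simp: sq_integrable_def ess_bounded_def)
  obtain C where C: "AE z in circle. cmod (f z) \<le> C"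
    using assms by (auto simp: ess_bounded_def)
  have "integrable circle (\<lambda>z. C\<^sup>2 * (cmod (g z))\<^sup>2)"
    using assms by (auto simp: sq_integrable_def)
  then have "integrable circle (\<lambda>z. (cmod (f z * g z))\<^sup>2)"
  proof (rule Bochner_Integration.integrable_bound)
    show "AE z in circle. norm ((cmod (f z * g z))\<^sup>2) \<le> norm (C\<^sup>2 * (cmod (g z))\<^sup>2)"
      using C by eventually_elim
        (auto simp: norm_mult power_mult_distrib intro!: mult_right_mono power_mono)
  qed simp
  then show ?thesis by (simp add: sq_integrable_def)
qed

lemma sq_integrable_prod:
  assumes "sq_integrable f" "sq_integrable g"
  shows "integrable circle (\<lambda>z. f z * cnj (g z))"
proof -
  have [measurable]: "f \<in> borel_measurable circle" "g \<in> borel_measurable circle"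
    using assms by (auto simp: sq_integrable_def)
  have "integrable circle (\<lambda>z. (cmod (f z))\<^sup>2 + (cmod (g z))\<^sup>2)"
    using assms by (auto simp: sq_integrable_def)
  then show ?thesis
  proof (rule Bochner_Integration.integrable_bound)
    show "AE z in circle. norm (f z * cnj (g z)) \<le> norm ((cmod (f z))\<^sup>2 + (cmod (g z))\<^sup>2)"
    proof (rule AE_I2)
      fix z
      have "cmod (f z) * cmod (g z) \<le> 2 * cmod (f z) * cmod (g z)"
        by simp
      also have "\<dots> \<le> (cmod (f z))\<^sup>2 + (cmod (g z))\<^sup>2"
        by (rule sum_squares_bound)
      finally show "norm (f z * cnj (g z)) \<le> norm ((cmod (f z))\<^sup>2 + (cmod (g z))\<^sup>2)"
        by (simp add: norm_mult)
    qed
  qed simp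
qed

lemma sq_integrable_reflect:
  assumes "sq_integrable f"
  shows "sq_integrable (\<lambda>z. cnj z * f (cnj z))"
proof -
  have [measurable]: "f \<in> borel_measurable borel"
    using assms measurable_cong_sets[OF sets_circle refl] by (auto simp: sq_integrable_def)
  have "integrable (distr circle borel cnj) (\<lambda>z. (cmod (f z))\<^sup>2)"
    using assms by (simp add: distr_circle_cnj sq_integrable_def)
  then have *: "integrable circle (\<lambda>z. (cmod (f (cnj z)))\<^sup>2)"
    by (subst (asm) integrable_distr_eq) auto
  have "integrable circle (\<lambda>z. (cmod (cnj z * f (cnj z)))\<^sup>2)"
    using * by (rule integrable_cong_AE_imp) (use AE_circle_norm in
        \<open>auto simp: norm_mult elim!: eventually_mono\<close>)
  then show ?thesis by (simp add: sq_integrable_def)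
qed

lemma sq_integrable_cnj: "sq_integrable f \<Longrightarrow> sq_integrable (\<lambda>z. cnj (f z))"
  by (auto simp: sq_integrable_def)

lemma AE_circle_cnj:
  assumes [measurable]: "Measurable.pred borel Q" and "AE z in circle. Q z"
  shows "AE z in circle. Q (cnj z)"
proof -
  have "AE z in distr circle borel cnj. Q z"
    using assms(2) by (subst distr_circle_cnj)
  then show ?thesis
    by (subst (asm) AE_distr_iff) auto
qed

quotient_type L2 = "complex \<Rightarrow> complex" / partial: L2_rel
proof (rule part_equivpI)
  show "\<exists>f. L2_rel f f"
    using sq_integrable_zero by (auto simp: L2_rel_def)
  show "symp L2_rel"
    by (auto simp: symp_def L2_rel_def elim!: eventually_mono)
  show "transp L2_rel"
    unfolding transp_def L2_rel_def by (auto elim: eventually_elim2)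
qed

instantiation L2 :: complex_inner
begin

lift_definition zero_L2 :: L2 is "\<lambda>_. 0"
  by (simp add: L2_rel_def sq_integrable_zero)

lift_definition plus_L2 :: "L2 \<Rightarrow> L2 \<Rightarrow> L2" is "\<lambda>f g z. f z + g z"
  by (auto simp: L2_rel_def sq_integrable_add elim: eventually_elim2)

lift_definition scaleC_L2 :: "complex \<Rightarrow> L2 \<Rightarrow> L2" is "\<lambda>c f z. c * f z"
  by (auto simp: L2_rel_def sq_integrable_scale elim!: eventually_mono)

definition scaleR_L2 :: "real \<Rightarrow> L2 \<Rightarrow> L2" where "scaleR_L2 r f = scaleC (complex_of_real r) f"

definition uminus_L2 :: "L2 \<Rightarrow> L2" where "uminus_L2 f = scaleC (- 1) f"

definition minus_L2 :: "L2 \<Rightarrow> L2 \<Rightarrow> L2" where "minus_L2 f g = f + - g"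

lift_definition cinner_L2 :: "L2 \<Rightarrow> L2 \<Rightarrow> complex" is "\<lambda>f g. \<integral>z. f z * cnj (g z) \<partial>circle"
proof -
  fix f f' g g' assume *: "L2_rel f f'" "L2_rel g g'"
  have [measurable]: "f \<in> borel_measurable circle" "g \<in> borel_measurable circle"
      "f' \<in> borel_measurable circle" "g' \<in> borel_measurable circle"
    using * by (auto simp: L2_rel_def sq_integrable_def)
  have "AE z in circle. f z * cnj (g z) = f' z * cnj (g' z)"
    using * by (auto simp: L2_rel_def elim: eventually_elim2)
  then show "(\<integral>z. f z * cnj (g z) \<partial>circle) = (\<integral>z. f' z * cnj (g' z) \<partial>circle)"
    by (intro integral_cong_AE) auto
qed

definition inner_L2 :: "L2 \<Rightarrow> L2 \<Rightarrow> real" where "inner_L2 f g = Re (cinner f g)"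

definition norm_L2 :: "L2 \<Rightarrow> real" where "norm_L2 f = sqrt (inner f f)"

definition sgn_L2 :: "L2 \<Rightarrow> L2" where "sgn_L2 f = scaleR (inverse (norm f)) f"

definition dist_L2 :: "L2 \<Rightarrow> L2 \<Rightarrow> real" where "dist_L2 f g = norm (f - g)"

definition uniformity_L2 :: "(L2 \<times> L2) filter" where
  "uniformity_L2 = (INF e\<in>{0<..}. principal {(f, g). dist f g < e})"

definition open_L2 :: "L2 set \<Rightarrow> bool" where
  "open_L2 A \<longleftrightarrow> (\<forall>f\<in>A. eventually (\<lambda>(f', g). f' = f \<longrightarrow> g \<in> A) uniformity)"

instance
proof
  fix f g h :: L2 and a b :: complex and r s :: real
  show add_assoc: "f + g + h = f + (g + h)" for f g h :: L2
    by transfer (auto simp: L2_rel_def add.assoc intro!: sq_integrable_add)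
  show "f + g = g + f"
    by transfer (auto simp: L2_rel_def add.commute intro!: sq_integrable_add)
  show "0 + f = f"
    by transfer (auto simp: L2_rel_def)
  have one: "1 *\<^sub>C f = f" for f :: L2
    by transfer (auto simp: L2_rel_def)
  show radd: "a *\<^sub>C (f + g) = a *\<^sub>C f + a *\<^sub>C g" for a f and g :: L2
    by transfer (auto simp: L2_rel_def algebra_simps intro!: sq_integrable_add sq_integrable_scale)
  show ladd: "(a + b) *\<^sub>C f = a *\<^sub>C f + b *\<^sub>C f" for a b and f :: L2
    by transfer (auto simp: L2_rel_def distrib_right intro!: sq_integrable_add sq_integrable_scale)
  show scsc: "a *\<^sub>C b *\<^sub>C f = (a * b) *\<^sub>C f" for a b and f :: L2
    by transfer (auto simp: L2_rel_def mult.assoc intro!: sq_integrable_scale)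
  have zero: "0 *\<^sub>C f = (0 :: L2)" for f :: L2
    by transfer (auto simp: L2_rel_def sq_integrable_zero)
  show "- f + f = 0"
    using ladd[of "- 1" 1 f] by (simp add: uminus_L2_def one zero)
  show "f - g = f + - g"
    by (simp add: minus_L2_def)
  show "r *\<^sub>R (f + g) = r *\<^sub>R f + r *\<^sub>R g" "(r + s) *\<^sub>R f = r *\<^sub>R f + s *\<^sub>R f"
    "r *\<^sub>R s *\<^sub>R f = (r * s) *\<^sub>R f" "1 *\<^sub>R f = f"
    by (simp_all add: scaleR_L2_def radd ladd scsc one)
  show "complex_of_real r *\<^sub>C f = r *\<^sub>R f"
    by (simp add: scaleR_L2_def)
  show comm: "cinner f g = cnj (cinner g f)" for f g :: L2
    by transfer (simp flip: Bochner_Integration.integral_cnj add: mult.commute)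
  show cadd: "cinner (f + g) h = cinner f h + cinner g h"
    by transfer (simp add: distrib_right L2_rel_def sq_integrable_prod)
  show cscale: "cinner (a *\<^sub>C f) g = a * cinner f g" for a f and g :: L2
    by transfer (simp add: mult.assoc)
  show "inner f g = Re (cinner f g)"
    by (simp add: inner_L2_def)
  show "inner f g = inner g f"
    by (subst (2) inner_L2_def, subst comm) (simp add: inner_L2_def)
  show "inner (f + g) h = inner f h + inner g h"
    by (simp add: inner_L2_def cadd)
  show "inner (r *\<^sub>R f) g = r * inner f g"
    by (simp add: inner_L2_def scaleR_L2_def cscale)
  have cinner_self: "Re (\<integral>z. u z * cnj (u z) \<partial>circle) = (\<integral>z. (cmod (u z))\<^sup>2 \<partial>circle)" for u
    by (simp only: complex_norm_square[symmetric] integral_complex_of_real Re_complex_of_real)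
  show "0 \<le> inner f f"
    unfolding inner_L2_def by transfer (simp only: cinner_self, simp)
  show "inner f f = 0 \<longleftrightarrow> f = 0"
    unfolding inner_L2_def
  proof transfer
    fix u assume "L2_rel u u"
    then have u: "sq_integrable u" by (simp add: L2_rel_def)
    have "(\<integral>z. (cmod (u z))\<^sup>2 \<partial>circle) = 0 \<longleftrightarrow> (AE z in circle. (cmod (u z))\<^sup>2 = 0)"
      using u by (intro integral_nonneg_eq_0_iff_AE) (auto simp: sq_integrable_def)
    then show "Re (\<integral>z. u z * cnj (u z) \<partial>circle) = 0 \<longleftrightarrow> L2_rel u (\<lambda>_. 0)"
      by (simp only: cinner_self) (simp add: L2_rel_def u sq_integrable_zero)
  qed
  show "norm f = sqrt (inner f f)" by (simp add: norm_L2_def)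
  show "sgn f = inverse (norm f) *\<^sub>R f" by (simp add: sgn_L2_def)
  show "dist f g = norm (f - g)" by (simp add: dist_L2_def)
  show "(uniformity :: (L2 \<times> L2) filter) = (INF e\<in>{0<..}. principal {(x, y). dist x y < e})"
    by (simp add: uniformity_L2_def)
  show "open A \<longleftrightarrow> (\<forall>x\<in>A. eventually (\<lambda>(x', y). x' = x \<longrightarrow> y \<in> A) uniformity)" for A :: "L2 set"
    by (simp add: open_L2_def)
qed

end

lift_definition z_L2 :: L2 is "\<lambda>z. z"
proof -
  interpret finite_measure circle by (rule finite_measure_circle)
  have "integrable circle (\<lambda>z. (cmod z)\<^sup>2)"
    by (rule integrable_const_bound[where B = 1])
      (use AE_circle_norm in \<open>auto elim!: eventually_mono\<close>)
  then show "L2_rel (\<lambda>z. z) (\<lambda>z. z)"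
    by (simp add: L2_rel_def sq_integrable_def)
qed

lift_definition conj_L2 :: "L2 \<Rightarrow> L2" is "\<lambda>f z. cnj (f z)"
  by (auto simp: L2_rel_def sq_integrable_cnj elim!: eventually_mono)

lift_definition J_L2 :: "L2 \<Rightarrow> L2" is "\<lambda>f z. cnj z * f (cnj z)"
proof -
  fix f f' assume *: "L2_rel f f'"
  then have [measurable]: "f \<in> borel_measurable borel" "f' \<in> borel_measurable borel"
    using measurable_cong_sets[OF sets_circle refl] by (auto simp: sq_integrable_def L2_rel_def)
  have "AE z in circle. f z = f' z" using * by (simp add: L2_rel_def)
  then have "AE z in circle. f (cnj z) = f' (cnj z)"
    by (intro AE_circle_cnj[where Q = "\<lambda>z. f z = f' z"]) auto
  then show "L2_rel (\<lambda>z. cnj z * f (cnj z)) (\<lambda>z. cnj z * f' (cnj z))"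
    using * by (auto simp: L2_rel_def sq_integrable_reflect elim!: eventually_mono)
qed

text \<open>The circle has finite measure, so \<open>L\<^sup>\<infinity>\<close> is a subspace of \<open>L\<^sup>2\<close>.\<close>

lemma ess_bounded_cong:
  assumes "L2_rel f g" shows "ess_bounded f \<longleftrightarrow> ess_bounded g"
proof -
  have fg: "AE z in circle. f z = g z" "f \<in> borel_measurable circle" "g \<in> borel_measurable circle"
    using assms by (auto simp: L2_rel_def sq_integrable_def)
  have "(AE z in circle. cmod (f z) \<le> C) \<longleftrightarrow> (AE z in circle. cmod (g z) \<le> C)" for C
    using fg(1) by (intro eventually_subst) (auto elim: eventually_mono)
  then show ?thesis using fg by (simp add: ess_bounded_def)
qed

lift_definition bounded_L2 :: "L2 \<Rightarrow> bool" is ess_bounded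
  by (rule ess_bounded_cong)

definition Linf :: "L2 set" where
  "Linf = {\<phi>. bounded_L2 \<phi>}"

text \<open>Pointwise multiplication by \<open>\<phi> \<in> L\<^sup>\<infinity>\<close>; the value 0 for other \<open>\<phi>\<close> is junk.\<close>

lift_definition mult_L2 :: "L2 \<Rightarrow> L2 \<Rightarrow> L2" is
  "\<lambda>\<phi> f. if ess_bounded \<phi> then (\<lambda>z. \<phi> z * f z) else (\<lambda>_. 0)"
proof -
  fix p p' f f' assume *: "L2_rel p p'" "L2_rel f f'"
  show "L2_rel (if ess_bounded p then \<lambda>z. p z * f z else (\<lambda>_. 0))
      (if ess_bounded p' then \<lambda>z. p' z * f' z else (\<lambda>_. 0))"
  proof (cases "ess_bounded p")
    case True
    moreover have "ess_bounded p'" using True ess_bounded_cong[OF *(1)] by simp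
    moreover have "AE z in circle. p z * f z = p' z * f' z"
      using * by (auto simp: L2_rel_def elim: eventually_elim2)
    ultimately show ?thesis using * by (simp add: L2_rel_def sq_integrable_mult)
  next
    case False
    then show ?thesis using ess_bounded_cong[OF *(1)] by (simp add: L2_rel_def sq_integrable_zero)
  qed
qed

lift_definition fourier :: "L2 \<Rightarrow> int \<Rightarrow> complex" is
  "\<lambda>f n. \<integral>z. f z * z powi (- n) \<partial>circle"
proof -
  fix f f' assume *: "L2_rel f f'"
  then have [measurable]: "f \<in> borel_measurable borel" "f' \<in> borel_measurable borel"
    using measurable_cong_sets[OF sets_circle refl] by (auto simp: sq_integrable_def L2_rel_def)
  have [measurable]: "(\<lambda>z::complex. z powi k) \<in> borel_measurable borel" for k
    by (cases "k \<ge> 0") (simp_all add: power_int_def)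
  have "(\<integral>z. f z * z powi (- n) \<partial>circle) = (\<integral>z. f' z * z powi (- n) \<partial>circle)" for n
    by (rule integral_cong_AE) (use * in \<open>auto simp: L2_rel_def elim!: eventually_mono\<close>)
  then show "(\<lambda>n. \<integral>z. f z * z powi (- n) \<partial>circle) = (\<lambda>n. \<integral>z. f' z * z powi (- n) \<partial>circle)"
    by (rule ext)
qed

lemma fourier_eq_cinner:
  "\<exists>e. \<forall>f. fourier f n = cinner f e"
proof -
  define e where "e = (\<lambda>z::complex. cnj (z powi (- n)))"
  interpret finite_measure circle by (rule finite_measure_circle)
  have [measurable]: "(\<lambda>z::complex. z powi k) \<in> borel_measurable borel" for k
    by (cases "k \<ge> 0") (simp_all add: power_int_def)
  have [measurable]: "e \<in> borel_measurable borel" by (simp add: e_def)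
  have [measurable]: "(\<lambda>z. (cmod (e z))\<^sup>2) \<in> borel_measurable circle" by measurable
  have "integrable circle (\<lambda>z. (cmod (e z))\<^sup>2)"
  proof (rule integrable_const_bound[where B = 1])
    show "AE z in circle. norm ((cmod (e z))\<^sup>2) \<le> 1"
      using AE_circle_norm by eventually_elim (simp add: e_def norm_power_int)
  qed simp
  then have e: "L2_rel e e" by (simp add: L2_rel_def sq_integrable_def)
  have "fourier f n = cinner f (abs_L2 e)" for f
  proof -
    obtain u where u: "L2_rel u u" "f = abs_L2 u"
      using Quotient_L2 by (metis Quotient_abs_rep Quotient_rep_reflp)
    show ?thesis
      using u e by (simp add: fourier.abs_eq cinner_L2.abs_eq e_def)
  qed
  then show ?thesis by blast
qed


section \<open>The Hardy space \<open>H\<^sup>2\<close>\<close>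

typedef H2 = "{f :: L2. \<forall>n<0. fourier f n = 0}" morphisms of_H2 Abs_H2
proof
  show "0 \<in> {f :: L2. \<forall>n<0. fourier f n = 0}"
    by (auto simp: zero_L2_def fourier.abs_eq L2_rel_def sq_integrable_zero)
qed

setup_lifting type_definition_H2

lemma fourier_add: "fourier (f + g) n = fourier f n + fourier g n"
  using fourier_eq_cinner[of n] by (auto simp: cinner_add_left)

lemma fourier_scaleC: "fourier (c *\<^sub>C f) n = c * fourier f n"
  using fourier_eq_cinner[of n] by (auto simp: cinner_scaleC_left)

instantiation H2 :: complex_inner
begin

lift_definition zero_H2 :: H2 is 0
  using fourier_add[of 0 0] by simp

lift_definition plus_H2 :: "H2 \<Rightarrow> H2 \<Rightarrow> H2" is "(+)"
  by (simp add: fourier_add)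

lift_definition scaleC_H2 :: "complex \<Rightarrow> H2 \<Rightarrow> H2" is "(*\<^sub>C)"
  by (simp add: fourier_scaleC)

lift_definition scaleR_H2 :: "real \<Rightarrow> H2 \<Rightarrow> H2" is "(*\<^sub>R)"
  by (simp add: fourier_scaleC flip: scaleC_of_real)

lift_definition uminus_H2 :: "H2 \<Rightarrow> H2" is uminus
  by (simp add: fourier_scaleC uminus_L2_def)

lift_definition minus_H2 :: "H2 \<Rightarrow> H2 \<Rightarrow> H2" is "(-)"
  by (simp add: fourier_scaleC fourier_add minus_L2_def uminus_L2_def)

lift_definition cinner_H2 :: "H2 \<Rightarrow> H2 \<Rightarrow> complex" is cinner .

lift_definition inner_H2 :: "H2 \<Rightarrow> H2 \<Rightarrow> real" is inner .

lift_definition norm_H2 :: "H2 \<Rightarrow> real" is norm .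

lift_definition sgn_H2 :: "H2 \<Rightarrow> H2" is sgn
  by (simp add: sgn_div_norm fourier_scaleC flip: scaleC_of_real)

lift_definition dist_H2 :: "H2 \<Rightarrow> H2 \<Rightarrow> real" is dist .

definition uniformity_H2 :: "(H2 \<times> H2) filter" where
  "uniformity_H2 = (INF e\<in>{0<..}. principal {(f, g). dist f g < e})"

definition open_H2 :: "H2 set \<Rightarrow> bool" where
  "open_H2 A \<longleftrightarrow> (\<forall>f\<in>A. eventually (\<lambda>(f', g). f' = f \<longrightarrow> g \<in> A) uniformity)"

instance
proof
  fix f g h :: H2 and a b :: complex and r s :: real
  show "f + g + h = f + (g + h)" by transfer (rule add.assoc)
  show "f + g = g + f" by transfer (rule add.commute)
  show "0 + f = f" by transfer simp
  show "- f + f = 0" by transfer simp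
  show "f - g = f + - g" by transfer simp
  show "r *\<^sub>R (f + g) = r *\<^sub>R f + r *\<^sub>R g" by transfer (rule scaleR_add_right)
  show "(r + s) *\<^sub>R f = r *\<^sub>R f + s *\<^sub>R f" by transfer (rule scaleR_add_left)
  show "r *\<^sub>R s *\<^sub>R f = (r * s) *\<^sub>R f" by transfer simp
  show "1 *\<^sub>R f = f" by transfer simp
  show "a *\<^sub>C (f + g) = a *\<^sub>C f + a *\<^sub>C g" by transfer (rule scaleC_add_right)
  show "(a + b) *\<^sub>C f = a *\<^sub>C f + b *\<^sub>C f" by transfer (rule scaleC_add_left)
  show "a *\<^sub>C b *\<^sub>C f = (a * b) *\<^sub>C f" by transfer (rule scaleC_scaleC)
  show "complex_of_real r *\<^sub>C f = r *\<^sub>R f" by transfer (rule scaleC_of_real)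
  show "cinner f g = cnj (cinner g f)" by transfer (rule cinner_commute)
  show "cinner (f + g) h = cinner f h + cinner g h" by transfer (rule cinner_add_left)
  show "cinner (a *\<^sub>C f) g = a * cinner f g" by transfer (rule cinner_scaleC_left)
  show "inner f g = Re (cinner f g)" by transfer (rule inner_eq_Re_cinner)
  show "inner f g = inner g f" by transfer (rule inner_commute)
  show "inner (f + g) h = inner f h + inner g h" by transfer (rule inner_add_left)
  show "inner (r *\<^sub>R f) g = r * inner f g" by transfer simp
  show "0 \<le> inner f f" by transfer simp
  show "inner f f = 0 \<longleftrightarrow> f = 0" by transfer simp
  show "norm f = sqrt (inner f f)" by transfer (rule norm_eq_sqrt_inner)
  show "sgn f = inverse (norm f) *\<^sub>R f" by transfer (rule sgn_div_norm)
  show "dist f g = norm (f - g)" by transfer (rule dist_norm)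
  show "(uniformity :: (H2 \<times> H2) filter) = (INF e\<in>{0<..}. principal {(x, y). dist x y < e})"
    by (simp add: uniformity_H2_def)
  show "open A \<longleftrightarrow> (\<forall>x\<in>A. eventually (\<lambda>(x', y). x' = x \<longrightarrow> y \<in> A) uniformity)" for A :: "H2 set"
    by (simp add: open_H2_def)
qed

end

definition Hinf :: "L2 set" where
  "Hinf = Linf \<inter> range of_H2"

text \<open>The orthogonal projection: \<open>H\<^sup>2\<close> is closed in the complete space \<open>L\<^sup>2\<close>, so \<open>h\<close> exists uniquely.\<close>

definition P_H2 :: "L2 \<Rightarrow> H2" where
  "P_H2 f = (THE h. \<forall>k. cinner (f - of_H2 h) (of_H2 k) = 0)"

definition toeplitz :: "L2 \<Rightarrow> H2 \<Rightarrow> H2" where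
  "toeplitz \<phi> h = P_H2 (mult_L2 \<phi> (of_H2 h))"

definition hankel :: "L2 \<Rightarrow> H2 \<Rightarrow> H2" where
  "hankel \<phi> h = P_H2 (J_L2 (mult_L2 \<phi> (of_H2 h)))"

definition S_H2 :: "H2 \<Rightarrow> H2" where
  "S_H2 = toeplitz z_L2"

definition taylor :: "H2 \<Rightarrow> nat \<Rightarrow> complex" where
  "taylor f n = fourier (of_H2 f) (int n)"

text \<open>Junk for coefficients that are not square-summable.\<close>

definition H2_series :: "(nat \<Rightarrow> complex) \<Rightarrow> H2" where
  "H2_series a = (THE f. \<forall>n. taylor f n = a n)"

definition U_H2 :: "H2 \<Rightarrow> H2 \<times> H2" where
  "U_H2 f = (H2_series (\<lambda>n. taylor f (2 * n)), H2_series (\<lambda>n. taylor f (2 * n + 1)))"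

definition conj_plus_z :: "H2 \<Rightarrow> L2" where
  "conj_plus_z f = conj_L2 (of_H2 f) + mult_L2 z_L2 (of_H2 f)"

end

(* Comparing matrix entries in the monomial basis, the intertwining relation says that the diagonal
   blocks of Y satisfy a(i,j) = conj a(j+1,i+1) and a(i+1,0) = 0, and that the off-diagonal blocks
   satisfy similar relations. Splitting the indices by parity, the diagonal blocks become 2x2 block
   Toeplitz matrices and the off-diagonal ones have a single nonzero entry, a Hankel matrix. Bounded
   symbols exist by the theorems of Brown-Halmos and Nehari. Both reduce to one fact: an L^2 function
   whose Toeplitz form on trigonometric polynomials is bounded is essentially bounded. For Nehari the
   Hankel matrix is first extended, antidiagonal by antidiagonal and without increasing the norm, to a
   two-sided sequence; each step is the case of Parrott's theorem proved in quadratic_completion. *)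

theory Submission
  imports Defs "HOL-Library.Nat_Bijection"
begin

section \<open>Complex inner product spaces\<close>

text \<open>On a diagonal block the relation is invariance under (i, j) -> (j + 1, i + 1) combined
  with conjugation, and this explains the shape of the answer. The map exchanges even-even with
  odd-odd positions, which pairs a Toeplitz matrix with its adjoint, and sends each mixed class to
  itself. On the even-odd class it becomes the symmetry psi_k = conj psi_(1-k), which characterizes
  conj f + z f; on the odd-even class it spreads the zeros of column 0 over the whole class. The
  obstacle lies in passing from matrices to symbols: the columns of a bounded matrix are
  square-summable, which yields only an L^2 symbol. Boundedness is recovered by testing against
  squared moduli of polynomials, which approximate the indicators of compact sets. A Toeplitz matrix
  provides exactly these tests. A Hankel matrix sees only the negative Fourier coefficients of its
  symbol, so the others have to be constructed without losing the norm bound. With bound 0, the same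
  test shows that Fourier coefficients determine a function.\<close>

lemma scaleC_zero_left [simp]: "0 *\<^sub>C (x::'a::complex_inner) = 0"
  using scaleC_of_real[of 0 x] by simp

lemma scaleC_one [simp]: "1 *\<^sub>C (x::'a::complex_inner) = x"
  using scaleC_of_real[of 1 x] by simp

lemma scaleC_zero_right [simp]: "a *\<^sub>C (0::'a::complex_inner) = 0"
  using scaleC_add_right[of a 0 "0::'a"] by simp

lemma cinner_add_right: "cinner (x::'a::complex_inner) (y + z) = cinner x y + cinner x z"
  by (metis cinner_add_left cinner_commute complex_cnj_add)

lemma cinner_scaleC_right: "cinner (x::'a::complex_inner) (a *\<^sub>C y) = cnj a * cinner x y"
  by (metis cinner_commute cinner_scaleC_left complex_cnj_mult)

lemma cinner_zero_left [simp]: "cinner 0 (x::'a::complex_inner) = 0"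
  using cinner_add_left[of 0 0 x] by simp

lemma cinner_zero_right [simp]: "cinner (x::'a::complex_inner) 0 = 0"
  using cinner_add_right[of x 0 0] by simp

lemma cinner_diff_left: "cinner (x - y) (z::'a::complex_inner) = cinner x z - cinner y z"
  using cinner_add_left[of "x - y" y z] by simp

lemma cinner_diff_right: "cinner (x::'a::complex_inner) (y - z) = cinner x y - cinner x z"
  using cinner_add_right[of x "y - z" z] by simp

lemma cinner_sum_left: "cinner (\<Sum>i\<in>I. f i) (x::'a::complex_inner) = (\<Sum>i\<in>I. cinner (f i) x)"
  by (induction I rule: infinite_finite_induct) (auto simp: cinner_add_left)

lemma cinner_sum_right: "cinner (x::'a::complex_inner) (\<Sum>i\<in>I. f i) = (\<Sum>i\<in>I. cinner x (f i))"
  by (induction I rule: infinite_finite_induct) (auto simp: cinner_add_right)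

lemma cinner_self: "cinner x (x::'a::complex_inner) = of_real ((norm x)\<^sup>2)"
proof (rule complex_eqI)
  show "Re (cinner x x) = Re (of_real ((norm x)\<^sup>2))"
    by (simp add: power2_norm_eq_inner inner_eq_Re_cinner)
  show "Im (cinner x x) = Im (of_real ((norm x)\<^sup>2))"
    using cinner_commute[of x x] by (simp add: complex_eq_iff)
qed

lemma norm_scaleC: "norm (a *\<^sub>C (x::'a::complex_inner)) = cmod a * norm x"
proof -
  have "complex_of_real ((norm (a *\<^sub>C x))\<^sup>2) = of_real ((cmod a * norm x)\<^sup>2)"
    unfolding cinner_self[symmetric] cinner_scaleC_left cinner_scaleC_right
    by (simp add: cinner_self complex_norm_square[symmetric] power_mult_distrib mult.assoc[symmetric] mult.commute[of "cnj a"] del: of_real_power)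
  then have "(norm (a *\<^sub>C x))\<^sup>2 = (cmod a * norm x)\<^sup>2"
    by (simp only: of_real_eq_iff)
  then show ?thesis
    by (simp add: power2_eq_iff_nonneg)
qed

text \<open>A unimodular factor on \<open>x\<close> makes the inner product real and nonnegative, so
  that the real Cauchy-Schwarz inequality applies.\<close>

lemma norm_cinner_le: "cmod (cinner x (y::'a::complex_inner)) \<le> norm x * norm y"
proof (cases "cinner x y = 0")
  case False
  define c where "c = cnj (sgn (cinner x y))"
  have c: "cmod c = 1"
    using False by (simp add: c_def norm_sgn)
  have "c * cinner x y = of_real (cmod (cinner x y))"
    using False by (simp add: c_def sgn_eq field_simps complex_norm_square[symmetric] power2_eq_square)
  then have "cmod (cinner x y) = inner (c *\<^sub>C x) y"
    by (simp add: inner_eq_Re_cinner cinner_scaleC_left)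
  also have "\<dots> \<le> norm (c *\<^sub>C x) * norm y"
    by (rule norm_cauchy_schwarz)
  finally show ?thesis by (simp add: norm_scaleC c)
qed simp

lemma cinner_eq_left_imp_eq:
  assumes "\<And>x. cinner x y = cinner x (z::'a::complex_inner)" shows "y = z"
proof -
  have "cinner (y - z) (y - z) = 0"
    using assms[of "y - z"] by (simp add: cinner_diff_right)
  then show ?thesis by (simp add: cinner_self)
qed

lemma norm_add_orthogonal:
  assumes "cinner x (y::'a::complex_inner) = 0"
  shows "(norm (x + y))\<^sup>2 = (norm x)\<^sup>2 + (norm y)\<^sup>2"
proof -
  have "inner x y = 0" using assms by (simp add: inner_eq_Re_cinner)
  then show ?thesis by (simp add: power2_norm_eq_inner inner_add inner_commute)
qed

section \<open>Orthonormal systems\<close>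

lemma cinner_orthonormal_sum:
  fixes e :: "'i \<Rightarrow> 'a::complex_inner"
  assumes "finite I" "\<And>i j. cinner (e i) (e j) = of_bool (i = j)"
  shows "cinner (\<Sum>i\<in>I. a i *\<^sub>C e i) (e k) = (if k \<in> I then a k else 0)"
proof -
  have "cinner (\<Sum>i\<in>I. a i *\<^sub>C e i) (e k) = (\<Sum>i\<in>I. if i = k then a i else 0)"
    unfolding cinner_sum_left cinner_scaleC_left assms(2) by (intro sum.cong) auto
  then show ?thesis using assms(1) by simp
qed

lemma norm_orthonormal_sum:
  fixes e :: "'i \<Rightarrow> 'a::complex_inner"
  assumes "finite I" "\<And>i j. cinner (e i) (e j) = of_bool (i = j)"
  shows "(norm (\<Sum>i\<in>I. a i *\<^sub>C e i))\<^sup>2 = (\<Sum>i\<in>I. (cmod (a i))\<^sup>2)"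
proof -
  have "complex_of_real ((norm (\<Sum>i\<in>I. a i *\<^sub>C e i))\<^sup>2) = (\<Sum>i\<in>I. cnj (a i) * a i)"
    unfolding cinner_self[symmetric] cinner_sum_right cinner_scaleC_right
    by (intro sum.cong refl) (simp add: cinner_orthonormal_sum[OF assms])
  also have "\<dots> = complex_of_real (\<Sum>i\<in>I. (cmod (a i))\<^sup>2)"
    by (simp add: complex_norm_square mult.commute del: of_real_power)
  finally show ?thesis by (simp only: of_real_eq_iff)
qed

text \<open>The sum is the squared norm of the projection \<open>p\<close> of \<open>x\<close> onto
  the span of the system; since \<open>x - p\<close> is orthogonal to \<open>p\<close>, Pythagoras
  gives the bound.\<close>

lemma bessel_inequality:
  fixes e :: "'i \<Rightarrow> 'a::complex_inner"
  assumes "finite I" "\<And>i j. cinner (e i) (e j) = of_bool (i = j)"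
  shows "(\<Sum>i\<in>I. (cmod (cinner x (e i)))\<^sup>2) \<le> (norm x)\<^sup>2"
proof -
  define p where "p = (\<Sum>i\<in>I. cinner x (e i) *\<^sub>C e i)"
  have "cinner p (e i) = cinner x (e i)" if "i \<in> I" for i
    using that by (simp add: p_def cinner_orthonormal_sum[OF assms])
  then have "cinner (x - p) p = 0"
    by (subst (2) p_def) (simp add: cinner_sum_right cinner_scaleC_right cinner_diff_left)
  from norm_add_orthogonal[OF this] have "(norm p)\<^sup>2 \<le> (norm x)\<^sup>2" by simp
  then show ?thesis
    by (simp add: p_def norm_orthonormal_sum[OF assms])
qed

text \<open>By Pythagoras the squared distance of two partial sums equals the distance of the
  corresponding partial sums of the scalar series. The limit itself is supplied later by the
  completeness of the particular space.\<close>

lemma orthonormal_series_Cauchy: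
  fixes e :: "nat \<Rightarrow> 'a::complex_inner"
  assumes e: "\<And>i j. cinner (e i) (e j) = of_bool (i = j)"
    and a: "summable (\<lambda>n. (cmod (a n))\<^sup>2)"
  shows "Cauchy (\<lambda>N. \<Sum>n<N. a n *\<^sub>C e n)"
proof (rule metric_CauchyI)
  fix r :: real assume "0 < r"
  have "Cauchy (\<lambda>N. \<Sum>n<N. (cmod (a n))\<^sup>2)"
    using a by (simp add: summable_iff_convergent convergent_eq_Cauchy LIMSEQ_imp_Cauchy convergent_Cauchy)
  then obtain K where K: "\<And>m n. m \<ge> K \<Longrightarrow> n \<ge> K \<Longrightarrow>
      dist (\<Sum>n<m. (cmod (a n))\<^sup>2) (\<Sum>n<n. (cmod (a n))\<^sup>2) < r\<^sup>2"
    using metric_CauchyD[of _ "r\<^sup>2"] \<open>0 < r\<close> by (metis zero_less_power)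
  have less: "dist (\<Sum>n<m. a n *\<^sub>C e n) (\<Sum>n<n. a n *\<^sub>C e n) < r" if "K \<le> n" "n \<le> m" for m n
  proof -
    have split: "(\<Sum>n<m. f n) = (\<Sum>n<n. f n) + (\<Sum>k\<in>{n..<m}. f k)" for f :: "nat \<Rightarrow> 'b::ab_group_add"
      using sum.atLeastLessThan_concat[of 0 n m f] that by (simp add: atLeast0LessThan)
    have "(dist (\<Sum>n<m. a n *\<^sub>C e n) (\<Sum>n<n. a n *\<^sub>C e n))\<^sup>2 = (\<Sum>k\<in>{n..<m}. (cmod (a k))\<^sup>2)"
      by (simp add: split dist_norm norm_orthonormal_sum[OF _ e])
    also have "\<dots> < r\<^sup>2"
      using K[of m n] that by (simp add: split dist_norm sum_nonneg)
    finally show ?thesis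
      using \<open>0 < r\<close> by (meson less_imp_le power_less_imp_less_base)
  qed
  show "\<exists>M. \<forall>m\<ge>M. \<forall>n\<ge>M. dist (\<Sum>n<m. a n *\<^sub>C e n) (\<Sum>n<n. a n *\<^sub>C e n) < r"
  proof (intro exI allI impI)
    fix m n assume "K \<le> m" "K \<le> n"
    then show "dist (\<Sum>n<m. a n *\<^sub>C e n) (\<Sum>n<n. a n *\<^sub>C e n) < r"
      using less[of n m] less[of m n] by (cases "n \<le> m") (auto simp: dist_commute)
  qed
qed


section \<open>Bounded operators and adjoints\<close>

text \<open>A relation, because the definite description in \<open>cadjoint\<close> says nothing
  until some adjoint has been exhibited; uniqueness then identifies the two.\<close>

definition is_adjoint :: "('a::complex_inner \<Rightarrow> 'b::complex_inner) \<Rightarrow> ('b \<Rightarrow> 'a) \<Rightarrow> bool" where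
  "is_adjoint A B \<longleftrightarrow> (\<forall>x y. cinner (A x) y = cinner x (B y))"

lemma cadjoint_eqI: "is_adjoint A B \<Longrightarrow> cadjoint A = B"
  unfolding cadjoint_def is_adjoint_def
proof (rule the_equality)
  fix B' assume "\<forall>x y. cinner (A x) y = cinner x (B y)" "\<forall>x y. cinner (A x) y = cinner x (B' y)"
  then have "B' y = B y" for y
    by (intro cinner_eq_left_imp_eq) metis
  then show "B' = B" by (rule ext)
qed

lemma is_adjoint_sym: "is_adjoint A B \<Longrightarrow> is_adjoint B A"
  unfolding is_adjoint_def by (metis cinner_commute)

lemma bounded_clinear_add: "bounded_clinear A \<Longrightarrow> A (x + y) = A x + A y"
  by (simp add: bounded_clinear_def bounded_linear.linear linear_add)

lemma bounded_clinear_diff: "bounded_clinear A \<Longrightarrow> A (x - y) = A x - A y"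
  by (simp add: bounded_clinear_def bounded_linear.linear linear_diff)

lemma bounded_clinear_zero: "bounded_clinear A \<Longrightarrow> A 0 = 0"
  by (simp add: bounded_clinear_def bounded_linear.linear linear_0)

lemma bounded_clinear_scaleC: "bounded_clinear A \<Longrightarrow> A (c *\<^sub>C x) = c *\<^sub>C A x"
  by (simp add: bounded_clinear_def)

lemma bounded_clinear_sum: "bounded_clinear A \<Longrightarrow> A (\<Sum>i\<in>I. f i) = (\<Sum>i\<in>I. A (f i))"
  by (simp add: bounded_clinear_def bounded_linear.linear linear_sum)

lemma bounded_clinear_bound:
  assumes "bounded_clinear A"
  obtains M where "M \<ge> 0" "\<And>x. norm (A x) \<le> M * norm x"
  using assms bounded_linear.nonneg_bounded[of A] unfolding bounded_clinear_def
  by (metis mult.commute)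

lemma bounded_clinearI:
  assumes "\<And>x y. A (x + y) = A x + A y" "\<And>c x. A (c *\<^sub>C x) = c *\<^sub>C A x"
    "\<And>x. norm (A x) \<le> M * norm x"
  shows "bounded_clinear A"
  unfolding bounded_clinear_def
proof
  show "bounded_linear A"
    by (rule bounded_linear_intro[where K = M])
      (use assms in \<open>auto simp: mult.commute simp flip: scaleC_of_real\<close>)
qed (use assms in auto)

lemma bounded_clinear_comp:
  "bounded_clinear A \<Longrightarrow> bounded_clinear B \<Longrightarrow> bounded_clinear (A \<circ> B)"
  unfolding bounded_clinear_def by (auto intro: bounded_linear_compose simp: o_def)

lemma bounded_clinear_zero_op [simp]: "bounded_clinear (\<lambda>_. 0)"
  by (simp add: bounded_clinear_def)

lemma bounded_clinear_Pair:
  "bounded_clinear A \<Longrightarrow> bounded_clinear B \<Longrightarrow> bounded_clinear (\<lambda>x. (A x, B x))"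
  unfolding bounded_clinear_def by (auto intro: bounded_linear_Pair simp: scaleC_prod_def)

lemma bounded_clinear_add_op:
  "bounded_clinear A \<Longrightarrow> bounded_clinear B \<Longrightarrow> bounded_clinear (\<lambda>x. A x + B x)"
  unfolding bounded_clinear_def by (auto intro: bounded_linear_add simp: scaleC_add_right)

lemma bounded_clinear_fst: "bounded_clinear fst" and bounded_clinear_snd: "bounded_clinear snd"
  unfolding bounded_clinear_def
  by (auto simp: scaleC_prod_def bounded_linear_fst bounded_linear_snd)

lemma bounded_clinear_id: "bounded_clinear (\<lambda>x. x)"
  by (simp add: bounded_clinear_def bounded_linear_ident)

lemma is_adjoint_imp_clinear:
  assumes "is_adjoint A B"
  shows "B (x + y) = B x + B y" "B (c *\<^sub>C x) = c *\<^sub>C B x"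
proof -
  have AB: "cinner u (B v) = cinner (A u) v" for u v
    using assms by (simp add: is_adjoint_def)
  show "B (x + y) = B x + B y"
    by (rule cinner_eq_left_imp_eq) (simp add: AB cinner_add_right)
  show "B (c *\<^sub>C x) = c *\<^sub>C B x"
    by (rule cinner_eq_left_imp_eq) (simp add: AB cinner_scaleC_right)
qed

text \<open>The squared norm of \<open>B y\<close> is the inner product of \<open>A (B y)\<close>
  with \<open>y\<close>, hence at most M |B y| |y|; one factor |B y| cancels.\<close>

lemma is_adjoint_imp_bounded_clinear:
  assumes "bounded_clinear A" "is_adjoint A B"
  shows "bounded_clinear B"
proof -
  obtain M where M: "M \<ge> 0" "\<And>x. norm (A x) \<le> M * norm x"
    using bounded_clinear_bound[OF assms(1)] by blast
  show ?thesis
  proof (rule bounded_clinearI[where M = M])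
    fix y
    have "(norm (B y))\<^sup>2 = cmod (cinner (B y) (B y))"
      by (simp add: cinner_self norm_power)
    also have "\<dots> = cmod (cinner (A (B y)) y)"
      using assms by (simp add: is_adjoint_def)
    also have "\<dots> \<le> norm (A (B y)) * norm y"
      by (rule norm_cinner_le)
    also have "\<dots> \<le> M * norm (B y) * norm y"
      by (intro mult_right_mono M) auto
    finally have "norm (B y) * norm (B y) \<le> norm (B y) * (M * norm y)"
      by (simp add: power2_eq_square mult_ac)
    then show "norm (B y) \<le> M * norm y"
      using M by (cases "B y = 0") auto
  qed (use is_adjoint_imp_clinear[OF assms(2)] in auto)
qed

lemma is_adjoint_block_op:
  assumes "is_adjoint A A'" "is_adjoint B B'" "is_adjoint C C'" "is_adjoint D D'"
  shows "is_adjoint (block_op A B C D) (block_op A' C' B' D')"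
  using assms unfolding is_adjoint_def
  by (auto simp: block_op_def cinner_prod_def cinner_add_left cinner_add_right)

lemma bounded_clinear_block_op:
  assumes "bounded_clinear A" "bounded_clinear B" "bounded_clinear C" "bounded_clinear D"
  shows "bounded_clinear (block_op A B C D)"
proof -
  have "bounded_clinear (\<lambda>x. ((A \<circ> fst) x + (B \<circ> snd) x, (C \<circ> fst) x + (D \<circ> snd) x))"
    by (rule bounded_clinear_Pair; rule bounded_clinear_add_op; rule bounded_clinear_comp)
      (rule assms bounded_clinear_fst bounded_clinear_snd)+
  also have "(\<lambda>x. ((A \<circ> fst) x + (B \<circ> snd) x, (C \<circ> fst) x + (D \<circ> snd) x)) = block_op A B C D"
    by (auto simp: block_op_def)
  finally show ?thesis .
qed

text \<open>A constant could be moved from one entry of a row to the other without changing the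
  operator, so the argument rests on the blocks vanishing at 0, which linearity provides.\<close>

lemma block_op_eq_iff:
  assumes "bounded_clinear A" "bounded_clinear B" "bounded_clinear C" "bounded_clinear D"
    "bounded_clinear A'" "bounded_clinear B'" "bounded_clinear C'" "bounded_clinear D'"
  shows "block_op A B C D = block_op A' B' C' D' \<longleftrightarrow> A = A' \<and> B = B' \<and> C = C' \<and> D = D'"
proof
  assume eq: "block_op A B C D = block_op A' B' C' D'"
  have "A x = A' x" "C x = C' x" "B y = B' y" "D y = D' y" for x y
    using fun_cong[OF eq, of "(x, 0)"] fun_cong[OF eq, of "(0, y)"] assms[THEN bounded_clinear_zero]
    unfolding block_op_def by simp_all
  then show "A = A' \<and> B = B' \<and> C = C' \<and> D = D'" by auto
qed auto


section \<open>Integration over the circle\<close>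

lemma powi_measurable [measurable]: "(\<lambda>z::complex. z powi k) \<in> borel_measurable borel"
  by (cases "k \<ge> 0") (simp_all add: power_int_def)

lemma integrable_circle_bounded:
  fixes f :: "complex \<Rightarrow> 'b::{banach,second_countable_topology}"
  assumes "f \<in> borel_measurable borel" "\<And>z. cmod z = 1 \<Longrightarrow> norm (f z) \<le> B"
  shows "integrable circle f"
proof -
  interpret finite_measure circle by (rule finite_measure_circle)
  have [measurable]: "f \<in> borel_measurable circle"
    using assms(1) by simp
  show ?thesis
    by (rule integrable_const_bound[where B = B])
      (use AE_circle_norm assms in \<open>auto elim!: eventually_mono\<close>)
qed

lemma sq_integrable_bounded:
  assumes "f \<in> borel_measurable borel" "\<And>z. cmod z = 1 \<Longrightarrow> cmod (f z) \<le> B"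
  shows "sq_integrable f"
  using assms integrable_circle_bounded[of "\<lambda>z. (cmod (f z))\<^sup>2" "B\<^sup>2"]
  by (auto simp: sq_integrable_def power_mono)

lemma sq_integrable_imp_integrable: "sq_integrable f \<Longrightarrow> integrable circle f"
  using sq_integrable_prod[of f "\<lambda>_. 1"] sq_integrable_bounded[of "\<lambda>_. 1" 1] by simp

lemma integral_circle:
  fixes f :: "complex \<Rightarrow> 'b::{banach,second_countable_topology}"
  assumes [measurable]: "f \<in> borel_measurable borel"
  shows "(\<integral>z. f z \<partial>circle) = (\<integral>x. indicator {-pi..pi} x *\<^sub>R f (cis x) \<partial>lborel) /\<^sub>R (2 * pi)"
proof -
  have "uniform_measure lborel {-pi..pi}
      = density lborel (\<lambda>x. ennreal (indicator {-pi..pi} x / (2 * pi)))"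
    unfolding uniform_measure_def
    by (intro density_cong AE_I2) (auto split: split_indicator simp: divide_ennreal simp flip: ennreal_1)
  then have "(\<integral>z. f z \<partial>circle) = (\<integral>x. (indicator {-pi..pi} x / (2 * pi)) *\<^sub>R f (cis x) \<partial>lborel)"
    unfolding circle_def by (simp add: integral_distr integral_density)
  also have "\<dots> = (\<integral>x. (indicator {-pi..pi} x *\<^sub>R f (cis x)) /\<^sub>R (2 * pi) \<partial>lborel)"
    by (intro Bochner_Integration.integral_cong refl) (simp only: scaleR_scaleR divide_inverse mult.commute)
  finally show ?thesis by (simp only: integral_scaleR_right)
qed

lemma integral_circle_powi: "(\<integral>z. z powi k \<partial>circle) = of_bool (k = 0)"
proof (cases "k = 0")
  case True
  then show ?thesis
    by (simp add: measure_def emeasure_circle_UNIV)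
next
  case False
  \<comment> \<open>An antiderivative of e^(ikx). As \<open>k\<close> is an integer, it takes the
    same value at both ends of the interval and the integral vanishes.\<close>
  define F where "F x = cis (of_int k * x) / (\<i> * of_int k)" for x :: real
  have "(\<integral>x. indicator {-pi..pi} x *\<^sub>R (cis x powi k) \<partial>lborel) = F pi - F (- pi)"
  proof (rule integral_FTC_atLeastAtMost)
    fix x :: real
    have "(cis has_vector_derivative (\<i> * cis y)) (at y)" for y
      unfolding cis_conv_exp
      by (rule has_vector_derivative_real_field | auto intro!: derivative_eq_intros)+
    moreover have "((\<lambda>x. of_int k * x) has_vector_derivative of_int k) (at x)"
      unfolding has_real_derivative_iff_has_vector_derivative[symmetric]
      by (auto intro!: derivative_eq_intros)
    ultimately have "((\<lambda>x. cis (of_int k * x)) has_vector_derivative (of_int k *\<^sub>R (\<i> * cis (of_int k * x)))) (at x)"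
      using vector_diff_chain_at[of "\<lambda>x. of_int k * x" "of_int k" x cis "\<i> * cis (of_int k * x)"]
      by (simp add: o_def)
    then have "(F has_vector_derivative (of_int k *\<^sub>R (\<i> * cis (of_int k * x))) / (\<i> * of_int k)) (at x)"
      unfolding F_def by (rule has_vector_derivative_divide)
    then show "(F has_vector_derivative cis x powi k) (at x within {- pi..pi})"
      using False by (simp add: cis_power_int scaleR_conv_of_real has_vector_derivative_at_within)
  qed (auto simp: cis_power_int intro!: continuous_intros)
  also have "cis (of_int k * pi) = cis (of_int k * - pi)"
    by (simp add: complex_eq_iff sin_npi_int mult.commute)
  then have "F pi - F (- pi) = 0"
    by (simp add: F_def)
  finally show ?thesis
    using False by (subst integral_circle) simp_all
qed

section \<open>From bounds on polynomial test functions to essential bounds\<close>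

lemma real_polynomial_function_circle:
  fixes r :: "complex \<Rightarrow> real"
  assumes "real_polynomial_function r"
  shows "\<exists>n p. \<forall>z. cmod z = 1 \<longrightarrow> of_real (r z) * z ^ n = poly p z"
  using assms
proof (induction r)
  case (linear f)
  \<comment> \<open>On the circle cnj z = 1/z, so Re z = (z + 1/z)/2 and Im z = (z - 1/z)/(2i).
    Multiplying \<open>f z = Re z * f 1 + Im z * f \<i>\<close> by \<open>z\<close> clears the
    denominators and leaves these coefficients.\<close>
  have "of_real (f z) * z ^ 1 = poly [:(of_real (f 1) + \<i> * of_real (f \<i>)) / 2, 0,
      (of_real (f 1) - \<i> * of_real (f \<i>)) / 2:] z" if z: "cmod z = 1" for z
  proof -
    have "f z = f (Re z *\<^sub>R 1 + Im z *\<^sub>R \<i>)"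
      by (rule arg_cong[where f = f]) (simp add: complex_eq_iff)
    also have "\<dots> = Re z * f 1 + Im z * f \<i>"
      using linear by (simp add: linear_simps)
    finally have f: "complex_of_real (f z) = of_real (Re z) * of_real (f 1) + of_real (Im z) * of_real (f \<i>)"
      by simp
    have zz: "z * cnj z = 1"
      using complex_norm_square[of z] z by simp
    have re: "complex_of_real (Re z) = (z + cnj z) / 2"
      by (simp add: complex_add_cnj)
    have im: "complex_of_real (Im z) = - \<i> * (z - cnj z) / 2"
      by (simp add: complex_eq_iff)
    have *: "(z + cnj z) / 2 * a * z = (z\<^sup>2 + 1) / 2 * a" "- \<i> * (z - cnj z) / 2 * a * z = - \<i> * (z\<^sup>2 - 1) / 2 * a" for a
      using zz by (simp_all add: field_simps power2_eq_square)
    have "of_real (f z) * z = (z\<^sup>2 + 1) / 2 * of_real (f 1) + - \<i> * (z\<^sup>2 - 1) / 2 * of_real (f \<i>)"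
      unfolding f re im distrib_right by (simp only: *)
    then show ?thesis
      by (simp add: field_simps power2_eq_square)
  qed
  then show ?case by blast
next
  case (const c)
  have "of_real c * z ^ 0 = poly [:of_real c:] z" for z :: complex by simp
  then show ?case by blast
next
  case (add f g)
  then obtain n p m q where "\<And>z. cmod z = 1 \<Longrightarrow> of_real (f z) * z ^ n = poly p z"
    "\<And>z. cmod z = 1 \<Longrightarrow> of_real (g z) * z ^ m = poly q z" by blast
  then have "of_real (f z + g z) * z ^ (n + m) = poly (p * monom 1 m + q * monom 1 n) z" if "cmod z = 1" for z
    using that by (simp add: poly_monom power_add algebra_simps)
  then show ?case by blast
next
  case (mult f g)
  then obtain n p m q where *: "\<And>z. cmod z = 1 \<Longrightarrow> of_real (f z) * z ^ n = poly p z"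
    "\<And>z. cmod z = 1 \<Longrightarrow> of_real (g z) * z ^ m = poly q z" by blast
  have "of_real (f z * g z) * z ^ (n + m) = poly (p * q) z" if "cmod z = 1" for z
    by (simp add: power_add flip: *[OF that])
  then show ?case by blast
qed

text \<open>On a compact subset \<open>K\<close> of the set where \<open>g\<close> exceeds
  \<open>M\<close>, the function g - M is positive but has a nonpositive integral, so
  \<open>K\<close> is a null set. Inner regularity then makes the whole set null.\<close>

lemma AE_le_of_compact_integrals:
  fixes g :: "complex \<Rightarrow> real"
  assumes g: "integrable circle g"
    and le: "\<And>K. compact K \<Longrightarrow> (\<integral>z. indicator K z * g z \<partial>circle) \<le> M * measure circle K"
  shows "AE z in circle. g z \<le> M"
proof -
  interpret finite_measure circle by (rule finite_measure_circle)
  have [measurable]: "g \<in> borel_measurable borel"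
    using borel_measurable_integrable[OF g] by simp
  define B where "B = {z. M < g z}"
  have B: "B \<in> sets borel" by (simp add: B_def)
  have "emeasure circle K = 0" if K: "K \<subseteq> B" "compact K" for K
  proof -
    have [measurable]: "K \<in> sets borel" using K by (simp add: borel_compact)
    have iK: "integrable circle (\<lambda>z. indicator K z * h z)" if "integrable circle h" for h :: "complex \<Rightarrow> real"
      using integrable_mult_indicator[OF _ that, of K] by simp
    have int: "integrable circle (\<lambda>z. indicator K z * (g z - M))"
      using g by (intro iK) simp
    have nn: "AE z in circle. 0 \<le> indicator K z * (g z - M)"
      using K(1) by (intro AE_I2) (auto simp: indicator_def B_def)
    have "(\<integral>z. indicator K z * (g z - M) \<partial>circle) = (\<integral>z. indicator K z * g z \<partial>circle) - (\<integral>z. indicator K z * M \<partial>circle)"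
      unfolding right_diff_distrib by (intro Bochner_Integration.integral_diff iK g) simp
    also have "(\<integral>z. indicator K z * M \<partial>circle) = M * measure circle K"
      by simp
    finally have "(\<integral>z. indicator K z * (g z - M) \<partial>circle) \<le> 0"
      using le[OF K(2)] by simp
    moreover have "0 \<le> (\<integral>z. indicator K z * (g z - M) \<partial>circle)"
      by (rule integral_nonneg_AE[OF nn])
    ultimately have "AE z in circle. indicator K z * (g z - M) = 0"
      using integral_nonneg_eq_0_iff_AE[OF int nn] by simp
    then have "AE z in circle. z \<notin> K"
      by eventually_elim (use K(1) in \<open>auto simp: indicator_def B_def split: if_splits\<close>)
    then show ?thesis
      using AE_iff_measurable[of K circle "\<lambda>z. z \<notin> K"] by simp
  qed
  then have "(SUP K \<in> {K. K \<subseteq> B \<and> compact K}. emeasure circle K) = 0"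
    by (subst SUP_eq_const) auto
  then have "emeasure circle B = 0"
    using inner_regular[of circle B] B by (simp add: emeasure_circle_UNIV)
  then show ?thesis
    using B by (intro AE_I[of _ _ B]) (auto simp: B_def not_le)
qed

text \<open>The indicator of \<open>K\<close> is a bounded pointwise limit, on the circle, of
  squared moduli of polynomials, and dominated convergence carries the bound over to it.\<close>

lemma integral_compact_le_of_poly_bound:
  assumes \<phi>: "sq_integrable \<phi>"
    and bound: "\<And>p. cmod (\<integral>z. \<phi> z * of_real ((cmod (poly p z))\<^sup>2) \<partial>circle)
      \<le> M * (\<integral>z. (cmod (poly p z))\<^sup>2 \<partial>circle)"
    and K: "compact K"
  shows "cmod (\<integral>z. of_real (indicator K z) * \<phi> z \<partial>circle) \<le> M * measure circle K"
\<comment> \<open>The empty set is treated apart because \<open>infdist\<close> to it is 0 by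
  convention, so that the functions \<open>u n\<close> below would be constantly 1.\<close>
proof (cases "K = {}")
  case False
  interpret finite_measure circle by (rule finite_measure_circle)
  have [measurable]: "\<phi> \<in> borel_measurable borel" "\<phi> \<in> borel_measurable circle"
    using \<phi> by (auto simp: sq_integrable_def)
  note i\<phi> = sq_integrable_imp_integrable[OF \<phi>]
  have [measurable]: "K \<in> sets borel" using K by (simp add: borel_compact)
  \<comment> \<open>Continuous, between 0 and 1, equal to 1 on \<open>K\<close>; at a point outside
    \<open>K\<close> it vanishes for large \<open>n\<close>, because \<open>K\<close> is
    closed.\<close>
  define u where "u n z = max 0 (1 - real n * infdist z K)" for n z
  have "\<exists>r. real_polynomial_function r \<and> (\<forall>z. cmod z = 1 \<longrightarrow> \<bar>u n z - r z\<bar> < 1 / real (Suc n))" for n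
  proof -
    have "compact (sphere (0::complex) 1)" "continuous_on (sphere 0 1) (u n)"
      unfolding u_def by (auto intro!: continuous_intros)
    from Stone_Weierstrass_real_polynomial_function[OF this, of "1 / real (Suc n)"]
    show ?thesis by (auto simp: dist_norm)
  qed
  then obtain r where r: "\<And>n. real_polynomial_function (r n)"
    and ur: "\<And>n z. cmod z = 1 \<Longrightarrow> \<bar>u n z - r n z\<bar> < 1 / real (Suc n)" by metis
  have [measurable]: "r n \<in> borel_measurable borel" for n
    using r by (intro borel_measurable_continuous_onI continuous_on_polymonial_function)
      (simp add: real_polynomial_function_eq)
  have bnd: "\<bar>r n z\<bar> \<le> 2" if "cmod z = 1" for n z
  proof -
    have "0 \<le> u n z" "u n z \<le> 1" by (auto simp: u_def infdist_nonneg)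
    moreover have "1 / real (Suc n) \<le> 1" by simp
    ultimately show ?thesis using ur[OF that, of n] by linarith
  qed
  \<comment> \<open>The values of \<open>u n\<close> are at most 1 and the approximation error is at
    most 1, which bounds \<open>r n\<close> by 2 and yields the dominating constant 4.\<close>
  have r2: "(r n z)\<^sup>2 \<le> 4" if "cmod z = 1" for n z
    using power_mono[OF bnd[OF that, of n], of 2] by simp
  have lim: "(\<lambda>n. (r n z)\<^sup>2) \<longlonglongrightarrow> indicator K z" if z: "cmod z = 1" for z
  proof -
    have "(\<lambda>n. u n z - r n z) \<longlonglongrightarrow> 0"
      by (rule Lim_null_comparison[OF _ LIMSEQ_inverse_real_of_nat])
        (use ur[OF z] in \<open>auto intro!: always_eventually less_imp_le simp: divide_inverse\<close>)
    moreover have "(\<lambda>n. u n z) \<longlonglongrightarrow> indicator K z"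
    proof (cases "z \<in> K")
      case True
      then show ?thesis by (simp add: u_def)
    next
      case nK: False
      then have pos: "infdist z K > 0"
        using K False by (simp add: infdist_pos_not_in_closed compact_imp_closed)
      obtain N where N: "1 / infdist z K < real N"
        using reals_Archimedean2 by blast
      have "u n z = indicator K z" if "n \<ge> N" for n
      proof -
        have "1 / infdist z K \<le> real n" using N that by linarith
        then have "1 \<le> real n * infdist z K" using pos by (simp add: pos_divide_le_eq)
        then show ?thesis using nK by (simp add: u_def)
      qed
      then have "eventually (\<lambda>n. u n z = indicator K z) sequentially"
        using eventually_sequentially by blast
      then show ?thesis by (rule tendsto_eventually)
    qed
    ultimately have "(\<lambda>n. u n z - (u n z - r n z)) \<longlonglongrightarrow> indicator K z - 0"
      by (intro tendsto_diff)
    then have "(\<lambda>n. (r n z)\<^sup>2) \<longlonglongrightarrow> (indicator K z)\<^sup>2"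
      by (intro tendsto_power) simp
    moreover have "(indicator K z :: real)\<^sup>2 = indicator K z"
      by (simp add: indicator_def)
    ultimately show ?thesis by simp
  qed
  \<comment> \<open>The approximants are squared to bring them into the form covered by the
    hypothesis: the factor \<open>z ^ m\<close> that turns \<open>r n\<close> into a polynomial has
    modulus 1 on the circle, so the square of \<open>r n\<close> equals the squared modulus of
    \<open>poly p\<close>.\<close>
  have le: "cmod (\<integral>z. of_real ((r n z)\<^sup>2) * \<phi> z \<partial>circle) \<le> M * (\<integral>z. (r n z)\<^sup>2 \<partial>circle)" for n
  proof -
    obtain m p where p: "\<And>z. cmod z = 1 \<Longrightarrow> of_real (r n z) * z ^ m = poly p z"
      using real_polynomial_function_circle[OF r] by blast
    have rp: "(r n z)\<^sup>2 = (cmod (poly p z))\<^sup>2" if "cmod z = 1" for z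
      using that by (simp add: p[OF that, symmetric] norm_mult norm_power)
    have [measurable]: "(\<lambda>z. poly p z) \<in> borel_measurable borel"
      by (intro borel_measurable_continuous_onI continuous_intros)
    have "(\<integral>z. of_real ((r n z)\<^sup>2) * \<phi> z \<partial>circle) = (\<integral>z. \<phi> z * of_real ((cmod (poly p z))\<^sup>2) \<partial>circle)"
      by (intro integral_cong_AE)
        (use AE_circle_norm rp in \<open>auto simp del: of_real_power elim!: eventually_mono\<close>)
    moreover have "(\<integral>z. (r n z)\<^sup>2 \<partial>circle) = (\<integral>z. (cmod (poly p z))\<^sup>2 \<partial>circle)"
      by (intro integral_cong_AE) (use AE_circle_norm rp in \<open>auto elim!: eventually_mono\<close>)
    ultimately show ?thesis using bound[of p] by simp
  qed
  have "(\<lambda>n. \<integral>z. of_real ((r n z)\<^sup>2) * \<phi> z \<partial>circle) \<longlonglongrightarrow> (\<integral>z. of_real (indicator K z) * \<phi> z \<partial>circle)"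
  proof (rule integral_dominated_convergence[where w = "\<lambda>z. 4 * cmod (\<phi> z)"])
    show "AE z in circle. (\<lambda>n. of_real ((r n z)\<^sup>2) * \<phi> z) \<longlonglongrightarrow> of_real (indicator K z) * \<phi> z"
      using AE_circle_norm by eventually_elim (intro tendsto_intros lim)
    show "AE z in circle. norm (of_real ((r n z)\<^sup>2) * \<phi> z) \<le> 4 * cmod (\<phi> z)" for n
      using AE_circle_norm by eventually_elim (auto simp: norm_mult norm_power intro!: mult_right_mono dest: r2[of _ n])
  qed (use i\<phi> in auto)
  moreover have "(\<lambda>n. \<integral>z. (r n z)\<^sup>2 \<partial>circle) \<longlonglongrightarrow> (\<integral>z. indicator K z \<partial>circle)"
  proof (rule integral_dominated_convergence[where w = "\<lambda>z. 4"])
    show "AE z in circle. (\<lambda>n. (r n z)\<^sup>2) \<longlonglongrightarrow> indicator K z"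
      using AE_circle_norm by eventually_elim (intro lim)
    show "AE z in circle. norm ((r n z)\<^sup>2) \<le> 4" for n
      using AE_circle_norm by eventually_elim (auto dest: r2[of _ n])
  qed auto
  ultimately show ?thesis
    using le by (intro LIMSEQ_le[OF tendsto_norm tendsto_mult_left]) auto
qed auto

text \<open>The bound on integrals over compact sets survives multiplication of
  \<open>\<phi>\<close> by a unimodular constant. The rotations by 1, -1, i and -i give the upper
  and lower bounds for the real and the imaginary part.\<close>

lemma ess_bound_of_poly_bound:
  assumes \<phi>: "sq_integrable \<phi>"
    and bound: "\<And>p. cmod (\<integral>z. \<phi> z * of_real ((cmod (poly p z))\<^sup>2) \<partial>circle)
      \<le> M * (\<integral>z. (cmod (poly p z))\<^sup>2 \<partial>circle)"
  shows "AE z in circle. \<bar>Re (\<phi> z)\<bar> \<le> M \<and> \<bar>Im (\<phi> z)\<bar> \<le> M"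
proof -
  note i\<phi> = sq_integrable_imp_integrable[OF \<phi>]
  have AE: "AE z in circle. Re (c * \<phi> z) \<le> M" if c: "cmod c = 1" for c
  proof (rule AE_le_of_compact_integrals)
    show "integrable circle (\<lambda>z. Re (c * \<phi> z))" using i\<phi> by (intro integrable_Re) simp
    fix K :: "complex set" assume K: "compact K"
    have ik: "integrable circle (\<lambda>z. of_real (indicator K z) * \<phi> z)"
      using integrable_mult_indicator[OF _ i\<phi>, of K] K by (simp add: borel_compact scaleR_conv_of_real)
    have "(\<integral>z. indicator K z * Re (c * \<phi> z) \<partial>circle) = (\<integral>z. Re (c * (of_real (indicator K z) * \<phi> z)) \<partial>circle)"
      by (intro Bochner_Integration.integral_cong) (auto simp: indicator_def)
    also have "\<dots> = Re (c * (\<integral>z. of_real (indicator K z) * \<phi> z \<partial>circle))"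
      using ik by (subst integral_Re) simp_all
    also have "\<dots> \<le> cmod (\<integral>z. of_real (indicator K z) * \<phi> z \<partial>circle)"
      using complex_Re_le_cmod[of "c * _"] c by (simp add: norm_mult)
    also have "\<dots> \<le> M * measure circle K"
      by (rule integral_compact_le_of_poly_bound[OF \<phi> bound K])
    finally show "(\<integral>z. indicator K z * Re (c * \<phi> z) \<partial>circle) \<le> M * measure circle K" .
  qed
  show ?thesis
    using AE[of 1, simplified] AE[of "-1", simplified] AE[of \<i>, simplified] AE[of "-\<i>", simplified]
    by eventually_elim (auto simp: abs_le_iff)
qed


section \<open>Completeness of \<open>L\<^sup>2\<close> and Fourier coefficients\<close>

lemma L2_cases:
  obtains u where "sq_integrable u" "f = abs_L2 u"
proof -
  obtain u where "L2_rel u u" "f = abs_L2 u"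
    using Quotient_L2 by (metis Quotient_abs_rep Quotient_rep_reflp)
  then show ?thesis using that by (auto simp: L2_rel_def)
qed

lemma L2_rel_self: "sq_integrable u \<Longrightarrow> L2_rel u u"
  by (simp add: L2_rel_def)

lemma abs_L2_eqI:
  "sq_integrable u \<Longrightarrow> sq_integrable v \<Longrightarrow> AE z in circle. u z = v z \<Longrightarrow> abs_L2 u = abs_L2 v"
  by (rule Quotient_rel_abs[OF Quotient_L2]) (simp add: L2_rel_def)

lemma cinner_abs_L2:
  "sq_integrable u \<Longrightarrow> sq_integrable v \<Longrightarrow>
    cinner (abs_L2 u) (abs_L2 v) = (\<integral>z. u z * cnj (v z) \<partial>circle)"
  by (simp add: cinner_L2.abs_eq L2_rel_self)

lemma fourier_abs_L2:
  "sq_integrable u \<Longrightarrow> fourier (abs_L2 u) n = (\<integral>z. u z * z powi (- n) \<partial>circle)"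
  by (simp add: fourier.abs_eq L2_rel_self)

lemma norm_abs_L2:
  assumes "sq_integrable u"
  shows "(norm (abs_L2 u))\<^sup>2 = (\<integral>z. (cmod (u z))\<^sup>2 \<partial>circle)"
proof -
  have "complex_of_real ((norm (abs_L2 u))\<^sup>2) = (\<integral>z. u z * cnj (u z) \<partial>circle)"
    using assms by (simp only: cinner_self[symmetric] cinner_abs_L2)
  also have "\<dots> = complex_of_real (\<integral>z. (cmod (u z))\<^sup>2 \<partial>circle)"
    by (simp only: complex_norm_square[symmetric] integral_complex_of_real)
  finally show ?thesis by (simp only: of_real_eq_iff)
qed

lemma sq_integrable_diff:
  "sq_integrable u \<Longrightarrow> sq_integrable v \<Longrightarrow> sq_integrable (\<lambda>z. u z - v z)"
  using sq_integrable_add[of u "\<lambda>z. (- 1) * v z"] sq_integrable_scale[of v "- 1"] by simp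

lemma diff_abs_L2:
  assumes "sq_integrable u" "sq_integrable v"
  shows "abs_L2 u - abs_L2 v = abs_L2 (\<lambda>z. u z - v z)"
proof -
  have "abs_L2 (\<lambda>z. u z - v z) + abs_L2 v = abs_L2 u"
    using assms by (simp add: plus_L2.abs_eq L2_rel_self sq_integrable_diff)
  then show ?thesis by (metis add_diff_cancel_right')
qed

text \<open>Cauchy-Schwarz against the constant 1, which has norm 1 because the measure is
  normalized. It lets L^2-summable steps be treated as L^1-summable ones.\<close>

lemma integral_cmod_le_norm:
  assumes u: "sq_integrable u"
  shows "integrable circle (\<lambda>z. cmod (u z))" "(\<integral>z. cmod (u z) \<partial>circle) \<le> norm (abs_L2 u)"
proof -
  have v: "sq_integrable (\<lambda>z. complex_of_real (cmod (u z)))" and one: "sq_integrable (\<lambda>_. 1)"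
    using u sq_integrable_bounded[of "\<lambda>_. 1" 1] by (auto simp: sq_integrable_def)
  show "integrable circle (\<lambda>z. cmod (u z))"
    using sq_integrable_imp_integrable[OF u] by simp
  have "(norm (abs_L2 (\<lambda>z. complex_of_real (cmod (u z)))))\<^sup>2 = (norm (abs_L2 u))\<^sup>2"
    by (simp add: norm_abs_L2 u v)
  then have n: "norm (abs_L2 (\<lambda>z. complex_of_real (cmod (u z)))) = norm (abs_L2 u)"
    by (simp add: power2_eq_iff_nonneg)
  have "(norm (abs_L2 (\<lambda>_. 1)))\<^sup>2 = 1"
    by (subst norm_abs_L2[OF one]) (simp add: measure_def emeasure_circle_UNIV)
  then have 1: "norm (abs_L2 (\<lambda>_. 1)) = 1"
    by (metis abs_norm_cancel real_sqrt_abs real_sqrt_one)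
  have "cmod (cinner (abs_L2 (\<lambda>z. complex_of_real (cmod (u z)))) (abs_L2 (\<lambda>_. 1))) \<le> norm (abs_L2 u)"
    using norm_cinner_le[of "abs_L2 (\<lambda>z. complex_of_real (cmod (u z)))" "abs_L2 (\<lambda>_. 1)"] n 1 by simp
  also have "cinner (abs_L2 (\<lambda>z. complex_of_real (cmod (u z)))) (abs_L2 (\<lambda>_. 1)) = complex_of_real (\<integral>z. cmod (u z) \<partial>circle)"
    by (subst cinner_abs_L2[OF v one]) simp
  finally show "(\<integral>z. cmod (u z) \<partial>circle) \<le> norm (abs_L2 u)" by simp
qed

text \<open>The Riesz-Fischer argument: a rapidly converging subsequence converges almost
  everywhere, Fatou's lemma turns the pointwise limit into a limit in norm, and a Cauchy sequence
  follows its subsequence.\<close>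

lemma L2_complete:
  fixes X :: "nat \<Rightarrow> L2"
  assumes "Cauchy X"
  shows "\<exists>f. X \<longlonglongrightarrow> f"
proof -
  have "\<exists>N. \<forall>m\<ge>N. \<forall>n\<ge>N. norm (X m - X n) < (1/2) ^ k" for k
    using metric_CauchyD[OF assms, of "(1/2) ^ k"] by (simp add: dist_norm)
  then obtain N where N: "\<And>k m n. m \<ge> N k \<Longrightarrow> n \<ge> N k \<Longrightarrow> norm (X m - X n) < (1/2) ^ k"
    by metis
  \<comment> \<open>Summing the thresholds gives indices that lie beyond each \<open>N k\<close> and
    also grow monotonically with \<open>k\<close>.\<close>
  define s where "s k = (\<Sum>i\<le>k. N i)" for k
  have sN: "N k \<le> s k" for k
    unfolding s_def by (rule member_le_sum) auto
  have smono: "s k \<le> s l" if "k \<le> l" for k l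
    unfolding s_def using that by (intro sum_mono2) auto
  have close: "norm (X (s l) - X (s k)) < (1/2) ^ k" if "k \<le> l" for k l
    using N[of k "s l" "s k"] sN[of k] smono[OF that] by linarith
  have "\<exists>u. sq_integrable u \<and> X (s k) = abs_L2 u" for k
    by (rule L2_cases) auto
  then obtain u where u: "\<And>k. sq_integrable (u k)" and Xu: "\<And>k. X (s k) = abs_L2 (u k)"
    by metis
  have [measurable]: "u k \<in> borel_measurable circle" for k
    using u[of k] by (simp add: sq_integrable_def)
  define d where "d k z = u (Suc k) z - u k z" for k z
  have d: "sq_integrable (d k)" for k
    unfolding d_def by (intro sq_integrable_diff u)
  have [measurable]: "d k \<in> borel_measurable circle" for k
    using d[of k] by (simp add: sq_integrable_def)
  have dk: "(\<integral>\<^sup>+z. ennreal (cmod (d k z)) \<partial>circle) \<le> ennreal ((1/2) ^ k)" for k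
  proof -
    have "abs_L2 (d k) = X (s (Suc k)) - X (s k)"
      by (simp add: Xu diff_abs_L2 u d_def[abs_def])
    then have "(\<integral>z. cmod (d k z) \<partial>circle) \<le> (1/2) ^ k"
      using integral_cmod_le_norm(2)[OF d, of k] close[of k "Suc k"] by simp
    then show ?thesis
      by (subst nn_integral_eq_integral) (use integral_cmod_le_norm(1)[OF d] in \<open>auto intro!: ennreal_leI\<close>)
  qed
  have "(\<integral>\<^sup>+z. (\<Sum>k. ennreal (cmod (d k z))) \<partial>circle) = (\<Sum>k. \<integral>\<^sup>+z. ennreal (cmod (d k z)) \<partial>circle)"
    by (rule nn_integral_suminf) simp
  also have "\<dots> \<le> (\<Sum>k. ennreal ((1/2) ^ k))"
    by (intro suminf_le dk) auto
  also have "\<dots> = ennreal (\<Sum>k. (1/2) ^ k)"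
    by (rule suminf_ennreal2) (auto intro!: summable_geometric)
  finally have "(\<integral>\<^sup>+z. (\<Sum>k. ennreal (cmod (d k z))) \<partial>circle) \<noteq> \<infinity>"
    by (auto simp: top_unique)
  then have AE_fin: "AE z in circle. (\<Sum>k. ennreal (cmod (d k z))) \<noteq> \<infinity>"
    by (intro nn_integral_noteq_infinite) auto
  \<comment> \<open>Where the sequence diverges \<open>lim\<close> has an arbitrary value; this
    concerns only a null set, and \<open>f\<close> is measurable in any case.\<close>
  define f where "f z = lim (\<lambda>k. u k z)" for z
  have [measurable]: "f \<in> borel_measurable circle"
    unfolding f_def by measurable
  have AE_lim: "AE z in circle. (\<lambda>k. u k z) \<longlonglongrightarrow> f z"
    using AE_fin
  proof eventually_elim
    case (elim z)
    then have "summable (\<lambda>k. cmod (d k z))"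
      by (intro summable_suminf_not_top) auto
    then have "summable (\<lambda>k. d k z)"
      by (rule summable_norm_cancel)
    then have "convergent (\<lambda>n. \<Sum>k<n. d k z)"
      by (simp add: summable_iff_convergent)
    moreover have "(\<Sum>k<n. d k z) = u n z - u 0 z" for n
      unfolding d_def by (rule sum_lessThan_telescope)
    ultimately have "convergent (\<lambda>n. u n z - u 0 z)" by simp
    from convergent_add[OF this convergent_const[of "u 0 z"]] have "convergent (\<lambda>n. u n z)" by simp
    then show ?case
      unfolding f_def by (simp add: convergent_LIMSEQ_iff)
  qed
  \<comment> \<open>With \<open>k\<close> fixed, Fatou's lemma is applied in \<open>l\<close> to the
    differences u_l - u_k, whose L^2 norms are below (1/2)^k once \<open>l\<close> is at least
    \<open>k\<close>.\<close>
  have fatou: "(\<integral>\<^sup>+z. ennreal ((cmod (f z - u k z))\<^sup>2) \<partial>circle) \<le> ennreal (((1/2) ^ k)\<^sup>2)" for k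
  proof -
    have "AE z in circle. ennreal ((cmod (f z - u k z))\<^sup>2) = liminf (\<lambda>l. ennreal ((cmod (u l z - u k z))\<^sup>2))"
      using AE_lim
    proof eventually_elim
      case (elim z)
      then have "(\<lambda>l. ennreal ((cmod (u l z - u k z))\<^sup>2)) \<longlonglongrightarrow> ennreal ((cmod (f z - u k z))\<^sup>2)"
        by (intro tendsto_ennrealI tendsto_intros)
      then show ?case
        by (rule lim_imp_Liminf[OF sequentially_bot, symmetric])
    qed
    then have "(\<integral>\<^sup>+z. ennreal ((cmod (f z - u k z))\<^sup>2) \<partial>circle)
        = (\<integral>\<^sup>+z. liminf (\<lambda>l. ennreal ((cmod (u l z - u k z))\<^sup>2)) \<partial>circle)"
      by (rule nn_integral_cong_AE)
    also have "\<dots> \<le> liminf (\<lambda>l. \<integral>\<^sup>+z. ennreal ((cmod (u l z - u k z))\<^sup>2) \<partial>circle)"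
      by (rule nn_integral_liminf) simp
    also have "\<dots> \<le> ennreal (((1/2) ^ k)\<^sup>2)"
    proof (rule Liminf_le)
      show "eventually (\<lambda>l. (\<integral>\<^sup>+z. ennreal ((cmod (u l z - u k z))\<^sup>2) \<partial>circle) \<le> ennreal (((1/2) ^ k)\<^sup>2)) sequentially"
        using eventually_ge_at_top[of k]
      proof eventually_elim
        case (elim l)
        have sq: "sq_integrable (\<lambda>z. u l z - u k z)" by (intro sq_integrable_diff u)
        have "(\<integral>z. (cmod (u l z - u k z))\<^sup>2 \<partial>circle) = (norm (X (s l) - X (s k)))\<^sup>2"
          by (simp add: Xu diff_abs_L2 u norm_abs_L2[OF sq])
        also have "\<dots> \<le> ((1/2) ^ k)\<^sup>2"
          using close[OF elim] by (intro power_mono) auto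
        finally show ?case
          by (subst nn_integral_eq_integral) (use sq in \<open>auto simp: sq_integrable_def intro!: ennreal_leI\<close>)
      qed
    qed simp
    finally show ?thesis .
  qed
  have fu: "sq_integrable (\<lambda>z. f z - u k z)" for k
  proof -
    have "(\<integral>\<^sup>+z. ennreal (norm ((cmod (f z - u k z))\<^sup>2)) \<partial>circle) < \<infinity>"
      using fatou[of k] by (simp add: less_top[symmetric] top_unique) (metis ennreal_neq_top neq_top_trans)
    then show ?thesis
      unfolding sq_integrable_def by (intro conjI integrableI_bounded) auto
  qed
  have f: "sq_integrable f"
    using sq_integrable_add[OF fu u, of 0 0] by simp
  have lim: "norm (abs_L2 f - X (s k)) \<le> (1/2) ^ k" for k
  proof -
    have "ennreal ((norm (abs_L2 f - X (s k)))\<^sup>2) = (\<integral>\<^sup>+z. ennreal ((cmod (f z - u k z))\<^sup>2) \<partial>circle)"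
      using fu[of k] by (subst nn_integral_eq_integral)
        (simp_all add: Xu diff_abs_L2[OF f u] norm_abs_L2[OF fu] sq_integrable_def)
    then have "ennreal ((norm (abs_L2 f - X (s k)))\<^sup>2) \<le> ennreal (((1/2) ^ k)\<^sup>2)"
      using fatou[of k] by (simp only:)
    then have "(norm (abs_L2 f - X (s k)))\<^sup>2 \<le> ((1/2) ^ k)\<^sup>2"
      by (subst (asm) ennreal_le_iff) simp_all
    then show ?thesis by (rule power2_le_imp_le) simp
  qed
  have "X \<longlonglongrightarrow> abs_L2 f"
  proof (rule LIMSEQ_I)
    fix r :: real assume "0 < r"
    then obtain k where k: "(1/2) ^ k < r / 2"
      using real_arch_pow_inv[of "r / 2" "1/2"] by auto
    have "norm (X n - abs_L2 f) < r" if n: "n \<ge> N k" for n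
    proof -
      have "norm (X n - abs_L2 f) \<le> norm (X n - X (s k)) + norm (X (s k) - abs_L2 f)"
        using norm_triangle_ineq[of "X n - X (s k)" "X (s k) - abs_L2 f"] by simp
      also have "\<dots> < r"
        using N[OF n sN] lim[of k] k by (simp add: norm_minus_commute)
      finally show ?thesis .
    qed
    then show "\<exists>no. \<forall>n\<ge>no. norm (X n - abs_L2 f) < r" by blast
  qed
  then show ?thesis by blast
qed


lemma tendsto_cinner_left:
  fixes f :: "'a::complex_inner"
  assumes "X \<longlonglongrightarrow> f"
  shows "(\<lambda>n. cinner (X n) y) \<longlonglongrightarrow> cinner f y"
proof -
  have "(\<lambda>n. norm (X n - f) * norm y) \<longlonglongrightarrow> 0"
    using tendsto_mult_left_zero[OF tendsto_norm_zero[OF LIM_zero[OF assms]]] .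
  then have "(\<lambda>n. cinner (X n) y - cinner f y) \<longlonglongrightarrow> 0"
    by (rule Lim_null_comparison[rotated])
      (auto simp: norm_cinner_le simp flip: cinner_diff_left)
  then show ?thesis by (rule LIM_zero_cancel)
qed

lemma cinner_orthonormal_series:
  fixes e :: "nat \<Rightarrow> 'a::complex_inner"
  assumes e: "\<And>i j. cinner (e i) (e j) = of_bool (i = j)"
    and lim: "(\<lambda>N. \<Sum>n<N. a n *\<^sub>C e n) \<longlonglongrightarrow> f"
  shows "cinner f (e k) = a k"
proof -
  have "eventually (\<lambda>N. cinner (\<Sum>n<N. a n *\<^sub>C e n) (e k) = a k) sequentially"
    using eventually_gt_at_top[of k]
    by eventually_elim (simp add: cinner_orthonormal_sum[OF _ e])
  then have "(\<lambda>N. cinner (\<Sum>n<N. a n *\<^sub>C e n) (e k)) \<longlonglongrightarrow> a k"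
    by (rule tendsto_eventually)
  then show ?thesis
    using tendsto_cinner_left[OF lim] LIMSEQ_unique by blast
qed

section \<open>The trigonometric system and Toeplitz forms\<close>

lemma sq_integrable_powi: "sq_integrable (\<lambda>z. z powi k)"
  by (rule sq_integrable_bounded[where B = 1]) (auto simp: norm_power_int)

lemma ess_boundedI:
  assumes "f \<in> borel_measurable borel" "\<And>z. cmod z = 1 \<Longrightarrow> cmod (f z) \<le> B"
  shows "ess_bounded f"
  unfolding ess_bounded_def using assms AE_circle_norm
  by (auto intro!: exI[of _ B] elim!: eventually_mono)

lemma ess_bounded_powi: "ess_bounded (\<lambda>z. z powi k)"
  by (rule ess_boundedI[where B = 1]) (auto simp: norm_power_int)

lemma cnj_powi:
  assumes "cmod z = 1" shows "cnj (z powi n) = z powi (- n)"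
proof -
  have "z * cnj z = 1"
    using complex_norm_square[of z] assms by simp
  then have "cnj z = inverse z"
    by (metis inverse_unique)
  then show ?thesis
    by (simp add: power_int_def power_inverse)
qed

definition circle_monom :: "int \<Rightarrow> L2" where
  "circle_monom k = abs_L2 (\<lambda>z. z powi k)"

lemma fourier_cinner: "fourier f n = cinner f (circle_monom n)"
proof -
  obtain u where u: "sq_integrable u" "f = abs_L2 u" by (rule L2_cases)
  have "(\<integral>z. u z * z powi (- n) \<partial>circle) = (\<integral>z. u z * cnj (z powi n) \<partial>circle)"
  proof (intro integral_cong_AE)
    show "AE z in circle. u z * z powi (- n) = u z * cnj (z powi n)"
      using AE_circle_norm by eventually_elim (simp only: cnj_powi)
  qed (use u in \<open>auto simp: sq_integrable_def\<close>)
  then show ?thesis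
    using u by (simp add: circle_monom_def cinner_abs_L2 fourier_abs_L2 sq_integrable_powi)
qed

lemma cinner_circle_monom: "cinner (circle_monom i) (circle_monom j) = of_bool (i = j)"
proof -
  have "cinner (circle_monom i) (circle_monom j) = (\<integral>z. z powi i * z powi (- j) \<partial>circle)"
    unfolding fourier_cinner[symmetric] by (simp add: circle_monom_def fourier_abs_L2 sq_integrable_powi)
  also have "\<dots> = (\<integral>z. z powi (i - j) \<partial>circle)"
  proof (intro integral_cong_AE)
    show "AE z in circle. z powi i * z powi (- j) = z powi (i - j)"
      using AE_circle_norm
    proof eventually_elim
      case (elim z)
      then have "z \<noteq> 0" by auto
      then show ?case by (simp flip: power_int_add)
    qed
  qed auto
  finally show ?thesis by (simp add: integral_circle_powi)
qed

text \<open>Since cnj z = 1/z on the circle, expanding the squared modulus gives the quadratic form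
  of the Toeplitz matrix of \<open>\<phi>\<close> at the coefficient vector of \<open>p\<close>.
  This translates the hypothesis of \<open>ess_bound_of_poly_bound\<close> into a statement about
  matrices.\<close>

lemma integral_poly_square:
  assumes \<phi>: "sq_integrable \<phi>"
  shows "(\<integral>z. \<phi> z * of_real ((cmod (poly p z))\<^sup>2) \<partial>circle) = (\<Sum>i\<le>degree p. \<Sum>j\<le>degree p.
    fourier (abs_L2 \<phi>) (int i - int j) * coeff p j * cnj (coeff p i))"
proof -
  have [measurable]: "\<phi> \<in> borel_measurable borel"
    using \<phi> measurable_cong_sets[OF sets_circle refl] by (auto simp: sq_integrable_def)
  have [measurable]: "(\<lambda>z. poly p z) \<in> borel_measurable borel"
    by (intro borel_measurable_continuous_onI continuous_intros)
  have int: "integrable circle (\<lambda>z. \<phi> z * z powi k)" for k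
    using sq_integrable_imp_integrable[OF sq_integrable_mult[OF ess_bounded_powi \<phi>]]
    by (simp add: mult.commute)
  have eq: "\<phi> z * of_real ((cmod (poly p z))\<^sup>2) = (\<Sum>i\<le>degree p. \<Sum>j\<le>degree p.
      \<phi> z * z powi (- (int i - int j)) * (coeff p j * cnj (coeff p i)))" if z: "cmod z = 1" for z
  proof -
    from z have "z \<noteq> 0" by auto
    have "cnj (poly p z) = (\<Sum>i\<le>degree p. cnj (coeff p i) * z powi (- int i))"
      using cnj_powi[OF z] by (simp add: poly_altdef flip: power_int_of_nat)
    then have "\<phi> z * of_real ((cmod (poly p z))\<^sup>2) = \<phi> z * ((\<Sum>i\<le>degree p. cnj (coeff p i) * z powi (- int i)) *
        (\<Sum>j\<le>degree p. coeff p j * z powi int j))"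
      by (simp add: complex_norm_square poly_altdef mult.commute del: of_real_power)
    also have "\<dots> = (\<Sum>i\<le>degree p. \<Sum>j\<le>degree p.
        \<phi> z * (cnj (coeff p i) * z powi (- int i) * (coeff p j * z powi int j)))"
      by (subst sum_product) (simp only: sum_distrib_left)
    also have "\<dots> = (\<Sum>i\<le>degree p. \<Sum>j\<le>degree p.
      \<phi> z * z powi (- (int i - int j)) * (coeff p j * cnj (coeff p i)))"
    proof (intro sum.cong refl)
      fix i j
      have "z powi (- (int i - int j)) = z powi (- int i) * z powi int j"
        using power_int_add[of z "- int i" "int j"] \<open>z \<noteq> 0\<close>
        by (simp only: minus_diff_eq uminus_add_conv_diff simp_thms)
      then show "\<phi> z * (cnj (coeff p i) * z powi (- int i) * (coeff p j * z powi int j))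
        = \<phi> z * z powi (- (int i - int j)) * (coeff p j * cnj (coeff p i))"
        by (simp only: mult_ac)
    qed
    finally show ?thesis .
  qed
  have "(\<integral>z. \<phi> z * of_real ((cmod (poly p z))\<^sup>2) \<partial>circle) = (\<integral>z. (\<Sum>i\<le>degree p. \<Sum>j\<le>degree p.
      \<phi> z * z powi (- (int i - int j)) * (coeff p j * cnj (coeff p i))) \<partial>circle)"
    by (intro integral_cong_AE eventually_mono[OF AE_circle_norm] eq) measurable
  also have "\<dots> = (\<Sum>i\<le>degree p. \<Sum>j\<le>degree p.
      (\<integral>z. \<phi> z * z powi (- (int i - int j)) \<partial>circle) * (coeff p j * cnj (coeff p i)))"
    by (simp only: Bochner_Integration.integral_sum Bochner_Integration.integrable_sum
        integral_mult_left_zero integrable_mult_left int)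
  finally show ?thesis
    by (simp add: fourier_abs_L2[OF \<phi>] mult.assoc)
qed

text \<open>The case \<open>\<phi> = 1\<close> of \<open>integral_poly_square\<close>, where the
  Toeplitz matrix is the identity.\<close>

lemma integral_poly_norm:
  "(\<integral>z. (cmod (poly p z))\<^sup>2 \<partial>circle) = (\<Sum>i\<le>degree p. (cmod (coeff p i))\<^sup>2)"
proof -
  have one: "(\<lambda>_. 1) = (\<lambda>z::complex. z powi 0)" by simp
  have f1: "fourier (abs_L2 (\<lambda>_. 1)) k = of_bool (k = 0)" for k
    unfolding one circle_monom_def[symmetric] fourier_cinner
    by (auto simp: cinner_circle_monom)
  have "complex_of_real (\<integral>z. (cmod (poly p z))\<^sup>2 \<partial>circle) = (\<integral>z. 1 * of_real ((cmod (poly p z))\<^sup>2) \<partial>circle)"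
    by (simp only: integral_complex_of_real mult_1_left)
  also have "\<dots> = (\<Sum>i\<le>degree p. \<Sum>j\<le>degree p.
      fourier (abs_L2 (\<lambda>_. 1)) (int i - int j) * coeff p j * cnj (coeff p i))"
    by (rule integral_poly_square) (simp add: sq_integrable_bounded[of "\<lambda>_. 1" 1])
  also have "\<dots> = (\<Sum>i\<le>degree p. \<Sum>j\<le>degree p. if i = j then coeff p j * cnj (coeff p i) else 0)"
    by (intro sum.cong refl) (simp add: f1)
  also have "\<dots> = (\<Sum>i\<le>degree p. coeff p i * cnj (coeff p i))"
    by simp
  also have "\<dots> = complex_of_real (\<Sum>i\<le>degree p. (cmod (coeff p i))\<^sup>2)"
    by (simp add: complex_norm_square del: of_real_power)
  finally show ?thesis by (simp only: of_real_eq_iff)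
qed

text \<open>If all coefficients of the difference vanish, so does its Toeplitz form, and the
  essential bound holds with constant 0.\<close>

lemma fourier_inject:
  assumes "\<And>n. fourier f n = fourier g n"
  shows "f = g"
proof -
  obtain u where u: "sq_integrable u" "f - g = abs_L2 u" by (rule L2_cases)
  have z: "fourier (abs_L2 u) n = 0" for n
    using assms by (simp add: fourier_cinner cinner_diff_left flip: u(2))
  have "AE z in circle. \<bar>Re (u z)\<bar> \<le> 0 \<and> \<bar>Im (u z)\<bar> \<le> 0"
    by (rule ess_bound_of_poly_bound[OF u(1)]) (simp add: integral_poly_square[OF u(1)] z del: of_real_power)
  then have "AE z in circle. u z = 0"
    by eventually_elim (simp add: complex_eq_iff)
  then have "abs_L2 u = 0"
    unfolding zero_L2_def by (intro abs_L2_eqI u sq_integrable_zero)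
  then show ?thesis using u(2) by simp
qed

text \<open>The two hypotheses have separate roles: \<open>sq\<close> produces an L^2 function with
  coefficients \<open>t\<close>, and \<open>form\<close> shows that this function is essentially
  bounded.\<close>

lemma Linf_of_bounded_form:
  fixes t :: "int \<Rightarrow> complex"
  assumes form: "\<And>N a. cmod (\<Sum>i\<le>N. \<Sum>j\<le>N. t (int i - int j) * a j * cnj (a i)) \<le> M * (\<Sum>i\<le>N. (cmod (a i))\<^sup>2)"
    and sq: "\<And>N. (\<Sum>k\<in>{- int N..int N}. (cmod (t k))\<^sup>2) \<le> C"
  shows "\<exists>\<phi>\<in>Linf. \<forall>k. fourier \<phi> k = t k"
proof -
  \<comment> \<open>\<open>int_decode\<close> enumerates the integers, which turns the two-sided
    series into an ordinary one.\<close>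
  define e where "e n = circle_monom (int_decode n)" for n
  have e: "cinner (e i) (e j) = of_bool (i = j)" for i j
    by (simp add: e_def cinner_circle_monom inj_eq[OF inj_int_decode])
  have "(\<Sum>n<m. (cmod (t (int_decode n)))\<^sup>2) \<le> C" for m
  proof -
    \<comment> \<open>A sum of absolute values dominates each of them, so the first \<open>m\<close>
      enumerated integers lie between -N and N.\<close>
    define N where "N = (\<Sum>n<m. nat \<bar>int_decode n\<bar>)"
    have "\<bar>int_decode n\<bar> \<le> int N" if "n < m" for n
    proof -
      have "nat \<bar>int_decode n\<bar> \<le> N"
        unfolding N_def by (rule member_le_sum) (use that in auto)
      then show ?thesis by linarith
    qed
    then have sub: "int_decode ` {..<m} \<subseteq> {- int N..int N}"
      by (fastforce simp: abs_le_iff)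
    have "(\<Sum>n<m. (cmod (t (int_decode n)))\<^sup>2) = (\<Sum>k\<in>int_decode ` {..<m}. (cmod (t k))\<^sup>2)"
      by (subst sum.reindex) (auto simp: inj_int_decode)
    also have "\<dots> \<le> (\<Sum>k\<in>{- int N..int N}. (cmod (t k))\<^sup>2)"
      by (rule sum_mono2) (use sub in auto)
    also have "\<dots> \<le> C" by (rule sq)
    finally show ?thesis .
  qed
  then have "summable (\<lambda>n. (cmod (t (int_decode n)))\<^sup>2)"
    by (intro summableI_nonneg_bounded[where x = C]) auto
  from L2_complete[OF orthonormal_series_Cauchy[of e "\<lambda>n. t (int_decode n)", OF e this]] obtain \<phi>
    where \<phi>: "(\<lambda>N. \<Sum>n<N. t (int_decode n) *\<^sub>C e n) \<longlonglongrightarrow> \<phi>" by blast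
  have four: "fourier \<phi> k = t k" for k
    using cinner_orthonormal_series[OF e \<phi>, of "int_encode k"] by (simp add: e_def fourier_cinner)
  obtain u where u: "sq_integrable u" "\<phi> = abs_L2 u" by (rule L2_cases)
  have "AE z in circle. \<bar>Re (u z)\<bar> \<le> M \<and> \<bar>Im (u z)\<bar> \<le> M"
    by (rule ess_bound_of_poly_bound[OF u(1)])
      (simp add: integral_poly_square[OF u(1)] four[unfolded u(2)] integral_poly_norm form del: of_real_power)
  \<comment> \<open>The modulus is at most the sum of the absolute values of real and imaginary
    part. The loss against \<open>M\<close> is harmless because \<open>Linf\<close> asks only for
    some bound.\<close>
  then have "AE z in circle. cmod (u z) \<le> M + M"
    by eventually_elim (use cmod_le in \<open>smt (verit)\<close>)
  then have "ess_bounded u"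
    using u(1) by (auto simp: ess_bounded_def sq_integrable_def)
  then have "\<phi> \<in> Linf"
    using u by (simp add: Linf_def bounded_L2.abs_eq L2_rel_self)
  with four show ?thesis by blast
qed


section \<open>Operators on \<open>L\<^sup>2\<close>\<close>

lemma abs_L2_in_Linf: "sq_integrable u \<Longrightarrow> abs_L2 u \<in> Linf \<longleftrightarrow> ess_bounded u"
  by (simp add: Linf_def bounded_L2.abs_eq L2_rel_self)

lemma mult_abs_L2:
  "sq_integrable u \<Longrightarrow> ess_bounded u \<Longrightarrow> sq_integrable v \<Longrightarrow>
    mult_L2 (abs_L2 u) (abs_L2 v) = abs_L2 (\<lambda>z. u z * v z)"
  by (simp add: mult_L2.abs_eq L2_rel_self)

lemma mult_circle_monom:
  assumes "\<phi> \<in> Linf"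
  shows "fourier (mult_L2 \<phi> (circle_monom j)) i = fourier \<phi> (i - j)"
proof -
  obtain u where u: "sq_integrable u" "\<phi> = abs_L2 u" by (rule L2_cases)
  have b: "ess_bounded u" using assms u by (simp add: abs_L2_in_Linf)
  have [measurable]: "u \<in> borel_measurable borel"
    using u(1) measurable_cong_sets[OF sets_circle refl] by (auto simp: sq_integrable_def)
  have "(\<integral>z. u z * z powi j * z powi (- i) \<partial>circle) = (\<integral>z. u z * z powi (- (i - j)) \<partial>circle)"
  proof (intro integral_cong_AE)
    show "AE z in circle. u z * z powi j * z powi (- i) = u z * z powi (- (i - j))"
      using AE_circle_norm
    proof eventually_elim
      case (elim z)
      then have "z \<noteq> 0" by auto
      then show ?case by (simp add: mult.assoc flip: power_int_add)
    qed
  qed auto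
  then show ?thesis
    using u b by (simp add: circle_monom_def mult_abs_L2 sq_integrable_powi fourier_abs_L2 sq_integrable_mult)
qed

lemma bounded_clinear_mult_L2:
  assumes "\<phi> \<in> Linf"
  shows "bounded_clinear (mult_L2 \<phi>)"
proof -
  obtain u where u: "sq_integrable u" "\<phi> = abs_L2 u" by (rule L2_cases)
  have b: "ess_bounded u" using assms u by (simp add: abs_L2_in_Linf)
  then obtain C where C: "AE z in circle. cmod (u z) \<le> C"
    by (auto simp: ess_bounded_def)
  show ?thesis
  proof (rule bounded_clinearI[where M = "\<bar>C\<bar>"])
    fix f g :: L2 and c :: complex
    obtain v w where v: "sq_integrable v" "f = abs_L2 v" and w: "sq_integrable w" "g = abs_L2 w"
      by (metis L2_cases)
    show "mult_L2 \<phi> (f + g) = mult_L2 \<phi> f + mult_L2 \<phi> g"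
      using u v w b by (simp add: plus_L2.abs_eq L2_rel_self mult_abs_L2 sq_integrable_add
          sq_integrable_mult distrib_left)
    show "mult_L2 \<phi> (c *\<^sub>C f) = c *\<^sub>C mult_L2 \<phi> f"
      using u v b by (simp add: scaleC_L2.abs_eq L2_rel_self mult_abs_L2 sq_integrable_scale
          sq_integrable_mult mult.left_commute)
    have uv: "sq_integrable (\<lambda>z. u z * v z)" using b v by (simp add: sq_integrable_mult)
    have "(norm (mult_L2 \<phi> f))\<^sup>2 = (\<integral>z. (cmod (u z * v z))\<^sup>2 \<partial>circle)"
      using u v b by (simp add: mult_abs_L2 norm_abs_L2[OF uv])
    also have "\<dots> \<le> (\<integral>z. \<bar>C\<bar>\<^sup>2 * (cmod (v z))\<^sup>2 \<partial>circle)"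
    proof (rule integral_mono_AE)
      show "AE z in circle. (cmod (u z * v z))\<^sup>2 \<le> \<bar>C\<bar>\<^sup>2 * (cmod (v z))\<^sup>2"
        using C by eventually_elim
          (auto simp: norm_mult power_mult_distrib intro!: mult_right_mono power_mono)
    qed (use uv v in \<open>auto simp: sq_integrable_def\<close>)
    also have "\<dots> = (\<bar>C\<bar> * norm f)\<^sup>2"
      using v by (simp add: norm_abs_L2 power_mult_distrib)
    finally show "norm (mult_L2 \<phi> f) \<le> \<bar>C\<bar> * norm f"
      by (rule power2_le_imp_le) simp
  qed
qed

lemma z_L2_eq: "z_L2 = circle_monom 1"
  by (simp add: z_L2_def circle_monom_def)

lemma z_L2_in_Linf: "z_L2 \<in> Linf"
  by (simp add: z_L2_eq circle_monom_def abs_L2_in_Linf sq_integrable_powi ess_bounded_powi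
      del: power_int_1_right)

lemma fourier_mult_z: "fourier (mult_L2 z_L2 f) n = fourier f (n - 1)"
proof -
  obtain v where v: "sq_integrable v" "f = abs_L2 v" by (rule L2_cases)
  have [measurable]: "v \<in> borel_measurable borel"
    using v(1) measurable_cong_sets[OF sets_circle refl] by (auto simp: sq_integrable_def)
  have z: "sq_integrable (\<lambda>z. z)" "ess_bounded (\<lambda>z. z)"
    using sq_integrable_powi[of 1] ess_bounded_powi[of 1] by simp_all
  have "(\<integral>z. z * v z * z powi (- n) \<partial>circle) = (\<integral>z. v z * z powi (- (n - 1)) \<partial>circle)"
  proof (intro integral_cong_AE)
    show "AE z in circle. z * v z * z powi (- n) = v z * z powi (- (n - 1))"
      using AE_circle_norm
    proof eventually_elim
      case (elim z)
      then have "z powi (1 + - n) = z powi 1 * z powi (- n)"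
        by (intro power_int_add) auto
      then show ?case by simp
    qed
  qed auto
  then show ?thesis
    using v z by (simp add: z_L2_def mult_abs_L2 fourier_abs_L2 sq_integrable_mult)
qed

lemma fourier_conj: "fourier (conj_L2 f) n = cnj (fourier f (- n))"
proof -
  obtain v where v: "sq_integrable v" "f = abs_L2 v" by (rule L2_cases)
  have "cnj (fourier f (- n)) = (\<integral>z. cnj (v z * z powi n) \<partial>circle)"
    using v by (simp only: fourier_abs_L2 Bochner_Integration.integral_cnj minus_minus)
  also have "\<dots> = (\<integral>z. cnj (v z) * z powi (- n) \<partial>circle)"
  proof (intro integral_cong_AE)
    show "AE z in circle. cnj (v z * z powi n) = cnj (v z) * z powi (- n)"
      using AE_circle_norm by eventually_elim (simp only: cnj_powi complex_cnj_mult)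
  qed (use v in \<open>auto simp: sq_integrable_def\<close>)
  finally show ?thesis
    using v by (simp add: conj_L2.abs_eq L2_rel_self fourier_abs_L2 sq_integrable_cnj)
qed

lemma integral_circle_cnj:
  fixes g :: "complex \<Rightarrow> 'b::{banach,second_countable_topology}"
  assumes [measurable]: "g \<in> borel_measurable borel"
  shows "(\<integral>z. g (cnj z) \<partial>circle) = (\<integral>z. g z \<partial>circle)"
  by (subst (2) distr_circle_cnj[symmetric]) (simp add: integral_distr)

lemma J_abs_L2: "sq_integrable u \<Longrightarrow> J_L2 (abs_L2 u) = abs_L2 (\<lambda>z. cnj z * u (cnj z))"
  by (simp add: J_L2.abs_eq L2_rel_self)

text \<open>Reflection negates the index, and the factor cnj z contributes the additional
  -1.\<close>

lemma fourier_J: "fourier (J_L2 f) n = fourier f (- n - 1)"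
proof -
  obtain v where v: "sq_integrable v" "f = abs_L2 v" by (rule L2_cases)
  have [measurable]: "v \<in> borel_measurable borel"
    using v(1) measurable_cong_sets[OF sets_circle refl] by (auto simp: sq_integrable_def)
  have "fourier (J_L2 f) n = (\<integral>z. cnj z * v (cnj z) * z powi (- n) \<partial>circle)"
    using v by (simp add: J_abs_L2 fourier_abs_L2 sq_integrable_reflect)
  also have "\<dots> = (\<integral>z. cnj z * v (cnj z) * cnj (cnj z) powi (- n) \<partial>circle)"
    by simp
  also have "\<dots> = (\<integral>z. z * v z * cnj z powi (- n) \<partial>circle)"
    by (rule integral_circle_cnj[where g = "\<lambda>z. z * v z * cnj z powi (- n)"]) measurable
  also have "\<dots> = (\<integral>z. v z * z powi (- (- n - 1)) \<partial>circle)"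
  proof (intro integral_cong_AE)
    show "AE z in circle. z * v z * cnj z powi (- n) = v z * z powi (- (- n - 1))"
      using AE_circle_norm
    proof eventually_elim
      case (elim z)
      then have "z powi (1 + n) = z powi 1 * z powi n"
        by (intro power_int_add) auto
      moreover have "cnj z powi (- n) = z powi n"
        using cnj_powi[OF elim, of "- n"] by simp
      ultimately show ?case by (simp add: add.commute)
    qed
  qed auto
  finally show ?thesis
    using v by (simp add: fourier_abs_L2)
qed

lemma bounded_clinear_J_L2: "bounded_clinear J_L2"
proof (rule bounded_clinearI[where M = 1])
  fix f g :: L2 and c :: complex
  obtain v w where v: "sq_integrable v" "f = abs_L2 v" and w: "sq_integrable w" "g = abs_L2 w"
    by (metis L2_cases)
  show "J_L2 (f + g) = J_L2 f + J_L2 g" "J_L2 (c *\<^sub>C f) = c *\<^sub>C J_L2 f"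
    \<comment> \<open>Linearity is read off from the coefficients, since \<open>fourier_J\<close>
      acts on them by a mere change of index.\<close>
    by (rule fourier_inject; simp add: fourier_J fourier_add fourier_scaleC)+
  have [measurable]: "v \<in> borel_measurable borel"
    using v(1) measurable_cong_sets[OF sets_circle refl] by (auto simp: sq_integrable_def)
  have "(norm (J_L2 f))\<^sup>2 = (\<integral>z. (cmod (cnj z * v (cnj z)))\<^sup>2 \<partial>circle)"
    using v by (simp add: J_abs_L2 norm_abs_L2 sq_integrable_reflect)
  also have "\<dots> = (\<integral>z. (cmod (z * v z))\<^sup>2 \<partial>circle)"
    by (rule integral_circle_cnj[where g = "\<lambda>z. (cmod (z * v z))\<^sup>2"]) measurable
  also have "\<dots> = (\<integral>z. (cmod (v z))\<^sup>2 \<partial>circle)"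
    by (intro integral_cong_AE eventually_mono[OF AE_circle_norm]) (auto simp: norm_mult)
  also have "\<dots> = (norm f)\<^sup>2"
    using v by (simp add: norm_abs_L2)
  finally show "norm (J_L2 f) \<le> 1 * norm f"
    by (simp add: power2_eq_iff_nonneg)
qed


section \<open>The Hardy space\<close>

definition H2_monom :: "nat \<Rightarrow> H2" where
  "H2_monom n = Abs_H2 (circle_monom (int n))"

lemma of_H2_monom: "of_H2 (H2_monom n) = circle_monom (int n)"
  unfolding H2_monom_def by (rule Abs_H2_inverse) (auto simp: fourier_cinner cinner_circle_monom)

lemma cinner_of_H2: "cinner (of_H2 f) (of_H2 g) = cinner f g"
  by (simp add: cinner_H2.rep_eq)

lemma bounded_clinear_of_H2: "bounded_clinear of_H2"
  by (rule bounded_clinearI[where M = 1]) (simp_all add: plus_H2.rep_eq scaleC_H2.rep_eq norm_H2.rep_eq)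

lemma taylor_cinner: "taylor f n = cinner f (H2_monom n)"
  by (simp add: taylor_def fourier_cinner of_H2_monom flip: cinner_of_H2)

lemma cinner_H2_monom: "cinner (H2_monom i) (H2_monom j) = of_bool (i = j)"
  by (simp add: of_H2_monom cinner_circle_monom flip: cinner_of_H2)

lemma taylor_monom [simp]: "taylor (H2_monom i) j = of_bool (i = j)"
  by (simp add: taylor_cinner cinner_H2_monom)

lemma taylor_add: "taylor (f + g) n = taylor f n + taylor g n"
  and taylor_scaleC: "taylor (c *\<^sub>C f) n = c * taylor f n"
  and taylor_zero [simp]: "taylor 0 n = 0"
  by (simp_all add: taylor_cinner cinner_add_left cinner_scaleC_left)

lemma fourier_of_H2: "fourier (of_H2 f) n = (if n < 0 then 0 else taylor f (nat n))"
  using of_H2[of f] by (auto simp: taylor_def)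

lemma taylor_inject: "(\<And>n. taylor f n = taylor g n) \<Longrightarrow> f = g"
  by (subst of_H2_inject[symmetric]) (rule fourier_inject, simp add: fourier_of_H2)

text \<open>Each Fourier coefficient is an inner product and hence continuous, so a limit in L^2 of
  elements of H^2 has no negative coefficients either.\<close>

lemma H2_complete:
  fixes X :: "nat \<Rightarrow> H2"
  assumes "Cauchy X"
  shows "\<exists>f. X \<longlonglongrightarrow> f"
proof -
  have "Cauchy (\<lambda>n. of_H2 (X n))"
    using assms by (simp add: Cauchy_def dist_H2.rep_eq)
  then obtain g where g: "(\<lambda>n. of_H2 (X n)) \<longlonglongrightarrow> g"
    using L2_complete by blast
  have "fourier g k = 0" if "k < 0" for k
    using tendsto_cinner_left[OF g, of "circle_monom k"] that
    by (simp add: fourier_of_H2 LIMSEQ_const_iff flip: fourier_cinner)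
  then have "g = of_H2 (Abs_H2 g)"
    by (simp add: Abs_H2_inverse)
  then have "X \<longlonglongrightarrow> Abs_H2 g"
    using g by (simp add: tendsto_iff dist_H2.rep_eq)
  then show ?thesis by blast
qed

lemma riesz_fischer:
  assumes "summable (\<lambda>n. (cmod (a n))\<^sup>2)"
  obtains f where "(\<lambda>N. \<Sum>n<N. a n *\<^sub>C H2_monom n) \<longlonglongrightarrow> f" "\<And>n. taylor f n = a n"
proof -
  obtain f where f: "(\<lambda>N. \<Sum>n<N. a n *\<^sub>C H2_monom n) \<longlonglongrightarrow> f"
    using H2_complete[OF orthonormal_series_Cauchy[OF cinner_H2_monom assms]] by blast
  moreover have "taylor f n = a n" for n
    using cinner_orthonormal_series[OF cinner_H2_monom f] by (simp add: taylor_cinner)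
  ultimately show ?thesis by (rule that)
qed

lemma taylor_H2_series:
  assumes "summable (\<lambda>n. (cmod (a n))\<^sup>2)"
  shows "taylor (H2_series a) n = a n"
proof -
  obtain f where "\<And>n. taylor f n = a n" using riesz_fischer[OF assms] by blast
  then have "\<forall>n. taylor (H2_series a) n = a n"
    unfolding H2_series_def by (intro theI[of "\<lambda>f. \<forall>n. taylor f n = a n" f]) (auto intro: taylor_inject)
  then show ?thesis by simp
qed

text \<open>Bessel's inequality for a subfamily of the monomials. It is stated for subsequences so
  that it covers the even and the odd coefficients occurring in \<open>U_H2\<close>.\<close>

lemma summable_taylor_subseq:
  assumes "inj k"
  shows "summable (\<lambda>n. (cmod (taylor f (k n)))\<^sup>2)"
proof (rule summableI_nonneg_bounded)
  show "(\<Sum>n<N. (cmod (taylor f (k n)))\<^sup>2) \<le> (norm f)\<^sup>2" for N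
    using bessel_inequality[of "{..<N}" "\<lambda>n. H2_monom (k n)" f] assms
    by (simp add: taylor_cinner cinner_H2_monom inj_eq)
qed simp

text \<open>The series converges by Riesz-Fischer to some function with the coefficients of
  \<open>f\<close>, and coefficients determine the function.\<close>

lemma H2_expansion: "(\<lambda>N. \<Sum>n<N. taylor f n *\<^sub>C H2_monom n) \<longlonglongrightarrow> f"
proof -
  obtain g where g: "(\<lambda>N. \<Sum>n<N. taylor f n *\<^sub>C H2_monom n) \<longlonglongrightarrow> g" "\<And>n. taylor g n = taylor f n"
    using riesz_fischer[OF summable_taylor_subseq[of "\<lambda>n. n" f]] by auto
  then show ?thesis using taylor_inject[of g f] by simp
qed

lemma parseval: "(\<lambda>n. (cmod (taylor f n))\<^sup>2) sums (norm f)\<^sup>2"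
  using tendsto_power[OF tendsto_norm[OF H2_expansion[of f]], of 2]
  by (simp add: sums_def norm_orthonormal_sum[OF _ cinner_H2_monom])

text \<open>The value of the adjoint at \<open>y\<close> must have the Taylor coefficients
  \<open>cnj (c y n)\<close>; the work is in their square-summability. The codomain is left general
  because the lemma also serves the inclusion \<open>of_H2\<close> and the map
  \<open>U_H2\<close>.\<close>

lemma adjoint_exists:
  fixes A :: "H2 \<Rightarrow> 'b::complex_inner"
  assumes A: "bounded_clinear A"
  shows "is_adjoint A (cadjoint A)"
proof -
  obtain M where M: "M \<ge> 0" "\<And>x. norm (A x) \<le> M * norm x"
    using bounded_clinear_bound[OF A] by blast
  define c where "c y n = cinner (A (H2_monom n)) y" for y n
  have sumc: "summable (\<lambda>n. (cmod (cnj (c y n)))\<^sup>2)" for y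
  proof (rule summableI_nonneg_bounded)
    fix N
    \<comment> \<open>The truncation of the expected adjoint value: testing \<open>A\<close> on it
      makes the inner product of \<open>A x\<close> with \<open>y\<close> equal to the squared norm
      of \<open>x\<close>, which bounds the norm of \<open>x\<close> by M |y| uniformly in
      \<open>N\<close>.\<close>
    define x where "x = (\<Sum>n<N. cnj (c y n) *\<^sub>C H2_monom n)"
    define s where "s = (\<Sum>n<N. (cmod (cnj (c y n)))\<^sup>2)"
    have xs: "(norm x)\<^sup>2 = s"
      by (simp add: x_def s_def norm_orthonormal_sum[OF _ cinner_H2_monom])
    have "cinner (A x) y = (\<Sum>n<N. c y n * cnj (c y n))"
      by (simp add: x_def bounded_clinear_sum[OF A] bounded_clinear_scaleC[OF A]
          cinner_sum_left cinner_scaleC_left c_def mult.commute)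
    also have "\<dots> = of_real s"
      by (simp add: s_def complex_norm_square del: of_real_power)
    finally have "s = cmod (cinner (A x) y)"
      using zero_le_power2[of "norm x"] by (simp add: xs)
    also have "\<dots> \<le> M * norm x * norm y"
      using norm_cinner_le[of "A x" y] mult_right_mono[OF M(2)[of x], of "norm y"] by simp
    finally have "norm x * norm x \<le> norm x * (M * norm y)"
      by (simp add: xs[symmetric] power2_eq_square mult_ac)
    then have "norm x \<le> M * norm y"
      using M by (cases "x = 0") auto
    then have "(norm x)\<^sup>2 \<le> (M * norm y)\<^sup>2"
      by (intro power_mono) auto
    then show "(\<Sum>n<N. (cmod (cnj (c y n)))\<^sup>2) \<le> (M * norm y)\<^sup>2"
      by (simp add: xs s_def)
  qed simp
  have "cinner (A x) y = cinner x (H2_series (\<lambda>n. cnj (c y n)))" for x y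
  proof -
    have "(\<lambda>N. A (\<Sum>n<N. taylor x n *\<^sub>C H2_monom n)) \<longlonglongrightarrow> A x"
      using A H2_expansion by (auto simp: bounded_clinear_def intro: bounded_linear.tendsto)
    from tendsto_cinner_left[OF this, of y]
    have "(\<lambda>n. taylor x n * c y n) sums cinner (A x) y"
      by (simp add: sums_def bounded_clinear_sum[OF A] bounded_clinear_scaleC[OF A]
          cinner_sum_left cinner_scaleC_left c_def)
    moreover have "cinner (H2_monom n) (H2_series (\<lambda>n. cnj (c y n))) = c y n" for n
      using taylor_H2_series[OF sumc, of y n]
      by (metis cinner_commute complex_cnj_cnj taylor_cinner)
    then have "(\<lambda>n. taylor x n * c y n) sums cinner x (H2_series (\<lambda>n. cnj (c y n)))"
      using tendsto_cinner_left[OF H2_expansion[of x], of "H2_series (\<lambda>n. cnj (c y n))"]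
      by (simp add: sums_def cinner_sum_left cinner_scaleC_left)
    ultimately show ?thesis by (rule sums_unique2)
  qed
  then have "is_adjoint A (\<lambda>y. H2_series (\<lambda>n. cnj (c y n)))"
    by (simp add: is_adjoint_def)
  then show ?thesis using cadjoint_eqI by metis
qed

lemma cinner_cadjoint:
  "bounded_clinear (A :: H2 \<Rightarrow> 'b::complex_inner) \<Longrightarrow> cinner (cadjoint A y) x = cinner y (A x)"
  using is_adjoint_sym[OF adjoint_exists[of A]] by (simp add: is_adjoint_def)

lemma bounded_clinear_cadjoint:
  "bounded_clinear (A :: H2 \<Rightarrow> 'b::complex_inner) \<Longrightarrow> bounded_clinear (cadjoint A)"
  using is_adjoint_imp_bounded_clinear adjoint_exists by blast

lemma taylor_cadjoint:
  "bounded_clinear (A :: H2 \<Rightarrow> 'b::complex_inner) \<Longrightarrow>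
    taylor (cadjoint A y) n = cinner y (A (H2_monom n))"
  by (simp add: taylor_cinner cinner_cadjoint)

text \<open>The residual is orthogonal to the subspace exactly when \<open>h\<close> is the image of
  \<open>f\<close> under the adjoint of the inclusion. Existence, linearity and boundedness of the
  projection all come from this.\<close>

lemma P_H2_eq: "P_H2 = cadjoint of_H2"
proof (rule ext)
  fix f
  have "(\<forall>k. cinner (f - of_H2 h) (of_H2 k) = 0) \<longleftrightarrow> h = cadjoint of_H2 f" for h
  proof -
    have eq: "cinner (f - of_H2 h) (of_H2 k) = cinner (cadjoint of_H2 f - h) k" for k
      by (simp add: cinner_diff_left cinner_cadjoint[OF bounded_clinear_of_H2] cinner_of_H2)
    show ?thesis
    proof
      assume "\<forall>k. cinner (f - of_H2 h) (of_H2 k) = 0"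
      then have "cinner (cadjoint of_H2 f - h) (cadjoint of_H2 f - h) = 0"
        by (simp add: eq)
      then show "h = cadjoint of_H2 f" by (simp add: cinner_self)
    next
      assume h: "h = cadjoint of_H2 f"
      show "\<forall>k. cinner (f - of_H2 h) (of_H2 k) = 0" unfolding eq by (simp add: h)
    qed
  qed
  then show "P_H2 f = cadjoint of_H2 f"
    by (simp add: P_H2_def)
qed

lemma taylor_P: "taylor (P_H2 f) n = fourier f (int n)"
  by (simp add: P_H2_eq taylor_cadjoint bounded_clinear_of_H2 of_H2_monom fourier_cinner)

lemma bounded_clinear_P: "bounded_clinear P_H2"
  by (simp add: P_H2_eq bounded_clinear_cadjoint bounded_clinear_of_H2)

lemma bounded_clinear_toeplitz: "\<phi> \<in> Linf \<Longrightarrow> bounded_clinear (toeplitz \<phi>)"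
  using bounded_clinear_comp[OF bounded_clinear_P bounded_clinear_comp[OF bounded_clinear_mult_L2 bounded_clinear_of_H2]]
  by (simp add: toeplitz_def[abs_def] o_def)

lemma taylor_toeplitz:
  "\<phi> \<in> Linf \<Longrightarrow> taylor (toeplitz \<phi> (H2_monom j)) i = fourier \<phi> (int i - int j)"
  by (simp add: toeplitz_def taylor_P of_H2_monom mult_circle_monom)

lemma bounded_clinear_hankel: "\<phi> \<in> Linf \<Longrightarrow> bounded_clinear (hankel \<phi>)"
  using bounded_clinear_comp[OF bounded_clinear_P bounded_clinear_comp[OF bounded_clinear_J_L2
      bounded_clinear_comp[OF bounded_clinear_mult_L2 bounded_clinear_of_H2]]]
  by (simp add: hankel_def[abs_def] o_def)

text \<open>Only coefficients of \<open>\<phi>\<close> with negative index enter; the remaining ones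
  are free, which is what makes the choice of a bounded symbol possible.\<close>

lemma taylor_hankel:
  "\<phi> \<in> Linf \<Longrightarrow> taylor (hankel \<phi> (H2_monom j)) i = fourier \<phi> (- int i - int j - 1)"
  by (simp add: hankel_def taylor_P of_H2_monom fourier_J mult_circle_monom algebra_simps)

lemma bounded_clinear_S: "bounded_clinear S_H2"
  by (simp add: S_H2_def bounded_clinear_toeplitz z_L2_in_Linf)

lemma taylor_S: "taylor (S_H2 f) n = (if n = 0 then 0 else taylor f (n - 1))"
  by (auto simp: S_H2_def toeplitz_def taylor_P fourier_mult_z fourier_of_H2 nat_diff_distrib)

lemma S_monom: "S_H2 (H2_monom n) = H2_monom (Suc n)"
  by (rule taylor_inject) (auto simp: taylor_S)

lemma taylor_cadjoint_S: "taylor (cadjoint S_H2 f) n = taylor f (Suc n)"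
  unfolding taylor_cadjoint[OF bounded_clinear_S] S_monom by (simp add: taylor_cinner)

lemma taylor_U:
  "taylor (fst (U_H2 f)) n = taylor f (2 * n)" "taylor (snd (U_H2 f)) n = taylor f (2 * n + 1)"
  using summable_taylor_subseq[of "\<lambda>n. 2 * n" f] summable_taylor_subseq[of "\<lambda>n. 2 * n + 1" f]
  by (auto simp: U_H2_def inj_def intro!: taylor_H2_series)

lemma U_monom: "U_H2 (H2_monom (2 * n)) = (H2_monom n, 0)" "U_H2 (H2_monom (2 * n + 1)) = (0, H2_monom n)"
  by (auto simp: prod_eq_iff taylor_U intro!: taylor_inject) presburger+

lemma bounded_clinear_U: "bounded_clinear U_H2"
proof (rule bounded_clinearI[where M = 2])
  fix f g :: H2 and c :: complex
  show "U_H2 (f + g) = U_H2 f + U_H2 g" "U_H2 (c *\<^sub>C f) = c *\<^sub>C U_H2 f"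
    by (auto simp: prod_eq_iff taylor_U taylor_add taylor_scaleC scaleC_prod_def intro!: taylor_inject)
  \<comment> \<open>Each component of \<open>U_H2 f\<close> has a subsequence of the coefficients of
    \<open>f\<close>, so Bessel's inequality and Parseval's identity bound its norm. Adding the two
    bounds gives the factor 2; only boundedness matters here.\<close>
  have le: "norm h \<le> norm f" if "inj k" "\<And>n. taylor h n = taylor f (k n)" for h k
  proof -
    have "(\<Sum>n<N. (cmod (taylor h n))\<^sup>2) \<le> (norm f)\<^sup>2" for N
      using bessel_inequality[of "{..<N}" "\<lambda>n. H2_monom (k n)" f] that
      by (simp add: taylor_cinner[symmetric] cinner_H2_monom inj_eq)
    then have "(norm h)\<^sup>2 \<le> (norm f)\<^sup>2"
      using parseval[of h] by (intro LIMSEQ_le_const2[of "\<lambda>N. \<Sum>n<N. (cmod (taylor h n))\<^sup>2"]) (auto simp: sums_def)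
    then show ?thesis by (rule power2_le_imp_le) simp
  qed
  have "norm (U_H2 f) \<le> norm (fst (U_H2 f)) + norm (snd (U_H2 f))"
    by (metis norm_Pair_le prod.collapse)
  also have "\<dots> \<le> norm f + norm f"
    by (intro add_mono le[of "\<lambda>n. 2 * n"] le[of "\<lambda>n. 2 * n + 1"] taylor_U) (auto simp: inj_def)
  finally show "norm (U_H2 f) \<le> 2 * norm f" by simp
qed

lemma taylor_cadjoint_U:
  "taylor (cadjoint U_H2 x) (2 * n) = taylor (fst x) n"
  "taylor (cadjoint U_H2 x) (2 * n + 1) = taylor (snd x) n"
  unfolding taylor_cadjoint[OF bounded_clinear_U] U_monom
  by (simp_all add: cinner_prod_def taylor_cinner)

text \<open>The entries in row \<open>i\<close> determine the adjoint at the \<open>i\<close>-th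
  monomial, and the \<open>i\<close>-th coefficient of \<open>A f\<close> is the inner product of
  \<open>f\<close> with that vector. Passing through adjoints takes the place of a density
  argument.\<close>

lemma operator_eqI:
  fixes A B :: "H2 \<Rightarrow> H2"
  assumes A: "bounded_clinear A" and B: "bounded_clinear B"
    and eq: "\<And>i j. taylor (A (H2_monom j)) i = taylor (B (H2_monom j)) i"
  shows "A = B"
proof (intro ext taylor_inject)
  fix f i
  have "cadjoint A (H2_monom i) = cadjoint B (H2_monom i)"
  proof (rule taylor_inject)
    fix j
    show "taylor (cadjoint A (H2_monom i)) j = taylor (cadjoint B (H2_monom i)) j"
      unfolding taylor_cadjoint[OF A] taylor_cadjoint[OF B]
      using eq[of j i] by (metis cinner_commute taylor_cinner)
  qed
  then have "cinner f (cadjoint A (H2_monom i)) = cinner f (cadjoint B (H2_monom i))" by simp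
  then show "taylor (A f) i = taylor (B f) i"
    using adjoint_exists[OF A] adjoint_exists[OF B] by (simp add: is_adjoint_def taylor_cinner)
qed


section \<open>Bounded Toeplitz and Hankel matrices\<close>

lemma taylor_cadjoint_monom:
  "bounded_clinear (A :: H2 \<Rightarrow> H2) \<Longrightarrow>
    taylor (cadjoint A (H2_monom j)) i = cnj (taylor (A (H2_monom i)) j)"
  by (metis taylor_cadjoint taylor_cinner cinner_commute)

text \<open>The form is the inner product of \<open>A x\<close> with \<open>y\<close> for the
  polynomials with coefficients \<open>a\<close> and \<open>b\<close>. A second vector is allowed
  because Hankel matrices are tested with \<open>b\<close> the reversal of \<open>a\<close>,
  Toeplitz matrices with \<open>b = a\<close>.\<close>

lemma matrix_form_bound:
  fixes A :: "H2 \<Rightarrow> H2"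
  assumes A: "bounded_clinear A" and M: "\<And>x. norm (A x) \<le> M * norm x" and "0 \<le> M"
    and ab: "(\<Sum>i\<le>N. (cmod (b i))\<^sup>2) = (\<Sum>i\<le>N. (cmod (a i))\<^sup>2)"
  shows "cmod (\<Sum>i\<le>N. \<Sum>j\<le>N. taylor (A (H2_monom j)) i * a j * cnj (b i)) \<le> M * (\<Sum>i\<le>N. (cmod (a i))\<^sup>2)"
proof -
  define x where "x = (\<Sum>j\<le>N. a j *\<^sub>C H2_monom j)"
  define y where "y = (\<Sum>i\<le>N. b i *\<^sub>C H2_monom i)"
  have x: "(norm x)\<^sup>2 = (\<Sum>i\<le>N. (cmod (a i))\<^sup>2)" and y: "(norm y)\<^sup>2 = (\<Sum>i\<le>N. (cmod (a i))\<^sup>2)"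
    by (simp_all add: x_def y_def ab norm_orthonormal_sum[OF _ cinner_H2_monom])
  then have yx: "norm y = norm x" by (simp flip: power2_eq_iff_nonneg)
  have "cinner (A x) y = (\<Sum>i\<le>N. \<Sum>j\<le>N. taylor (A (H2_monom j)) i * a j * cnj (b i))"
    by (simp add: x_def y_def bounded_clinear_sum[OF A] bounded_clinear_scaleC[OF A] cinner_sum_left
        cinner_sum_right cinner_scaleC_left cinner_scaleC_right taylor_cinner sum_distrib_left mult_ac)
  then have "cmod (\<Sum>i\<le>N. \<Sum>j\<le>N. taylor (A (H2_monom j)) i * a j * cnj (b i)) \<le> norm (A x) * norm y"
    using norm_cinner_le[of "A x" y] by simp
  also have "\<dots> \<le> (M * norm x) * norm x"
    unfolding yx by (intro mult_right_mono M) auto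
  finally show ?thesis
    unfolding x[symmetric] by (simp add: power2_eq_square mult.assoc)
qed

text \<open>A column consists of coefficients of the image of a unit vector; Bessel's inequality
  applies.\<close>

lemma matrix_column_bound:
  fixes A :: "H2 \<Rightarrow> H2"
  assumes M: "\<And>x. norm (A x) \<le> M * norm x" and "0 \<le> M"
  shows "(\<Sum>i\<le>N. (cmod (taylor (A (H2_monom j)) i))\<^sup>2) \<le> M\<^sup>2"
proof -
  have "complex_of_real ((norm (H2_monom j))\<^sup>2) = of_real 1"
    unfolding cinner_self[symmetric] by (simp add: cinner_H2_monom)
  then have "(norm (H2_monom j))\<^sup>2 = 1" by (simp only: of_real_eq_iff)
  then have "norm (H2_monom j) = 1"
    by (metis norm_ge_zero power2_eq_1_iff neg_0_le_iff_le not_one_le_zero)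
  have "(\<Sum>i\<le>N. (cmod (taylor (A (H2_monom j)) i))\<^sup>2) \<le> (norm (A (H2_monom j)))\<^sup>2"
    using bessel_inequality[of "{..N}" H2_monom] by (simp add: taylor_cinner cinner_H2_monom)
  also have "\<dots> \<le> M\<^sup>2"
    using M[of "H2_monom j"] \<open>norm (H2_monom j) = 1\<close> by (intro power_mono) auto
  finally show ?thesis .
qed

text \<open>Constant diagonals give a two-sided sequence of candidate Fourier coefficients, and the
  bound of \<open>A\<close> is precisely the bound on their Toeplitz form.\<close>

lemma brown_halmos:
  fixes A :: "H2 \<Rightarrow> H2"
  assumes A: "bounded_clinear A"
    and shift: "\<And>i j. taylor (A (H2_monom (Suc j))) (Suc i) = taylor (A (H2_monom j)) i"
  shows "\<exists>\<phi>\<in>Linf. A = toeplitz \<phi>"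
proof -
  obtain M where M: "M \<ge> 0" "\<And>x. norm (A x) \<le> M * norm x"
    using bounded_clinear_bound[OF A] by blast
  \<comment> \<open>\<open>nat\<close> truncates negative numbers to 0, so this reads the first
    column for k >= 0 and the first row for k < 0.\<close>
  define t where "t k = taylor (A (H2_monom (nat (- k)))) (nat k)" for k
  have shifts: "taylor (A (H2_monom (j + k))) (i + k) = taylor (A (H2_monom j)) i" for i j k
    by (induction k) (simp_all add: shift)
  have t: "taylor (A (H2_monom j)) i = t (int i - int j)" for i j
  proof (cases "j \<le> i")
    case True
    then show ?thesis using shifts[of 0 j "i - j"] by (simp add: t_def nat_diff_distrib)
  next
    case False
    then show ?thesis using shifts[of "j - i" i 0] by (simp add: t_def nat_diff_distrib)
  qed
  have "\<exists>\<phi>\<in>Linf. \<forall>k. fourier \<phi> k = t k"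
  proof (rule Linf_of_bounded_form)
    show "cmod (\<Sum>i\<le>N. \<Sum>j\<le>N. t (int i - int j) * a j * cnj (a i)) \<le> M * (\<Sum>i\<le>N. (cmod (a i))\<^sup>2)" for N a
      using matrix_form_bound[OF A M(2,1), where N = N and a = a and b = a] by (simp add: t)
    show "(\<Sum>k\<in>{- int N..int N}. (cmod (t k))\<^sup>2) \<le> M\<^sup>2" for N
    proof -
      \<comment> \<open>Rows 0 to 2N of column \<open>N\<close> contain all \<open>t k\<close> with
        \<open>k\<close> between -N and N, so a single column bound controls the sum.\<close>
      have "(\<Sum>k\<in>{- int N..int N}. (cmod (t k))\<^sup>2) = (\<Sum>i\<le>2 * N. (cmod (t (int i - int N)))\<^sup>2)"
        by (rule sum.reindex_bij_witness[of _ "\<lambda>i. int i - int N" "\<lambda>k. nat (k + int N)"]) auto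
      then show ?thesis
        using matrix_column_bound[of A M N "2 * N", OF M(2,1)] by (simp add: t)
    qed
  qed
  then obtain \<phi> where \<phi>: "\<phi> \<in> Linf" "\<And>k. fourier \<phi> k = t k" by blast
  then have "A = toeplitz \<phi>"
    by (intro operator_eqI A bounded_clinear_toeplitz) (simp_all add: taylor_toeplitz t)
  with \<phi>(1) show ?thesis by blast
qed

section \<open>Parrott's theorem and the one-step extension of Hankel matrices\<close>

text \<open>\<open>Q\<close> is a quadratic function with homogeneous part \<open>q\<close>. Along a minimizing sequence of \<open>Q\<close>
  the functional \<open>r\<close> converges, and \<open>x\<close> is the negative of its limit.\<close>

lemma quadratic_completion:
  fixes Q q :: "'a::real_vector \<Rightarrow> real" and r :: "'a \<Rightarrow> complex"
  assumes nonneg: "\<And>u. 0 \<le> Q u"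
    and quad: "\<And>t u v. Q ((1 - t) *\<^sub>R u + t *\<^sub>R v) = (1 - t) * Q u + t * Q v - t * (1 - t) * q (u - v)"
    and r_diff: "\<And>u v. r (u - v) = r u - r v"
    and r_le: "\<And>u. (cmod (r u))\<^sup>2 \<le> q u"
  shows "\<exists>x. \<forall>u. (cmod (x + r u))\<^sup>2 \<le> Q u"
proof -
  define m where "m = (INF u. Q u)"
  have bdd: "bdd_below (range Q)" using nonneg by (auto intro!: bdd_belowI)
  have m_le: "m \<le> Q u" for u unfolding m_def by (intro cINF_lower bdd) auto
  have m_nonneg: "0 \<le> m" unfolding m_def by (intro cINF_greatest nonneg) auto
  have "\<exists>u. Q u < m + 1 / real (Suc k)" for k
    using cINF_less_iff[OF _ bdd, of "m + 1 / real (Suc k)"] by (auto simp: m_def)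
  then obtain u where u: "\<And>k. Q (u k) < m + 1 / real (Suc k)" by metis
  have Qu: "(\<lambda>k. Q (u k) - m) \<longlonglongrightarrow> 0"
    by (rule Lim_null_comparison[OF _ LIMSEQ_inverse_real_of_nat])
      (use u m_le in \<open>auto intro!: always_eventually simp: divide_inverse abs_le_iff less_imp_le algebra_simps\<close>)
  \<comment> \<open>The strict convexity expressed by \<open>quad\<close>, together with Q >= m at
    the intermediate point, bounds the distance of two values of \<open>r\<close> by how far
    \<open>Q\<close> exceeds its infimum.\<close>
  have key: "t * (1 - t) * (cmod (r v - r w))\<^sup>2 \<le> (1 - t) * (Q v - m) + t * (Q w - m)"
    if "0 \<le> t" "t \<le> 1" for t v w
  proof -
    have "t * (1 - t) * (cmod (r v - r w))\<^sup>2 \<le> t * (1 - t) * q (v - w)"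
      using r_le[of "v - w"] that by (intro mult_left_mono) (auto simp: r_diff)
    also have "\<dots> = (1 - t) * Q v + t * Q w - Q ((1 - t) *\<^sub>R v + t *\<^sub>R w)"
      by (simp add: quad)
    also have "\<dots> \<le> (1 - t) * Q v + t * Q w - m"
      using m_le by simp
    finally show ?thesis by (simp add: algebra_simps)
  qed
  have "Cauchy (\<lambda>k. r (u k))"
  proof (rule metric_CauchyI)
    fix e :: real assume e: "0 < e"
    have "eventually (\<lambda>k. Q (u k) - m < e\<^sup>2 / 4) sequentially"
      using order_tendstoD(2)[OF Qu, of "e\<^sup>2 / 4"] e by simp
    then obtain K where K: "\<And>k. k \<ge> K \<Longrightarrow> Q (u k) - m < e\<^sup>2 / 4"
      by (auto simp: eventually_sequentially)
    have "dist (r (u k)) (r (u l)) < e" if "k \<ge> K" "l \<ge> K" for k l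
    proof -
      \<comment> \<open>The midpoint t = 1/2 turns \<open>key\<close> into a Cauchy estimate: a
        quarter of the squared distance is below e^2/4.\<close>
      have half_le: "(0::real) \<le> 1 / 2" "(1::real) / 2 \<le> 1" by simp_all
      have "(cmod (r (u k) - r (u l)))\<^sup>2 < e\<^sup>2"
        using key[of "1/2" "u k" "u l", OF half_le] K[OF that(1)] K[OF that(2)] by argo
      then show ?thesis
        using e unfolding dist_norm by (intro power_less_imp_less_base[of _ 2 e]) auto
    qed
    then show "\<exists>M. \<forall>m\<ge>M. \<forall>n\<ge>M. dist (r (u m)) (r (u n)) < e" by blast
  qed
  then obtain y where y: "(\<lambda>k. r (u k)) \<longlonglongrightarrow> y"
    by (auto simp: Cauchy_convergent_iff convergent_def)
  have "(cmod (- y + r w))\<^sup>2 \<le> Q w" for w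
  proof -
    \<comment> \<open>One point runs through the minimizing sequence, which removes its term from
      \<open>key\<close>; what is left is divided by \<open>t\<close>. Letting \<open>t\<close> tend
      to 0 afterwards removes the factor 1 - t.\<close>
    have le: "(1 - t) * (cmod (y - r w))\<^sup>2 \<le> Q w - m" if t: "0 < t" "t \<le> 1" for t
    proof -
      have "t * (1 - t) * (cmod (y - r w))\<^sup>2 \<le> (1 - t) * 0 + t * (Q w - m)"
      proof (rule LIMSEQ_le)
        show "(\<lambda>k. t * (1 - t) * (cmod (r (u k) - r w))\<^sup>2) \<longlonglongrightarrow> t * (1 - t) * (cmod (y - r w))\<^sup>2"
          by (intro tendsto_intros y)
        show "(\<lambda>k. (1 - t) * (Q (u k) - m) + t * (Q w - m)) \<longlonglongrightarrow> (1 - t) * 0 + t * (Q w - m)"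
          by (intro tendsto_intros Qu)
      qed (use key t in auto)
      then show ?thesis using t by (simp add: mult.assoc)
    qed
    have "((\<lambda>t::real. (1 - t) * (cmod (y - r w))\<^sup>2) \<longlongrightarrow> (1 - 0) * (cmod (y - r w))\<^sup>2) (at_right 0)"
      by (intro tendsto_intros)
    moreover have "eventually (\<lambda>t::real. (1 - t) * (cmod (y - r w))\<^sup>2 \<le> Q w - m) (at_right 0)"
      using eventually_at_right_less[of 0] eventually_at_right[of 0 "1::real"]
      by (auto simp: eventually_at_right_field intro!: exI[of _ 1] le)
    ultimately have "(1 - 0) * (cmod (y - r w))\<^sup>2 \<le> Q w - m"
      by (rule tendsto_upperbound) simp
    then show ?thesis
      using m_nonneg by (simp add: norm_minus_commute)
  qed
  then show ?thesis by blast
qed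

lemma norm_convex_combination:
  fixes a b :: "'a::real_inner"
  shows "(norm ((1 - t) *\<^sub>R a + t *\<^sub>R b))\<^sup>2 = (1 - t) * (norm a)\<^sup>2 + t * (norm b)\<^sup>2 - t * (1 - t) * (norm (a - b))\<^sup>2"
  by (simp add: power2_norm_eq_inner inner_add_left inner_add_right inner_diff_left inner_diff_right
      inner_commute[of b a] algebra_simps)

lemma shift_decomposition: "u = taylor u 0 *\<^sub>C H2_monom 0 + S_H2 (cadjoint S_H2 u)"
  by (rule taylor_inject) (auto simp: taylor_add taylor_scaleC taylor_S taylor_cadjoint_S)

text \<open>\<open>S_H2\<close> is isometric and its range is orthogonal to the constants.\<close>

lemma norm_shift_add: "(norm (c *\<^sub>C H2_monom 0 + S_H2 v))\<^sup>2 = (cmod c)\<^sup>2 + (norm v)\<^sup>2"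
proof -
  have "cadjoint S_H2 (S_H2 v) = v"
    by (rule taylor_inject) (simp add: taylor_S taylor_cadjoint_S)
  then have "complex_of_real ((norm (S_H2 v))\<^sup>2) = of_real ((norm v)\<^sup>2)"
    using cinner_cadjoint[OF bounded_clinear_S, of "S_H2 v" v] by (simp only: cinner_self[symmetric])
  then have S: "(norm (S_H2 v))\<^sup>2 = (norm v)\<^sup>2"
    by (simp only: of_real_eq_iff)
  have "cinner (S_H2 v) (H2_monom 0) = 0"
    by (simp add: taylor_S flip: taylor_cinner)
  then have "cinner (H2_monom 0) (S_H2 v) = 0"
    by (metis cinner_commute complex_cnj_zero)
  then have "(norm (c *\<^sub>C H2_monom 0 + S_H2 v))\<^sup>2 = (norm (c *\<^sub>C H2_monom 0))\<^sup>2 + (norm (S_H2 v))\<^sup>2"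
    by (intro norm_add_orthogonal) (simp add: cinner_scaleC_left)
  moreover have "(norm (c *\<^sub>C H2_monom 0))\<^sup>2 = (cmod c)\<^sup>2"
    using norm_orthonormal_sum[of "{0::nat}" H2_monom "\<lambda>_. c"] by (simp add: cinner_H2_monom)
  ultimately show ?thesis by (simp add: S)
qed

text \<open>A contraction up to the scale \<open>M\<close>; keeping \<open>M\<close> in the
  predicate lets the same bound pass unchanged through all extensions.\<close>

definition hankel_contraction :: "real \<Rightarrow> (H2 \<Rightarrow> H2) \<Rightarrow> bool" where
  "hankel_contraction M G \<longleftrightarrow> bounded_clinear G \<and> (\<forall>x. norm (G x) \<le> M * norm x) \<and>
    (\<forall>i j. taylor (G (H2_monom j)) (Suc i) = taylor (G (H2_monom (Suc j))) i)"

text \<open>A new row is placed on top of \<open>G\<close>. The Hankel condition forces it to be the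
  first row of \<open>G\<close> moved one step to the right, except for the corner entry. Deleting
  either the new row or column 0 of the enlarged matrix leaves \<open>G\<close>, so both parts obey
  the bound, and \<open>quadratic_completion\<close> finds a corner for which the whole matrix
  does.\<close>

lemma hankel_extension:
  assumes "0 \<le> M" and G: "hankel_contraction M G"
  shows "\<exists>G'. hankel_contraction M G' \<and>
    (\<forall>i j. taylor (G' (H2_monom j)) (Suc i) = taylor (G (H2_monom j)) i)"
proof -
  let ?B = "cadjoint S_H2"
  have bG: "bounded_clinear G" and nG: "\<And>x. norm (G x) \<le> M * norm x"
    and hG: "\<And>i j. taylor (G (H2_monom j)) (Suc i) = taylor (G (H2_monom (Suc j))) i"
    using G by (auto simp: hankel_contraction_def)
  have bB: "bounded_clinear ?B" by (rule bounded_clinear_cadjoint[OF bounded_clinear_S])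
  have lin: "linear G" "linear S_H2"
    using bG bounded_clinear_S by (auto simp: bounded_clinear_def bounded_linear.linear)
  have "G \<circ> S_H2 = ?B \<circ> G"
    by (rule operator_eqI)
      (simp_all add: bounded_clinear_comp bG bB bounded_clinear_S S_monom taylor_cadjoint_S hG)
  then have GS: "G (S_H2 w) = ?B (G w)" for w by (metis comp_apply)
  define r where "r w = taylor (G w) 0" for w
  \<comment> \<open>\<open>q w\<close> and \<open>Q w\<close> measure the room that the bound leaves
    for the new coordinate at the vectors \<open>S_H2 w\<close> and
    \<open>H2_monom 0 + S_H2 w\<close>.\<close>
  define q where "q w = M\<^sup>2 * (norm w)\<^sup>2 - (norm (G (S_H2 w)))\<^sup>2" for w
  define Q where "Q w = M\<^sup>2 * (1 + (norm w)\<^sup>2) - (norm (G (H2_monom 0 + S_H2 w)))\<^sup>2" for w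
  have nG2: "(norm (G x))\<^sup>2 \<le> M\<^sup>2 * (norm x)\<^sup>2" for x
    using power_mono[OF nG[of x], of 2] by (simp add: power_mult_distrib)
  \<comment> \<open>By \<open>GS\<close>, the vector \<open>G (S_H2 w)\<close> is \<open>G w\<close>
    with its first coefficient removed, so the claim is the bound for \<open>G w\<close> after
    splitting off that coefficient.\<close>
  have r_le: "(cmod (r w))\<^sup>2 \<le> q w" for w
  proof -
    have "(norm (G w))\<^sup>2 = (cmod (r w))\<^sup>2 + (norm (?B (G w)))\<^sup>2"
      using norm_shift_add[of "taylor (G w) 0" "?B (G w)"] by (simp add: r_def flip: shift_decomposition)
    then show ?thesis
      using nG2[of w] by (simp add: q_def GS)
  qed
  have "\<exists>x. \<forall>w. (cmod (x + r w))\<^sup>2 \<le> Q w"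
  proof (rule quadratic_completion[where q = q])
    show "0 \<le> Q w" for w
      using nG2[of "H2_monom 0 + S_H2 w"] norm_shift_add[of 1 w] by (simp add: Q_def)
    show "r (u - v) = r u - r v" for u v
      by (simp add: r_def bounded_clinear_diff[OF bG] taylor_cinner cinner_diff_left)
    show "(cmod (r w))\<^sup>2 \<le> q w" for w by (rule r_le)
    fix t :: real and u v
    \<comment> \<open>The map taking \<open>w\<close> to \<open>G (H2_monom 0 + S_H2 w)\<close> is
      affine, and differences of its values are values of \<open>G\<close> on the range of the
      shift. This makes \<open>q\<close> the homogeneous part of \<open>Q\<close>.\<close>
    have "H2_monom 0 + S_H2 ((1 - t) *\<^sub>R u + t *\<^sub>R v)
        = (1 - t) *\<^sub>R (H2_monom 0 + S_H2 u) + t *\<^sub>R (H2_monom 0 + S_H2 v)"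
      unfolding linear_add[OF lin(2)] linear_scale[OF lin(2)] by (simp add: algebra_simps)
    then have "G (H2_monom 0 + S_H2 ((1 - t) *\<^sub>R u + t *\<^sub>R v))
        = (1 - t) *\<^sub>R G (H2_monom 0 + S_H2 u) + t *\<^sub>R G (H2_monom 0 + S_H2 v)"
      by (simp only: linear_add[OF lin(1)] linear_scale[OF lin(1)])
    moreover have "G (H2_monom 0 + S_H2 u) - G (H2_monom 0 + S_H2 v) = G (S_H2 (u - v))"
      using lin by (simp add: linear_add linear_diff)
    ultimately show "Q ((1 - t) *\<^sub>R u + t *\<^sub>R v) = (1 - t) * Q u + t * Q v - t * (1 - t) * q (u - v)"
      unfolding Q_def q_def by (simp add: norm_convex_combination) (simp add: algebra_simps)
  qed
  then obtain x where x: "\<And>w. (cmod (x + r w))\<^sup>2 \<le> Q w" by blast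
  \<comment> \<open>The coefficient at 0 is the new row: the corner \<open>x\<close> in column 0,
    followed by the first row of \<open>G\<close>.\<close>
  define G' where "G' u = (x * taylor u 0 + taylor (G (?B u)) 0) *\<^sub>C H2_monom 0 + S_H2 (G u)" for u
  \<comment> \<open>By homogeneity two cases remain: a = 0, which is \<open>r_le\<close>, and a = 1,
    which is the choice of \<open>x\<close>.\<close>
  have bound: "(cmod (x * a + r w))\<^sup>2 + (norm (G (a *\<^sub>C H2_monom 0 + S_H2 w)))\<^sup>2
      \<le> M\<^sup>2 * ((cmod a)\<^sup>2 + (norm w)\<^sup>2)" for a w
  proof (cases "a = 0")
    case True
    then show ?thesis using r_le[of w] by (simp add: q_def)
  next
    case False
    define v where "v = inverse a *\<^sub>C w"
    have w: "w = a *\<^sub>C v" using False by (simp add: v_def scaleC_scaleC)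
    have "r w = a * r v"
      by (simp add: w r_def bounded_clinear_scaleC[OF bG] taylor_scaleC)
    then have 1: "(cmod (x * a + r w))\<^sup>2 = (cmod a)\<^sup>2 * (cmod (x + r v))\<^sup>2"
      by (simp add: norm_mult power_mult_distrib flip: distrib_left mult.commute[of a x])
    have "G (a *\<^sub>C H2_monom 0 + S_H2 w) = a *\<^sub>C G (H2_monom 0 + S_H2 v)"
      by (simp add: w bounded_clinear_scaleC[OF bounded_clinear_S] scaleC_add_right
          flip: bounded_clinear_scaleC[OF bG])
    then have 2: "(norm (G (a *\<^sub>C H2_monom 0 + S_H2 w)))\<^sup>2 = (cmod a)\<^sup>2 * (norm (G (H2_monom 0 + S_H2 v)))\<^sup>2"
      by (simp add: norm_scaleC power_mult_distrib)
    have "(cmod a)\<^sup>2 * ((cmod (x + r v))\<^sup>2 + (norm (G (H2_monom 0 + S_H2 v)))\<^sup>2) \<le> (cmod a)\<^sup>2 * (M\<^sup>2 * (1 + (norm v)\<^sup>2))"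
      using x[of v] by (intro mult_left_mono) (auto simp: Q_def)
    then show ?thesis
      unfolding 1 2 by (simp add: w norm_scaleC power_mult_distrib algebra_simps)
  qed
  have norm_G': "norm (G' u) \<le> M * norm u" for u
  proof -
    have "(norm (G' u))\<^sup>2 = (cmod (x * taylor u 0 + r (?B u)))\<^sup>2 + (norm (G u))\<^sup>2"
      unfolding G'_def norm_shift_add r_def ..
    also have "G u = G (taylor u 0 *\<^sub>C H2_monom 0 + S_H2 (?B u))"
      using shift_decomposition[of u] by simp
    also have "(cmod (x * taylor u 0 + r (?B u)))\<^sup>2 + (norm \<dots>)\<^sup>2 \<le> M\<^sup>2 * ((cmod (taylor u 0))\<^sup>2 + (norm (?B u))\<^sup>2)"
      by (rule bound)
    also have "\<dots> = (M * norm u)\<^sup>2"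
      using norm_shift_add[of "taylor u 0" "?B u"] by (simp add: power_mult_distrib flip: shift_decomposition)
    finally show ?thesis
      by (rule power2_le_imp_le) (simp add: \<open>0 \<le> M\<close>)
  qed
  have B_monom: "?B (H2_monom (Suc j)) = H2_monom j" for j
    by (rule taylor_inject) (simp add: taylor_cadjoint_S)
  have ext: "taylor (G' (H2_monom j)) (Suc i) = taylor (G (H2_monom j)) i" for i j
    by (simp add: G'_def taylor_add taylor_scaleC taylor_S)
  have "taylor (G' (H2_monom j)) (Suc i) = taylor (G' (H2_monom (Suc j))) i" for i j
    by (cases i) (simp_all add: ext hG, simp add: G'_def taylor_add taylor_scaleC taylor_S B_monom)
  moreover have "bounded_clinear G'"
  proof (rule bounded_clinearI[OF _ _ norm_G'])
    show "G' (u + v) = G' u + G' v" for u v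
      by (rule taylor_inject) (simp add: G'_def taylor_add taylor_scaleC taylor_S
          bounded_clinear_add[OF bG] bounded_clinear_add[OF bB] bounded_clinear_add[OF bounded_clinear_S] algebra_simps)
    show "G' (c *\<^sub>C u) = c *\<^sub>C G' u" for c u
      by (rule taylor_inject) (simp add: G'_def taylor_add taylor_scaleC taylor_S
          bounded_clinear_scaleC[OF bG] bounded_clinear_scaleC[OF bB] bounded_clinear_scaleC[OF bounded_clinear_S] algebra_simps)
  qed
  ultimately have "hankel_contraction M G'"
    using norm_G' by (simp add: hankel_contraction_def)
  then show ?thesis using ext by blast
qed

section \<open>Nehari's theorem\<close>

text \<open>The matrix itself fixes the negative Fourier coefficients of the symbol; the successive
  extensions supply the others.\<close>

lemma nehari:
  assumes G: "bounded_clinear G"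
    and hankel: "\<And>i j. taylor (G (H2_monom j)) (Suc i) = taylor (G (H2_monom (Suc j))) i"
  shows "\<exists>\<phi>\<in>Linf. G = hankel \<phi>"
proof -
  obtain M where M: "M \<ge> 0" "\<And>x. norm (G x) \<le> M * norm x"
    using bounded_clinear_bound[OF G] by blast
  \<comment> \<open>By dependent choice \<open>\<Gamma> n\<close> is \<open>G\<close> with
    \<open>n\<close> new rows on top, always with the same bound \<open>M\<close>.\<close>
  have "\<exists>\<Gamma>. \<forall>n. (hankel_contraction M (\<Gamma> n) \<and> (n = 0 \<longrightarrow> \<Gamma> n = G)) \<and>
      (\<forall>i j. taylor (\<Gamma> (Suc n) (H2_monom j)) (Suc i) = taylor (\<Gamma> n (H2_monom j)) i)"
  proof (rule dependent_nat_choice)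
    show "\<exists>G'. hankel_contraction M G' \<and> (0 = 0 \<longrightarrow> G' = G)"
      using M G hankel by (auto simp: hankel_contraction_def)
  qed (use hankel_extension[OF M(1)] in auto)
  then obtain \<Gamma> where \<Gamma>: "\<And>n. hankel_contraction M (\<Gamma> n)" and \<Gamma>0: "\<Gamma> 0 = G"
    and ext: "\<And>n i j. taylor (\<Gamma> (Suc n) (H2_monom j)) (Suc i) = taylor (\<Gamma> n (H2_monom j)) i"
    by metis
  have bM: "bounded_clinear (\<Gamma> n)" "norm (\<Gamma> n x) \<le> M * norm x" for n x
    using \<Gamma>[of n] by (auto simp: hankel_contraction_def)
  \<comment> \<open>For k >= 0 this is column 0 of \<open>G\<close>; for k < 0 it is the corner
    entry that was chosen at extension number -k.\<close>
  define h where "h k = taylor (\<Gamma> (nat (- k)) (H2_monom 0)) (nat k)" for k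
  have h0: "taylor (\<Gamma> n (H2_monom 0)) i = h (int i - int n)" for n i
  proof (induction n arbitrary: i)
    case (Suc n)
    show ?case
    proof (cases i)
      case 0
      then show ?thesis by (simp add: h_def nat_add_distrib)
    next
      case (Suc i')
      then show ?thesis by (simp add: ext Suc.IH)
    qed
  qed (simp add: h_def)
  have h: "taylor (\<Gamma> n (H2_monom j)) i = h (int i + int j - int n)" for n i j
  proof (induction j arbitrary: i)
    case (Suc j)
    have "taylor (\<Gamma> n (H2_monom (Suc j))) i = taylor (\<Gamma> n (H2_monom j)) (Suc i)"
      using \<Gamma>[of n] by (simp add: hankel_contraction_def)
    then show ?case by (simp add: Suc.IH algebra_simps)
  qed (simp add: h0)
  have "\<exists>\<phi>\<in>Linf. \<forall>k. fourier \<phi> k = h (- k - 1)"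
  proof (rule Linf_of_bounded_form)
    fix N
    \<comment> \<open>Column 0 of \<open>\<Gamma> (Suc N)\<close> starts at h(-N-1), so its rows 0
      to 2N contain every summand.\<close>
    have "(\<Sum>k\<in>{- int N..int N}. (cmod (h (- k - 1)))\<^sup>2)
        = (\<Sum>i\<le>2 * N. (cmod (taylor (\<Gamma> (Suc N) (H2_monom 0)) i))\<^sup>2)"
      by (rule sum.reindex_bij_witness[of _ "\<lambda>i. int N - int i" "\<lambda>k. nat (int N - k)"]) (auto simp: h)
    then show "(\<Sum>k\<in>{- int N..int N}. (cmod (h (- k - 1)))\<^sup>2) \<le> M\<^sup>2"
      using matrix_column_bound[of "\<Gamma> (Suc N)" M, OF bM(2) M(1)] by simp
  next
    fix N and a :: "nat \<Rightarrow> complex"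
    have rev: "(\<Sum>i\<le>N. f (N - i)) = (\<Sum>i\<le>N. f i)" for f :: "nat \<Rightarrow> 'b::comm_monoid_add"
      by (rule sum.reindex_bij_witness[of _ "\<lambda>i. N - i" "\<lambda>i. N - i"]) auto
    \<comment> \<open>Reversing the rows turns a Hankel matrix into a Toeplitz matrix: entry (N - i,
      j) of \<open>\<Gamma> (Suc N)\<close> is h(j - i - 1). The reversal is absorbed into the
      second vector of \<open>matrix_form_bound\<close>.\<close>
    have "(\<Sum>i\<le>N. \<Sum>j\<le>N. h (- (int i - int j) - 1) * a j * cnj (a i))
        = (\<Sum>i\<le>N. \<Sum>j\<le>N. taylor (\<Gamma> (Suc N) (H2_monom j)) (N - i) * a j * cnj (a (N - (N - i))))"
      by (intro sum.cong refl) (auto simp: h of_nat_diff intro!: arg_cong[where f = h])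
    also have "\<dots> = (\<Sum>i\<le>N. \<Sum>j\<le>N. taylor (\<Gamma> (Suc N) (H2_monom j)) i * a j * cnj (a (N - i)))"
      by (rule rev[of "\<lambda>i. \<Sum>j\<le>N. taylor (\<Gamma> (Suc N) (H2_monom j)) i * a j * cnj (a (N - i))"])
    finally show "cmod (\<Sum>i\<le>N. \<Sum>j\<le>N. h (- (int i - int j) - 1) * a j * cnj (a i)) \<le> M * (\<Sum>i\<le>N. (cmod (a i))\<^sup>2)"
      using matrix_form_bound[OF bM(1)[of "Suc N"] bM(2)[of "Suc N"] M(1), where N = N and a = a and b = "\<lambda>i. a (N - i)"]
      by (simp add: rev[of "\<lambda>i. (cmod (a i))\<^sup>2"])
  qed
  then obtain \<phi> where \<phi>: "\<phi> \<in> Linf" "\<And>k. fourier \<phi> k = h (- k - 1)" by blast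
  then have "G = hankel \<phi>"
    by (intro operator_eqI G bounded_clinear_hankel)
      (simp_all add: taylor_hankel h[of 0, unfolded \<Gamma>0])
  with \<phi>(1) show ?thesis by blast
qed


section \<open>The structure theorem\<close>

lemma parity_cases:
  obtains p where "n = 2 * p" | p where "n = 2 * p + (1::nat)"
  by (metis even_two_times_div_two odd_two_times_div_two_succ)

lemma operator_eq_iff:
  fixes A B :: "H2 \<Rightarrow> H2"
  assumes "bounded_clinear A" "bounded_clinear B"
  shows "A = B \<longleftrightarrow> (\<forall>i j. taylor (A (H2_monom j)) i = taylor (B (H2_monom j)) i)"
  using operator_eqI[OF assms] by auto

lemma bounded_clinear_conj_U:
  assumes "bounded_clinear A" "bounded_clinear B" "bounded_clinear C" "bounded_clinear D"
  shows "bounded_clinear (cadjoint U_H2 \<circ> block_op A B C D \<circ> U_H2)"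
  by (intro bounded_clinear_comp bounded_clinear_cadjoint bounded_clinear_U bounded_clinear_block_op assms)

lemma taylor_conj_U:
  fixes A B C D :: "H2 \<Rightarrow> H2"
  assumes "A 0 = 0" "B 0 = 0" "C 0 = 0" "D 0 = 0"
  shows "taylor ((cadjoint U_H2 \<circ> block_op A B C D \<circ> U_H2) (H2_monom (2 * j))) (2 * i) = taylor (A (H2_monom j)) i"
    "taylor ((cadjoint U_H2 \<circ> block_op A B C D \<circ> U_H2) (H2_monom (2 * j + 1))) (2 * i) = taylor (B (H2_monom j)) i"
    "taylor ((cadjoint U_H2 \<circ> block_op A B C D \<circ> U_H2) (H2_monom (2 * j))) (2 * i + 1) = taylor (C (H2_monom j)) i"
    "taylor ((cadjoint U_H2 \<circ> block_op A B C D \<circ> U_H2) (H2_monom (2 * j + 1))) (2 * i + 1) = taylor (D (H2_monom j)) i"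
  unfolding comp_apply U_monom taylor_cadjoint_U using assms by (simp_all add: block_op_def)

text \<open>Conjugation by \<open>U_H2\<close> interleaves the matrices of the four blocks: the
  parities of the row and column index select the block, their halves select the entry.\<close>

lemma eq_conj_U_iff:
  fixes A B C D E :: "H2 \<Rightarrow> H2"
  assumes ops: "bounded_clinear A" "bounded_clinear B" "bounded_clinear C" "bounded_clinear D"
    and E: "bounded_clinear E"
  shows "E = cadjoint U_H2 \<circ> block_op A B C D \<circ> U_H2 \<longleftrightarrow> (\<forall>i j.
    taylor (E (H2_monom (2 * j))) (2 * i) = taylor (A (H2_monom j)) i \<and>
    taylor (E (H2_monom (2 * j + 1))) (2 * i) = taylor (B (H2_monom j)) i \<and>
    taylor (E (H2_monom (2 * j))) (2 * i + 1) = taylor (C (H2_monom j)) i \<and>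
    taylor (E (H2_monom (2 * j + 1))) (2 * i + 1) = taylor (D (H2_monom j)) i)" (is "_ = ?R")
proof
  note * = taylor_conj_U[of A B C D, OF ops[THEN bounded_clinear_zero]]
  show ?R if "E = cadjoint U_H2 \<circ> block_op A B C D \<circ> U_H2"
    unfolding that * by simp
  show "E = cadjoint U_H2 \<circ> block_op A B C D \<circ> U_H2" if R: ?R
  proof (rule operator_eqI[OF E bounded_clinear_conj_U[OF ops]])
    fix i j
    show "taylor (E (H2_monom j)) i = taylor ((cadjoint U_H2 \<circ> block_op A B C D \<circ> U_H2) (H2_monom j)) i"
      by (cases i rule: parity_cases; cases j rule: parity_cases) (simp_all only: R * simp_thms)
  qed
qed

section \<open>Restriction to index parities\<close>

text \<open>\<open>True\<close> stands for the odd indices.\<close>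

definition embed_parity :: "bool \<Rightarrow> H2 \<Rightarrow> H2" where
  "embed_parity b x = cadjoint U_H2 (if b then (0, x) else (x, 0))"

definition project_parity :: "bool \<Rightarrow> H2 \<Rightarrow> H2" where
  "project_parity b x = (if b then snd (U_H2 x) else fst (U_H2 x))"

lemma bounded_clinear_embed: "bounded_clinear (embed_parity b)"
proof -
  have "bounded_clinear (cadjoint U_H2 \<circ> (\<lambda>x. (0, x)))" "bounded_clinear (cadjoint U_H2 \<circ> (\<lambda>x. (x, 0)))"
    by (intro bounded_clinear_comp bounded_clinear_cadjoint bounded_clinear_U bounded_clinear_Pair
        bounded_clinear_zero_op bounded_clinear_id)+
  then show ?thesis by (cases b) (simp_all add: embed_parity_def[abs_def] o_def)
qed

lemma bounded_clinear_project: "bounded_clinear (project_parity b)"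
proof -
  have "bounded_clinear (fst \<circ> U_H2)" "bounded_clinear (snd \<circ> U_H2)"
    by (intro bounded_clinear_comp bounded_clinear_U bounded_clinear_fst bounded_clinear_snd)+
  then show ?thesis by (cases b) (simp_all add: project_parity_def[abs_def] o_def)
qed

lemma embed_monom: "embed_parity b (H2_monom n) = H2_monom (2 * n + of_bool b)"
proof (rule taylor_inject)
  fix k
  show "taylor (embed_parity b (H2_monom n)) k = taylor (H2_monom (2 * n + of_bool b)) k"
  proof (cases k rule: parity_cases)
    fix p assume k: "k = 2 * p"
    show ?thesis unfolding k embed_parity_def taylor_cadjoint_U by (cases b) (auto, presburger+)
  next
    fix p assume k: "k = 2 * p + 1"
    show ?thesis unfolding k embed_parity_def taylor_cadjoint_U by (cases b) (auto, presburger+)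
  qed
qed

text \<open>The submatrix with row parity \<open>b\<close> and column parity \<open>c\<close>.
  Writing it as a composition of operators makes its boundedness immediate, as
  \<open>brown_halmos\<close> and \<open>nehari\<close> require.\<close>

definition parity_block :: "bool \<Rightarrow> bool \<Rightarrow> (H2 \<Rightarrow> H2) \<Rightarrow> H2 \<Rightarrow> H2" where
  "parity_block b c A = project_parity b \<circ> A \<circ> embed_parity c"

lemma bounded_clinear_parity_block: "bounded_clinear A \<Longrightarrow> bounded_clinear (parity_block b c A)"
  unfolding parity_block_def
  by (intro bounded_clinear_comp bounded_clinear_embed bounded_clinear_project)

lemma taylor_parity_block:
  "taylor (parity_block b c A (H2_monom j)) i = taylor (A (H2_monom (2 * j + of_bool c))) (2 * i + of_bool b)"
  by (simp add: parity_block_def embed_monom project_parity_def taylor_U)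

text \<open>The conjugate of \<open>f\<close> occupies the indices k <= 0 and the shifted
  \<open>f\<close> the indices k >= 1, without overlap; hence the coefficients at k and 1 - k are
  conjugate.\<close>

lemma fourier_conj_plus_z:
  "fourier (conj_plus_z f) k = (if k \<le> 0 then cnj (taylor f (nat (- k))) else taylor f (nat (k - 1)))"
  by (auto simp: conj_plus_z_def fourier_add fourier_conj fourier_mult_z fourier_of_H2)

lemma Hinf_iff: "\<phi> \<in> Hinf \<longleftrightarrow> \<phi> \<in> Linf \<and> (\<forall>k<0. fourier \<phi> k = 0)"
  using Abs_H2_inverse[of \<phi>] of_H2 by (auto simp: Hinf_def image_iff) metis

text \<open>The relation links position (i, j) to (j + 1, i + 1), and applied twice it moves by (2,
  2). Every parity class is therefore a Toeplitz matrix, and the single application relates the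
  classes or gives a symmetry within one of them.\<close>

lemma diagonal_block_iff:
  fixes A :: "H2 \<Rightarrow> H2"
  assumes A: "bounded_clinear A"
  shows "(\<forall>i j. taylor (A (H2_monom j)) i = cnj (taylor (A (H2_monom (Suc i))) (Suc j))) \<and>
      (\<forall>i. taylor (A (H2_monom 0)) (Suc i) = 0) \<longleftrightarrow>
    (\<exists>\<phi>\<in>Hinf. \<exists>f. conj_plus_z f \<in> Linf \<and>
      A = cadjoint U_H2 \<circ> block_op (cadjoint (toeplitz \<phi>)) (toeplitz (conj_plus_z f))
        (\<lambda>_. 0) (toeplitz \<phi>) \<circ> U_H2)" (is "?L \<longleftrightarrow> ?R")
proof
  define a where "a i j = taylor (A (H2_monom j)) i" for i j
  assume L: ?L
  have cj: "a i j = cnj (a (Suc j) (Suc i))" and col0: "a (Suc i) 0 = 0" for i j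
    using L unfolding a_def by blast+
  have shift2: "a (i + 2) (j + 2) = a i j" for i j
    using cj[of i j] cj[of "Suc j" "Suc i"] by simp
  have shift: "a (i + 2 * k) (j + 2 * k) = a i j" for i j k
  proof (induction k)
    case (Suc k)
    then show ?case using shift2[of "i + 2 * k" "j + 2 * k"] by simp
  qed simp
  have Linf: "\<exists>\<phi>\<in>Linf. parity_block b c A = toeplitz \<phi>" for b c
    by (rule brown_halmos[OF bounded_clinear_parity_block[OF A]])
      (use shift2 in \<open>simp add: taylor_parity_block flip: a_def\<close>)
  obtain \<phi> where \<phi>: "\<phi> \<in> Linf" "parity_block True True A = toeplitz \<phi>" using Linf by blast
  have oo: "a (2 * i + 1) (2 * j + 1) = fourier \<phi> (int i - int j)" for i j
    using taylor_parity_block[of True True A j i] by (simp add: \<phi> taylor_toeplitz a_def)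
  obtain \<psi> where \<psi>: "\<psi> \<in> Linf" "parity_block False True A = toeplitz \<psi>" using Linf by blast
  have eo: "a (2 * i) (2 * j + 1) = fourier \<psi> (int i - int j)" for i j
    using taylor_parity_block[of False True A j i] by (simp add: \<psi> taylor_toeplitz a_def)
  have ee: "a (2 * i) (2 * j) = cnj (fourier \<phi> (int j - int i))" for i j
    using cj[of "2 * i" "2 * j"] oo[of j i] by simp
  \<comment> \<open>Entries below the diagonal are moved up to column 0. Those above it are first
    reflected, which keeps them in the odd-even class and brings them below the diagonal.\<close>
  have oe: "a (2 * i + 1) (2 * j) = 0" for i j
  proof (cases "j \<le> i")
    case True
    then show ?thesis using shift[of "2 * (i - j) + 1" j 0] col0[of "2 * (i - j)"] by (simp add: algebra_simps)
  next
    case False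
    then obtain d where "j = Suc (i + d)" using less_imp_Suc_add[of i j] by auto
    then have "a (2 * j + 1) (2 * (i + 1)) = 0"
      using shift[of "2 * d + 1" "i + 1" 0] col0[of "2 * d"] by (simp add: algebra_simps)
    then show ?thesis using cj[of "2 * i + 1" "2 * j"] by simp
  qed
  \<comment> \<open>Below the corner, column 0 of the even-even block lists the conjugates of the
    negative coefficients of \<open>\<phi>\<close>, so \<open>col0\<close> makes the symbol
    analytic.\<close>
  have "fourier \<phi> k = 0" if "k < 0" for k
    using ee[of "nat (- k)" 0] col0[of "2 * nat (- k) - 1"] that by simp
  then have Hinf: "\<phi> \<in> Hinf" using \<phi> by (simp add: Hinf_iff)
  \<comment> \<open>The relation maps the even-odd class to itself and exchanges its diagonals k and
    1 - k.\<close>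
  have \<psi>_sym: "fourier \<psi> k = cnj (fourier \<psi> (1 - k))" for k
    using eo[of "nat k" "nat (- k)"] cj[of "2 * nat k" "2 * nat (- k) + 1"] eo[of "nat (- k) + 1" "nat k"]
    by (cases "k \<ge> 0") (auto simp: algebra_simps)
  \<comment> \<open>By the symmetry, the half of \<open>\<psi>\<close> with indices k <= 0
    determines the other half; \<open>f\<close> is the conjugate of that half.\<close>
  define f where "f = P_H2 (conj_L2 \<psi>)"
  have tf: "taylor f n = fourier \<psi> (1 + int n)" for n
    using \<psi>_sym[of "1 + int n"] by (simp add: f_def taylor_P fourier_conj)
  have "conj_plus_z f = \<psi>"
  proof (rule fourier_inject)
    show "fourier (conj_plus_z f) k = fourier \<psi> k" for k
      by (cases "k \<le> 0") (simp_all add: fourier_conj_plus_z tf \<psi>_sym[of k, symmetric])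
  qed
  moreover have "A = cadjoint U_H2 \<circ> block_op (cadjoint (toeplitz \<phi>)) (toeplitz \<psi>) (\<lambda>_. 0) (toeplitz \<phi>) \<circ> U_H2"
    using \<phi>(1) \<psi>(1) ee oo eo oe
    by (subst eq_conj_U_iff)
      (simp_all add: A bounded_clinear_toeplitz bounded_clinear_cadjoint taylor_cadjoint_monom taylor_toeplitz a_def)
  ultimately show ?R using Hinf \<psi>(1) by blast
next
  define a where "a i j = taylor (A (H2_monom j)) i" for i j
  assume ?R
  then obtain \<phi> f where Hinf: "\<phi> \<in> Hinf" and f: "conj_plus_z f \<in> Linf"
    and Aeq: "A = cadjoint U_H2 \<circ> block_op (cadjoint (toeplitz \<phi>)) (toeplitz (conj_plus_z f))
        (\<lambda>_. 0) (toeplitz \<phi>) \<circ> U_H2" by blast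
  have \<phi>: "\<phi> \<in> Linf" "\<And>k. k < 0 \<Longrightarrow> fourier \<phi> k = 0" using Hinf by (simp_all add: Hinf_iff)
  let ?\<psi> = "conj_plus_z f"
  have m: "a (2 * i) (2 * j) = cnj (fourier \<phi> (int j - int i))"
    "a (2 * i) (2 * j + 1) = fourier ?\<psi> (int i - int j)"
    "a (2 * i + 1) (2 * j) = 0"
    "a (2 * i + 1) (2 * j + 1) = fourier \<phi> (int i - int j)" for i j
    using \<phi>(1) f iffD1[OF eq_conj_U_iff Aeq]
    by (simp_all add: A bounded_clinear_toeplitz bounded_clinear_cadjoint taylor_cadjoint_monom taylor_toeplitz a_def)
  have sym: "fourier ?\<psi> k = cnj (fourier ?\<psi> (1 - k))" for k
    by (simp add: fourier_conj_plus_z)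
  have "a i j = cnj (a (Suc j) (Suc i))" for i j
  proof (cases i rule: parity_cases; cases j rule: parity_cases)
    fix p q assume "i = 2 * p" "j = 2 * q"
    then show ?thesis using m(1)[of p q] m(4)[of q p] by simp
  next
    fix p q assume "i = 2 * p" "j = 2 * q + 1"
    then show ?thesis using m(2)[of p q] m(2)[of "q + 1" p] sym[of "int p - int q"] by (simp add: algebra_simps)
  next
    fix p q assume "i = 2 * p + 1" "j = 2 * q"
    then show ?thesis using m(3)[of p q] m(3)[of q "p + 1"] by simp
  next
    fix p q assume "i = 2 * p + 1" "j = 2 * q + 1"
    then show ?thesis using m(4)[of p q] m(1)[of "q + 1" "p + 1"] by simp
  qed
  moreover have "a (Suc i) 0 = 0" for i
  proof (cases i rule: parity_cases)
    fix p assume "i = 2 * p"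
    then show ?thesis using m(3)[of p 0] by simp
  next
    fix p assume "i = 2 * p + 1"
    then show ?thesis using m(1)[of "p + 1" 0] \<phi>(2)[of "- int (p + 1)"] by simp
  qed
  ultimately show ?L unfolding a_def by blast
qed

text \<open>Eliminating \<open>C\<close> shows that the entries of \<open>B\<close> are unchanged
  along antidiagonals in steps of two. The vanishing first columns of \<open>B\<close> and
  \<open>C\<close> then clear all but the even-odd class of \<open>B\<close>, which is a Hankel
  matrix, and \<open>C\<close> is recovered from \<open>B\<close> by conjugation.\<close>

lemma offdiagonal_block_iff:
  fixes B C :: "H2 \<Rightarrow> H2"
  assumes B: "bounded_clinear B" and C: "bounded_clinear C"
  shows "(\<forall>i. taylor (B (H2_monom 0)) i = 0) \<and> (\<forall>i. taylor (C (H2_monom 0)) i = 0) \<and>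
      (\<forall>i j. taylor (B (H2_monom (Suc j))) i = cnj (taylor (C (H2_monom (Suc i))) j)) \<and>
      (\<forall>i j. taylor (C (H2_monom j)) (Suc i) = cnj (taylor (B (H2_monom i)) (Suc j))) \<longleftrightarrow>
    (\<exists>\<phi>\<in>Linf. B = cadjoint U_H2 \<circ> block_op (\<lambda>_. 0) (hankel \<phi>) (\<lambda>_. 0) (\<lambda>_. 0) \<circ> U_H2 \<and>
      C = cadjoint U_H2 \<circ> block_op (\<lambda>_. 0) (cadjoint (hankel \<phi>)) (\<lambda>_. 0) (\<lambda>_. 0) \<circ> U_H2)" (is "?L \<longleftrightarrow> ?R")
proof
  define b where "b i j = taylor (B (H2_monom j)) i" for i j
  define c where "c i j = taylor (C (H2_monom j)) i" for i j
  assume L: ?L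
  have b0: "b i 0 = 0" and c0: "c i 0 = 0" and bc: "b i (Suc j) = cnj (c j (Suc i))"
    and cb: "c (Suc i) j = cnj (b (Suc j) i)" for i j
    using L unfolding b_def c_def by blast+
  have anti: "b i (j + 2) = b (i + 2) j" for i j
    using bc[of i "Suc j"] cb[of j "Suc i"] by simp
  \<comment> \<open>Column 0 of \<open>C\<close> reappears as row 1 of \<open>B\<close>; the steps
    along antidiagonals then spread its zeros to every odd row.\<close>
  have "b 1 m = 0" for m
    using cb[of m 0] c0[of "Suc m"] by simp
  note b1 = this
  have odd: "b (2 * i + 1) m = 0" for i m
  proof (induction i arbitrary: m)
    case (Suc i)
    then show ?case using anti[of "2 * i + 1" m] by simp
  qed (use b1 in simp)
  have even: "b i (2 * j) = 0" for i j
  proof (induction j arbitrary: i)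
    case (Suc j)
    then show ?case using anti[of i "2 * j"] by simp
  qed (use b0 in simp)
  have "\<exists>\<phi>\<in>Linf. parity_block False True B = hankel \<phi>"
    by (rule nehari[OF bounded_clinear_parity_block[OF B]])
      (use anti[of "2 * _" "2 * _ + 1"] in \<open>simp add: taylor_parity_block flip: b_def\<close>)
  then obtain \<phi> where \<phi>: "\<phi> \<in> Linf" "parity_block False True B = hankel \<phi>" by blast
  have eo: "b (2 * i) (2 * j + 1) = taylor (hankel \<phi> (H2_monom j)) i" for i j
    using taylor_parity_block[of False True B j i] by (simp add: \<phi> b_def)
  have c_eo: "c (2 * i) (2 * j + 1) = cnj (b (2 * j) (2 * i + 1))" for i j
    using bc[of "2 * j" "2 * i"] by simp
  have c_oo: "c (2 * i + 1) (2 * j + 1) = 0" for i j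
    using bc[of "2 * j" "2 * i + 1"] even[of "2 * j" "i + 1"] by simp
  have c_even: "c i (2 * j) = 0" for i j
  proof (cases j)
    case (Suc k)
    then show ?thesis using bc[of "2 * k + 1" i] odd[of k "Suc i"] by simp
  qed (simp add: c0)
  note c = c_eo c_oo c_even
  have "B = cadjoint U_H2 \<circ> block_op (\<lambda>_. 0) (hankel \<phi>) (\<lambda>_. 0) (\<lambda>_. 0) \<circ> U_H2"
    using \<phi>(1) odd even eo
    by (subst eq_conj_U_iff) (simp_all add: B bounded_clinear_hankel b_def)
  moreover have "C = cadjoint U_H2 \<circ> block_op (\<lambda>_. 0) (cadjoint (hankel \<phi>)) (\<lambda>_. 0) (\<lambda>_. 0) \<circ> U_H2"
    using \<phi>(1) c eo
    by (subst eq_conj_U_iff)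
      (simp_all add: C bounded_clinear_hankel bounded_clinear_cadjoint taylor_cadjoint_monom b_def c_def)
  ultimately show ?R using \<phi>(1) by blast
next
  define b where "b i j = taylor (B (H2_monom j)) i" for i j
  define c where "c i j = taylor (C (H2_monom j)) i" for i j
  assume ?R
  then obtain \<phi> where \<phi>: "\<phi> \<in> Linf"
    and Beq: "B = cadjoint U_H2 \<circ> block_op (\<lambda>_. 0) (hankel \<phi>) (\<lambda>_. 0) (\<lambda>_. 0) \<circ> U_H2"
    and Ceq: "C = cadjoint U_H2 \<circ> block_op (\<lambda>_. 0) (cadjoint (hankel \<phi>)) (\<lambda>_. 0) (\<lambda>_. 0) \<circ> U_H2" by blast
  define h where "h n = fourier \<phi> (- int n - 1)" for n
  have hk: "taylor (hankel \<phi> (H2_monom j)) i = h (i + j)" for i j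
    by (simp add: taylor_hankel[OF \<phi>] h_def)
  have mb: "b (2 * i) (2 * j) = 0" "b (2 * i) (2 * j + 1) = h (i + j)" "b (2 * i + 1) (2 * j) = 0" "b (2 * i + 1) (2 * j + 1) = 0" for i j
    using \<phi>(1) iffD1[OF eq_conj_U_iff Beq]
    by (simp_all add: B bounded_clinear_hankel hk b_def)
  have mc: "c (2 * i) (2 * j) = 0" "c (2 * i) (2 * j + 1) = cnj (h (i + j))" "c (2 * i + 1) (2 * j) = 0" "c (2 * i + 1) (2 * j + 1) = 0" for i j
    using \<phi>(1) iffD1[OF eq_conj_U_iff Ceq]
    by (simp_all add: C bounded_clinear_hankel bounded_clinear_cadjoint taylor_cadjoint_monom hk c_def add.commute)
  have b_if: "b i j = (if even i \<and> odd j then h (i div 2 + j div 2) else 0)" for i j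
    by (cases i rule: parity_cases; cases j rule: parity_cases) (simp_all only: mb, simp_all)
  have c_if: "c i j = (if even i \<and> odd j then cnj (h (i div 2 + j div 2)) else 0)" for i j
    by (cases i rule: parity_cases; cases j rule: parity_cases) (simp_all only: mc, simp_all)
  have "b i 0 = 0" "c i 0 = 0" "b i (Suc j) = cnj (c j (Suc i))" "c (Suc i) j = cnj (b (Suc j) i)" for i j
    unfolding b_if c_if
    by (cases i rule: parity_cases; cases j rule: parity_cases; simp add: add.commute)+
  then show ?L by (simp add: b_def c_def)
qed

section \<open>The intertwining relation in terms of matrix entries\<close>

lemma block_intertwining_iff:
  fixes A B C D :: "H2 \<Rightarrow> H2"
  assumes ops: "bounded_clinear A" "bounded_clinear B" "bounded_clinear C" "bounded_clinear D"
  shows "map_prod S_H2 (cadjoint S_H2) \<circ> block_op A B C D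
      = cadjoint (block_op A B C D) \<circ> map_prod S_H2 (cadjoint S_H2) \<longleftrightarrow>
    S_H2 \<circ> A = cadjoint A \<circ> S_H2 \<and> S_H2 \<circ> B = cadjoint C \<circ> cadjoint S_H2 \<and>
    cadjoint S_H2 \<circ> C = cadjoint B \<circ> S_H2 \<and> cadjoint S_H2 \<circ> D = cadjoint D \<circ> cadjoint S_H2"
proof -
  have bB: "bounded_clinear (cadjoint S_H2)" by (rule bounded_clinear_cadjoint[OF bounded_clinear_S])
  have adj: "cadjoint (block_op A B C D) = block_op (cadjoint A) (cadjoint C) (cadjoint B) (cadjoint D)"
    by (intro cadjoint_eqI is_adjoint_block_op adjoint_exists ops)
  have "map_prod S_H2 (cadjoint S_H2) \<circ> block_op A B C D
      = block_op (S_H2 \<circ> A) (S_H2 \<circ> B) (cadjoint S_H2 \<circ> C) (cadjoint S_H2 \<circ> D)"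
    by (auto simp: block_op_def bounded_clinear_add[OF bounded_clinear_S] bounded_clinear_add[OF bB])
  moreover have "cadjoint (block_op A B C D) \<circ> map_prod S_H2 (cadjoint S_H2)
      = block_op (cadjoint A \<circ> S_H2) (cadjoint C \<circ> cadjoint S_H2) (cadjoint B \<circ> S_H2) (cadjoint D \<circ> cadjoint S_H2)"
    unfolding adj by (auto simp: block_op_def)
  ultimately show ?thesis
    by (simp only:) (intro block_op_eq_iff bounded_clinear_comp bounded_clinear_cadjoint bounded_clinear_S ops)
qed

lemma taylor_adjoint_shift:
  assumes "bounded_clinear (A :: H2 \<Rightarrow> H2)"
  shows "taylor (cadjoint A (S_H2 (H2_monom j))) i = cnj (taylor (A (H2_monom i)) (Suc j))"
    "taylor (cadjoint A (cadjoint S_H2 (H2_monom j))) i = (if j = 0 then 0 else cnj (taylor (A (H2_monom i)) (j - 1)))"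
proof -
  show "taylor (cadjoint A (S_H2 (H2_monom j))) i = cnj (taylor (A (H2_monom i)) (Suc j))"
    by (simp add: S_monom taylor_cadjoint_monom assms)
  have "cadjoint S_H2 (H2_monom j) = (if j = 0 then 0 else H2_monom (j - 1))"
    by (rule taylor_inject) (auto simp: taylor_cadjoint_S)
  then show "taylor (cadjoint A (cadjoint S_H2 (H2_monom j))) i = (if j = 0 then 0 else cnj (taylor (A (H2_monom i)) (j - 1)))"
    using bounded_clinear_zero[OF bounded_clinear_cadjoint[OF assms]]
    by (simp add: taylor_cadjoint_monom assms)
qed

text \<open>Index 0, where a shift produces a zero, gives the vanishing conditions; successor
  indices give the relations between entries. The relation for \<open>D\<close> uses the backward
  shift where that for \<open>A\<close> uses the forward one, but after conjugating and exchanging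
  the indices the two conditions agree.\<close>

lemma intertwining_matrix:
  fixes A B C D :: "H2 \<Rightarrow> H2"
  assumes ops: "bounded_clinear A" "bounded_clinear B" "bounded_clinear C" "bounded_clinear D"
  shows "S_H2 \<circ> A = cadjoint A \<circ> S_H2 \<longleftrightarrow>
      (\<forall>i j. taylor (A (H2_monom j)) i = cnj (taylor (A (H2_monom (Suc i))) (Suc j))) \<and>
      (\<forall>i. taylor (A (H2_monom 0)) (Suc i) = 0)" (is "?A")
    and "cadjoint S_H2 \<circ> D = cadjoint D \<circ> cadjoint S_H2 \<longleftrightarrow>
      (\<forall>i j. taylor (D (H2_monom j)) i = cnj (taylor (D (H2_monom (Suc i))) (Suc j))) \<and>
      (\<forall>i. taylor (D (H2_monom 0)) (Suc i) = 0)" (is "?D")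
    and "S_H2 \<circ> B = cadjoint C \<circ> cadjoint S_H2 \<and> cadjoint S_H2 \<circ> C = cadjoint B \<circ> S_H2 \<longleftrightarrow>
      (\<forall>i. taylor (B (H2_monom 0)) i = 0) \<and> (\<forall>i. taylor (C (H2_monom 0)) i = 0) \<and>
      (\<forall>i j. taylor (B (H2_monom (Suc j))) i = cnj (taylor (C (H2_monom (Suc i))) j)) \<and>
      (\<forall>i j. taylor (C (H2_monom j)) (Suc i) = cnj (taylor (B (H2_monom i)) (Suc j)))" (is "?BC")
proof -
  have Suc_split: "(\<forall>i::nat. P i) \<longleftrightarrow> P 0 \<and> (\<forall>i. P (Suc i))" for P
    by (metis not0_implies_Suc)
  have cnj_flip: "x = cnj y \<longleftrightarrow> y = cnj x" for x y by auto
  have bounded: "bounded_clinear (S_H2 \<circ> X)" "bounded_clinear (X \<circ> S_H2)"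
    "bounded_clinear (cadjoint S_H2 \<circ> X)" "bounded_clinear (X \<circ> cadjoint S_H2)"
    "bounded_clinear (cadjoint X)" if "bounded_clinear X" for X :: "H2 \<Rightarrow> H2"
    using that by (intro bounded_clinear_comp bounded_clinear_cadjoint bounded_clinear_S; simp)+
  have "S_H2 \<circ> A = cadjoint A \<circ> S_H2 \<longleftrightarrow>
      (\<forall>i j. (if i = 0 then 0 else taylor (A (H2_monom j)) (i - 1)) = cnj (taylor (A (H2_monom i)) (Suc j)))"
    using ops by (subst operator_eq_iff) (simp_all add: bounded taylor_S taylor_adjoint_shift)
  also have "\<dots> \<longleftrightarrow> (\<forall>j. taylor (A (H2_monom 0)) (Suc j) = 0) \<and>
      (\<forall>i j. taylor (A (H2_monom j)) i = cnj (taylor (A (H2_monom (Suc i))) (Suc j)))"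
    by (subst Suc_split) (simp add: eq_commute[of 0])
  finally show ?A by blast
  have "cadjoint S_H2 \<circ> D = cadjoint D \<circ> cadjoint S_H2 \<longleftrightarrow>
      (\<forall>j i. taylor (D (H2_monom j)) (Suc i) = (if j = 0 then 0 else cnj (taylor (D (H2_monom i)) (j - 1))))"
    using ops by (subst operator_eq_iff) (auto simp: bounded taylor_cadjoint_S taylor_adjoint_shift)
  also have "\<dots> \<longleftrightarrow> (\<forall>i. taylor (D (H2_monom 0)) (Suc i) = 0) \<and>
      (\<forall>j i. taylor (D (H2_monom (Suc j))) (Suc i) = cnj (taylor (D (H2_monom i)) j))"
    by (subst Suc_split) simp
  finally show ?D using cnj_flip by blast
  have 1: "S_H2 \<circ> B = cadjoint C \<circ> cadjoint S_H2 \<longleftrightarrow>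
      (\<forall>i j. (if i = 0 then 0 else taylor (B (H2_monom j)) (i - 1))
        = (if j = 0 then 0 else cnj (taylor (C (H2_monom i)) (j - 1))))"
    using ops by (subst operator_eq_iff) (simp_all add: bounded taylor_S taylor_adjoint_shift)
  have 2: "cadjoint S_H2 \<circ> C = cadjoint B \<circ> S_H2 \<longleftrightarrow>
      (\<forall>i j. taylor (C (H2_monom j)) (Suc i) = cnj (taylor (B (H2_monom i)) (Suc j)))"
    using ops by (subst operator_eq_iff) (simp_all add: bounded taylor_cadjoint_S taylor_adjoint_shift)
  show ?BC
    unfolding 1 2 by (subst (1 2) Suc_split) (auto simp: all_simps Suc_split[of "\<lambda>j. _ = (if j = 0 then _ else _ j)"])
qed

theorem theorem3p8:
  fixes Y :: "H2 \<times> H2 \<Rightarrow> H2 \<times> H2"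
  assumes "bounded_clinear Y"
  shows "map_prod S_H2 (cadjoint S_H2) \<circ> Y = cadjoint Y \<circ> map_prod S_H2 (cadjoint S_H2) \<longleftrightarrow>
    (\<exists>\<phi>11\<in>Hinf. \<exists>\<phi>22\<in>Hinf. \<exists>f g :: H2. \<exists>\<phi>12\<in>Linf.
      conj_plus_z f \<in> Linf \<and> conj_plus_z g \<in> Linf \<and>
      (let T11 = block_op (cadjoint (toeplitz \<phi>11)) (toeplitz (conj_plus_z f))
                          (\<lambda>_. 0)                   (toeplitz \<phi>11);
           T22 = block_op (cadjoint (toeplitz \<phi>22)) (toeplitz (conj_plus_z g))
                          (\<lambda>_. 0)                   (toeplitz \<phi>22);
           T12 = block_op (\<lambda>_. 0) (hankel \<phi>12)
                          (\<lambda>_. 0) (\<lambda>_. 0);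
           T21 = block_op (\<lambda>_. 0) (cadjoint (hankel \<phi>12))
                          (\<lambda>_. 0) (\<lambda>_. 0)
       in Y = block_op (cadjoint U_H2 \<circ> T11 \<circ> U_H2) (cadjoint U_H2 \<circ> T12 \<circ> U_H2)
                       (cadjoint U_H2 \<circ> T21 \<circ> U_H2) (cadjoint U_H2 \<circ> T22 \<circ> U_H2)))"
proof -
  define A B C D where "A = fst \<circ> Y \<circ> (\<lambda>x. (x, 0))" and "B = fst \<circ> Y \<circ> (\<lambda>x. (0, x))"
    and "C = snd \<circ> Y \<circ> (\<lambda>x. (x, 0))" and "D = snd \<circ> Y \<circ> (\<lambda>x. (0, x))"
  have ops: "bounded_clinear A" "bounded_clinear B" "bounded_clinear C" "bounded_clinear D"
    unfolding A_def B_def C_def D_def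
    by (intro bounded_clinear_comp bounded_clinear_fst bounded_clinear_snd assms bounded_clinear_Pair
        bounded_clinear_id bounded_clinear_zero_op)+
  have Y: "Y = block_op A B C D"
  proof (rule ext, safe)
    fix x y
    have "Y (x, y) = Y (x, 0) + Y (0, y)"
      using bounded_clinear_add[OF assms, of "(x, 0)" "(0, y)"] by simp
    then show "Y (x, y) = block_op A B C D (x, y)"
      by (simp add: block_op_def A_def B_def C_def D_def prod_eq_iff)
  qed
  let ?T = "\<lambda>\<phi> f. cadjoint U_H2 \<circ> block_op (cadjoint (toeplitz \<phi>)) (toeplitz (conj_plus_z f))
    (\<lambda>_. 0) (toeplitz \<phi>) \<circ> U_H2"
  let ?H = "\<lambda>h. cadjoint U_H2 \<circ> block_op (\<lambda>_. 0) h (\<lambda>_. 0) (\<lambda>_. 0) \<circ> U_H2"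
  have blocks: "Y = block_op (?T \<phi>11 f) (?H (hankel \<phi>12)) (?H (cadjoint (hankel \<phi>12))) (?T \<phi>22 g) \<longleftrightarrow>
    A = ?T \<phi>11 f \<and> B = ?H (hankel \<phi>12) \<and> C = ?H (cadjoint (hankel \<phi>12)) \<and> D = ?T \<phi>22 g"
    if "\<phi>11 \<in> Hinf" "\<phi>22 \<in> Hinf" "\<phi>12 \<in> Linf" "conj_plus_z f \<in> Linf" "conj_plus_z g \<in> Linf" for \<phi>11 \<phi>22 \<phi>12 f g
    unfolding Y using that
    by (intro block_op_eq_iff ops bounded_clinear_conj_U bounded_clinear_cadjoint bounded_clinear_toeplitz
        bounded_clinear_hankel bounded_clinear_zero_op) (simp_all add: Hinf_iff)
  have "map_prod S_H2 (cadjoint S_H2) \<circ> Y = cadjoint Y \<circ> map_prod S_H2 (cadjoint S_H2) \<longleftrightarrow>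
    S_H2 \<circ> A = cadjoint A \<circ> S_H2 \<and> cadjoint S_H2 \<circ> D = cadjoint D \<circ> cadjoint S_H2 \<and>
    (S_H2 \<circ> B = cadjoint C \<circ> cadjoint S_H2 \<and> cadjoint S_H2 \<circ> C = cadjoint B \<circ> S_H2)"
    unfolding Y block_intertwining_iff[OF ops] by blast
  \<comment> \<open>The conditions on \<open>A\<close>, on \<open>D\<close> and on the pair of
    \<open>B\<close> and \<open>C\<close> share no parameter, so the symbols can be chosen
    independently.\<close>
  also have "\<dots> \<longleftrightarrow>
    (\<exists>\<phi>\<in>Hinf. \<exists>f. conj_plus_z f \<in> Linf \<and> A = ?T \<phi> f) \<and>
    (\<exists>\<phi>\<in>Hinf. \<exists>f. conj_plus_z f \<in> Linf \<and> D = ?T \<phi> f) \<and>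
    (\<exists>\<phi>\<in>Linf. B = ?H (hankel \<phi>) \<and> C = ?H (cadjoint (hankel \<phi>)))"
    unfolding intertwining_matrix[OF ops] diagonal_block_iff[OF ops(1)] diagonal_block_iff[OF ops(4)]
      offdiagonal_block_iff[OF ops(2,3)] ..
  finally show ?thesis
    unfolding Let_def using blocks by meson
qed

end
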